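(* Let $(W,\Phi)$ be a $\phi$-module over $K$ which is $\partial$-integrable. Then $W$ is solvable, i.e. there is a filtration $0=W_0\subset W_1\subset\cdots\subset W_n=W$ by $\Phi$-stable $K$-subspaces with $\dim_K W_i=i$. Moreover, if $\nabla$ is any $\partial$-connection on $W$ with $\nabla\circ\Phi=q\,\Phi\circ\nabla$, such a filtration exists in which each $W_i$ is also stable under $\nabla$.
   Context: Fix a lattice $\Lambda_0\subset\mathbb{C}$, its commensurability class $\mathfrak{L}$, $K_\Lambda$ the field of $\Lambda$-periodic meromorphic functions, $K=\bigcup_{\Lambda\in\mathfrak{L}}K_\Lambda$; fix an integer $q\ge2$, $\phi f(z)=f(qz)$, $\partial=d/dz$. A $\phi$-module over $K$ is a finite-dimensional $K$-vector space $W$ with a bijective additive map $\Phi:W\to W$ such that $\Phi(aw)=\phi(a)\Phi(w)$ for $a\in K$. A $\partial$-connection on $W$ is an additive map $\nabla:W\to W$ with $\nabla(aw)=\partial(a)w+a\nabla(w)$. The $\phi$-module $W$ is called $\partial$-integrable if there exists a $\partial$-connection $\nabla$ on $W$ with $\nabla\circ\Phi=q\,\Phi\circ\nabla$ (equivalently, for a matrix $A$ of the associated system $\phi(y)=Ay$, there is $B\in\mathfrak{gl}_n(K)$ with $\partial(A)=q\phi(B)A-AB$). *)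

theory Defs
  imports
    "HOL-Complex_Analysis.Complex_Analysis"
    "Jordan_Normal_Form.Missing_VectorSpace"
begin

text \<open>Linear independence is over the reals, as a lattice has two real-independent generators.\<close>

definition complex_lattice :: "complex set \<Rightarrow> bool" where
  "complex_lattice \<Lambda> \<longleftrightarrow>
     (\<exists>\<omega>1 \<omega>2. \<omega>1 \<noteq> \<omega>2 \<and> independent {\<omega>1, \<omega>2} \<and>
        \<Lambda> = {of_int m * \<omega>1 + of_int n * \<omega>2 | m n :: int. True})"

text \<open>For additive subgroups: there are finitely many cosets \<open>x + H\<close> with \<open>x \<in> G\<close>.\<close>

definition finite_index :: "complex set \<Rightarrow> complex set \<Rightarrow> bool" where
  "finite_index H G \<longleftrightarrow> H \<subseteq> G \<and> finite ((\<lambda>x. (+) x ` H) ` G)"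

definition commensurable :: "complex set \<Rightarrow> complex set \<Rightarrow> bool" where
  "commensurable \<Lambda> \<Lambda>' \<longleftrightarrow> finite_index (\<Lambda> \<inter> \<Lambda>') \<Lambda> \<and> finite_index (\<Lambda> \<inter> \<Lambda>') \<Lambda>'"

definition commensurability_class :: "complex set \<Rightarrow> complex set set" where
  "commensurability_class \<Lambda>0 = {\<Lambda>. complex_lattice \<Lambda> \<and> commensurable \<Lambda> \<Lambda>0}"

text \<open>
  A meromorphic function on the complex plane is represented by its unique
  \<open>nicely_meromorphic_on\<close> representative, which is continuous away from its poles and
  takes the value 0 there. Pointwise operations can leave the set of such representatives
  (a sum may have a removable singularity), so they are followed by \<^const>\<open>remove_sings\<close>.
\<close>

definition periodic_meromorphic :: "complex set \<Rightarrow> (complex \<Rightarrow> complex) set" where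
  "periodic_meromorphic \<Lambda> =
     {f. f nicely_meromorphic_on UNIV \<and> (\<forall>w\<in>\<Lambda>. \<forall>z. f (z + w) = f z)}"

definition elliptic_field :: "complex set \<Rightarrow> (complex \<Rightarrow> complex) ring" where
  "elliptic_field \<Lambda>0 =
     \<lparr>carrier = (\<Union>\<Lambda> \<in> commensurability_class \<Lambda>0. periodic_meromorphic \<Lambda>),
      mult = (\<lambda>f g. remove_sings (\<lambda>z. f z * g z)),
      one = (\<lambda>_. 1),
      zero = (\<lambda>_. 0),
      add = (\<lambda>f g. remove_sings (\<lambda>z. f z + g z))\<rparr>"

definition dilation :: "nat \<Rightarrow> (complex \<Rightarrow> complex) \<Rightarrow> complex \<Rightarrow> complex" where
  "dilation q f = (\<lambda>z. f (of_nat q * z))"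

text \<open>At a pole, \<open>deriv f\<close> is unspecified; \<^const>\<open>remove_sings\<close> also corrects that value.\<close>

definition mero_deriv :: "(complex \<Rightarrow> complex) \<Rightarrow> complex \<Rightarrow> complex" where
  "mero_deriv f = remove_sings (deriv f)"

definition phi_module ::
  "complex set \<Rightarrow> nat \<Rightarrow> (complex \<Rightarrow> complex, 'w) module \<Rightarrow> ('w \<Rightarrow> 'w) \<Rightarrow> bool" where
  "phi_module \<Lambda>0 q W \<Phi> \<longleftrightarrow>
     vectorspace (elliptic_field \<Lambda>0) W \<and>
     vectorspace.fin_dim (elliptic_field \<Lambda>0) W \<and>
     bij_betw \<Phi> (carrier W) (carrier W) \<and>
     (\<forall>v \<in> carrier W. \<forall>w \<in> carrier W. \<Phi> (v \<oplus>\<^bsub>W\<^esub> w) = \<Phi> v \<oplus>\<^bsub>W\<^esub> \<Phi> w) \<and>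
     (\<forall>a \<in> carrier (elliptic_field \<Lambda>0). \<forall>w \<in> carrier W.
        \<Phi> (a \<odot>\<^bsub>W\<^esub> w) = dilation q a \<odot>\<^bsub>W\<^esub> \<Phi> w)"

definition connection ::
  "complex set \<Rightarrow> (complex \<Rightarrow> complex, 'w) module \<Rightarrow> ('w \<Rightarrow> 'w) \<Rightarrow> bool" where
  "connection \<Lambda>0 W D \<longleftrightarrow>
     D \<in> carrier W \<rightarrow> carrier W \<and>
     (\<forall>v \<in> carrier W. \<forall>w \<in> carrier W. D (v \<oplus>\<^bsub>W\<^esub> w) = D v \<oplus>\<^bsub>W\<^esub> D w) \<and>
     (\<forall>a \<in> carrier (elliptic_field \<Lambda>0). \<forall>w \<in> carrier W.
        D (a \<odot>\<^bsub>W\<^esub> w) = mero_deriv a \<odot>\<^bsub>W\<^esub> w \<oplus>\<^bsub>W\<^esub> a \<odot>\<^bsub>W\<^esub> D w)"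

text \<open>The integer \<open>q\<close> acts on \<open>W\<close> as the constant function with value \<open>q\<close>.\<close>

definition compatible ::
  "nat \<Rightarrow> (complex \<Rightarrow> complex, 'w) module \<Rightarrow> ('w \<Rightarrow> 'w) \<Rightarrow> ('w \<Rightarrow> 'w) \<Rightarrow> bool" where
  "compatible q W \<Phi> D \<longleftrightarrow>
     (\<forall>w \<in> carrier W. D (\<Phi> w) = (\<lambda>_. of_nat q) \<odot>\<^bsub>W\<^esub> \<Phi> (D w))"

definition integrable_phi_module ::
  "complex set \<Rightarrow> nat \<Rightarrow> (complex \<Rightarrow> complex, 'w) module \<Rightarrow> ('w \<Rightarrow> 'w) \<Rightarrow> bool" where
  "integrable_phi_module \<Lambda>0 q W \<Phi> \<longleftrightarrow> (\<exists>D. connection \<Lambda>0 W D \<and> compatible q W \<Phi> D)"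

definition full_filtration ::
  "complex set \<Rightarrow> (complex \<Rightarrow> complex, 'w) module \<Rightarrow> nat \<Rightarrow> (nat \<Rightarrow> 'w set) \<Rightarrow> bool" where
  "full_filtration \<Lambda>0 W n F \<longleftrightarrow>
     F 0 = {\<zero>\<^bsub>W\<^esub>} \<and> F n = carrier W \<and>
     (\<forall>i<n. F i \<subset> F (Suc i)) \<and>
     (\<forall>i\<le>n. VectorSpace.subspace (elliptic_field \<Lambda>0) (F i) W \<and>
             vectorspace.dim (elliptic_field \<Lambda>0) (W\<lparr>carrier := F i\<rparr>) = i)"

definition solvable_phi_module ::
  "complex set \<Rightarrow> (complex \<Rightarrow> complex, 'w) module \<Rightarrow> ('w \<Rightarrow> 'w) \<Rightarrow> bool" where
  "solvable_phi_module \<Lambda>0 W \<Phi> \<longleftrightarrow>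
     (\<exists>n F. full_filtration \<Lambda>0 W n F \<and> (\<forall>i\<le>n. \<Phi> ` F i \<subseteq> F i))"

lemma remove_sings_nicely:
  assumes "f nicely_meromorphic_on UNIV"
  shows "remove_sings f = f"
proof
  fix z
  show "remove_sings f z = f z"
    using assms unfolding nicely_meromorphic_on_def
    by (metis UNIV_I remove_sings_at_pole remove_sings_eqI)
qed

lemma remove_sings_cong_cosparse:
  assumes "eventually (\<lambda>z. f z = g z) (cosparse UNIV)"
  shows "remove_sings f = remove_sings g"
proof
  fix z
  have "eventually (\<lambda>z. f z = g z) (at z)"
    using assms by (simp add: eventually_cosparse_open_eq)
  then show "remove_sings f z = remove_sings g z"
    by (rule remove_sings_cong) simp
qed

lemma remove_sings_periodic:
  fixes w z :: complex
  assumes "\<And>z. h (z + w) = h z"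
  shows "remove_sings h (z + w) = remove_sings h z"
proof -
  have "filtermap (\<lambda>x. x - (- w)) (at z) = at (z - (- w))"
    by (rule filtermap_at_shift)
  then have "filtermap (\<lambda>x. x + w) (at z) = at (z + w)"
    by simp
  then have "remove_sings (h \<circ> (\<lambda>x. x + w)) z = remove_sings h (z + w)"
    by (rule remove_sings_compose)
  moreover have "h \<circ> (\<lambda>x. x + w) = h"
    using assms by auto
  ultimately show ?thesis by simp
qed

lemma lattice_multiple_subset:
  assumes "complex_lattice \<Lambda>1" "complex_lattice \<Lambda>2" "finite_index (\<Lambda>1 \<inter> \<Lambda>2) \<Lambda>2" 
  obtains N :: nat where "N > 0" "\<And>x k. x \<in> \<Lambda>2 \<Longrightarrow> of_nat (N * k) * x \<in> \<Lambda>1"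
proof -
  obtain a b where A: "\<Lambda>1 = {of_int m * a + of_int n * b | m n :: int. True}"
    using assms(1) unfolding complex_lattice_def by blast
  obtain c d where B: "\<Lambda>2 = {of_int m * c + of_int n * d | m n :: int. True}"
    using assms(2) unfolding complex_lattice_def by blast
  have diffI: "x - y \<in> \<Lambda>1" if "x \<in> \<Lambda>1" "y \<in> \<Lambda>1" for x y
  proof -
    obtain m n m' n' where xy: "x = of_int m * a + of_int n * b" "y = of_int m' * a + of_int n' * b"
      using \<open>x \<in> \<Lambda>1\<close> \<open>y \<in> \<Lambda>1\<close> A by blast
    then have "x - y = of_int (m - m') * a + of_int (n - n') * b"
      by (simp add: algebra_simps)
    then show ?thesis using A by blast
  qed
  have zero: "0 \<in> \<Lambda>1" unfolding A by (rule CollectI, rule exI[of _ 0], rule exI[of _ 0]) simp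
  have addI: "x + y \<in> \<Lambda>1" if "x \<in> \<Lambda>1" "y \<in> \<Lambda>1" for x y
    using diffI[OF that(1) diffI[OF zero that(2)]] by simp
  have multI: "of_nat k * x \<in> \<Lambda>1" if "x \<in> \<Lambda>1" for k x
    by (induction k) (auto simp: algebra_simps zero intro: addI that)
  have multI': "of_int k * x \<in> \<Lambda>1" if "x \<in> \<Lambda>1" for k x
  proof (cases "k \<ge> 0")
    case True
    then show ?thesis using multI[OF that, of "nat k"] by simp
  next
    case False
    then have "of_int k * x = 0 - of_nat (nat (- k)) * x" by simp
    then show ?thesis using multI[OF that] diffI[OF zero] by metis
  qed
  have mult2: "of_nat k * x \<in> \<Lambda>2" if x: "x \<in> \<Lambda>2" for k x
  proof -
    obtain m n where "x = of_int m * c + of_int n * d" using x B by blast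
    then have "of_nat k * x = of_int (int k * m) * c + of_int (int k * n) * d"
      by (simp add: algebra_simps)
    then show ?thesis using B by blast
  qed
  have ex: "\<exists>N>0. of_nat N * x \<in> \<Lambda>1" if x: "x \<in> \<Lambda>2" for x
  proof -
    have "range (\<lambda>k::nat. (+) (of_nat k * x) ` (\<Lambda>1 \<inter> \<Lambda>2)) \<subseteq> (\<lambda>x. (+) x ` (\<Lambda>1 \<inter> \<Lambda>2)) ` \<Lambda>2"
      using mult2[OF x] by auto
    then have "finite (range (\<lambda>k::nat. (+) (of_nat k * x) ` (\<Lambda>1 \<inter> \<Lambda>2)))"
      using assms(3) finite_subset unfolding finite_index_def by blast
    then have "\<not> inj (\<lambda>k::nat. (+) (of_nat k * x) ` (\<Lambda>1 \<inter> \<Lambda>2))"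
      using finite_imageD infinite_UNIV_nat by blast
    then obtain k l :: nat where kl: "k < l"
        "(+) (of_nat k * x) ` (\<Lambda>1 \<inter> \<Lambda>2) = (+) (of_nat l * x) ` (\<Lambda>1 \<inter> \<Lambda>2)"
      unfolding inj_on_def by (metis linorder_neqE_nat)
    have "0 \<in> \<Lambda>2" unfolding B by (rule CollectI, rule exI[of _ 0], rule exI[of _ 0]) simp
    then have "of_nat l * x + 0 \<in> (+) (of_nat l * x) ` (\<Lambda>1 \<inter> \<Lambda>2)"
      using zero by blast
    then obtain y where "y \<in> \<Lambda>1" "of_nat l * x + 0 = of_nat k * x + y"
      using kl(2) by blast
    then have "of_nat (l - k) * x \<in> \<Lambda>1"
      using kl(1) by (simp add: of_nat_diff algebra_simps)
    then show ?thesis using kl(1) by (intro exI[of _ "l - k"]) auto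
  qed
  have cd: "c \<in> \<Lambda>2" "d \<in> \<Lambda>2"
    unfolding B by (rule CollectI, rule exI[of _ 1], rule exI[of _ 0], simp)
                   (rule CollectI, rule exI[of _ 0], rule exI[of _ 1], simp)
  obtain N1 N2 where N: "N1 > 0" "of_nat N1 * c \<in> \<Lambda>1" "N2 > 0" "of_nat N2 * d \<in> \<Lambda>1"
    using ex[OF cd(1)] ex[OF cd(2)] by blast
  show ?thesis
  proof (rule that[of "N1 * N2"])
    show "N1 * N2 > 0" using N by simp
    fix x k assume "x \<in> \<Lambda>2"
    then obtain m n where "x = of_int m * c + of_int n * d" using B by blast
    then have "of_nat (N1 * N2 * k) * x =
        of_int (int N2 * int k * m) * (of_nat N1 * c) + of_int (int N1 * int k * n) * (of_nat N2 * d)"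
      by (simp add: algebra_simps)
    then show "of_nat (N1 * N2 * k) * x \<in> \<Lambda>1"
      using addI multI' N by metis
  qed
qed

lemma lattice_multiple_in_class:
  assumes "complex_lattice \<Lambda>0" "N > 0"
  shows "(*) (of_nat N) ` \<Lambda>0 \<in> commensurability_class \<Lambda>0"
proof -
  obtain a b where ab: "a \<noteq> b" "independent {a, b}"
    "\<Lambda>0 = {of_int m * a + of_int n * b | m n :: int. True}"
    using assms(1) unfolding complex_lattice_def by blast
  let ?M = "(*) (of_nat N) ` \<Lambda>0"
  have M: "?M = {of_int m * (of_nat N * a) + of_int n * (of_nat N * b) | m n :: int. True}"
  proof (intro equalityI subsetI)
    fix x assume "x \<in> ?M"
    then obtain m n where "x = of_nat N * (of_int m * a + of_int n * b)" using ab(3) by blast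
    then have "x = of_int m * (of_nat N * a) + of_int n * (of_nat N * b)"
      by (simp add: algebra_simps)
    then show "x \<in> {of_int m * (of_nat N * a) + of_int n * (of_nat N * b) | m n :: int. True}"
      by blast
  next
    fix x assume "x \<in> {of_int m * (of_nat N * a) + of_int n * (of_nat N * b) | m n :: int. True}"
    then obtain m n :: int where "x = of_int m * (of_nat N * a) + of_int n * (of_nat N * b)" by blast
    then have "x = of_nat N * (of_int m * a + of_int n * b)"
      by (simp add: algebra_simps)
    then show "x \<in> ?M" using ab(3) by blast
  qed
  have "linear ((*) (of_nat N) :: complex \<Rightarrow> complex)"
    by (auto intro!: linearI simp: algebra_simps)
  moreover have "inj ((*) (of_nat N) :: complex \<Rightarrow> complex)"
    using assms(2) by (auto simp: inj_on_def)
  ultimately have "independent ((*) (of_nat N) ` {a, b})"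
    using ab(2) by (meson inj_on_subset linear_independent_injective_image subset_UNIV)
  then have "complex_lattice ?M"
    unfolding complex_lattice_def using M ab(1) assms(2)
    by (intro exI[of _ "of_nat N * a"] exI[of _ "of_nat N * b"]) auto
  moreover have sub: "?M \<subseteq> \<Lambda>0"
  proof
    fix x assume "x \<in> ?M"
    then obtain m n :: int where "x = of_int m * (of_nat N * a) + of_int n * (of_nat N * b)"
      unfolding M by blast
    then have "x = of_int (m * int N) * a + of_int (n * int N) * b" by simp
    then show "x \<in> \<Lambda>0" using ab(3) by blast
  qed
  moreover have addM: "x + y \<in> ?M" if "x \<in> ?M" "y \<in> ?M" for x y
  proof -
    obtain m n m' n' :: int where "x = of_int m * (of_nat N * a) + of_int n * (of_nat N * b)"
      "y = of_int m' * (of_nat N * a) + of_int n' * (of_nat N * b)"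
      using \<open>x \<in> ?M\<close> \<open>y \<in> ?M\<close> unfolding M by blast
    then have "x + y = of_int (m + m') * (of_nat N * a) + of_int (n + n') * (of_nat N * b)"
      by (simp add: algebra_simps)
    then show ?thesis unfolding M by blast
  qed
  have negM: "- x \<in> ?M" if "x \<in> ?M" for x
  proof -
    obtain m n :: int where "x = of_int m * (of_nat N * a) + of_int n * (of_nat N * b)"
      using \<open>x \<in> ?M\<close> unfolding M by blast
    then have "- x = of_int (- m) * (of_nat N * a) + of_int (- n) * (of_nat N * b)"
      by (simp add: algebra_simps)
    then show ?thesis unfolding M by blast
  qed
  have coset: "(+) (x + y) ` ?M = (+) x ` ?M" if "y \<in> ?M" for x y
  proof (intro equalityI subsetI)
    fix u assume "u \<in> (+) (x + y) ` ?M"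
    then obtain v where "v \<in> ?M" "u = (x + y) + v" by blast
    then have v: "v \<in> ?M" "u = x + (y + v)" by (auto simp: add.assoc)
    then show "u \<in> (+) x ` ?M" using addM[OF that v(1)] by blast
  next
    fix u assume "u \<in> (+) x ` ?M"
    then obtain v where "v \<in> ?M" "u = x + v" by blast
    then have v: "v \<in> ?M" "u = (x + y) + (v + (- y))" by auto
    then show "u \<in> (+) (x + y) ` ?M" using addM[OF v(1) negM[OF that]] by blast
  qed
  have "(\<lambda>x. (+) x ` ?M) ` \<Lambda>0 \<subseteq>
      (\<lambda>(m, n). (+) (of_int m * a + of_int n * b) ` ?M) ` ({0..<int N} \<times> {0..<int N})"
  proof (rule image_subsetI)
    fix x assume "x \<in> \<Lambda>0"
    then obtain m n :: int where x: "x = of_int m * a + of_int n * b" using ab(3) by blast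
    let ?y = "of_int (m div int N) * (of_nat N * a) + of_int (n div int N) * (of_nat N * b)"
    let ?x = "of_int (m mod int N) * a + of_int (n mod int N) * b"
    have "(of_int m :: complex) = of_int (m mod int N + m div int N * int N)"
         "(of_int n :: complex) = of_int (n mod int N + n div int N * int N)"
      by simp_all
    then have "(of_int m :: complex) = of_int (m mod int N) + of_int (m div int N) * of_nat N"
         "(of_int n :: complex) = of_int (n mod int N) + of_int (n div int N) * of_nat N"
      by (simp_all only: of_int_add of_int_mult of_int_of_nat_eq)
    then have "x = ?x + ?y"
      unfolding x by (simp only: ) (simp add: algebra_simps)
    moreover have "?y \<in> ?M" unfolding M by blast
    ultimately have "(+) x ` ?M = (+) ?x ` ?M" using coset by metis
    moreover have "(m mod int N, n mod int N) \<in> {0..<int N} \<times> {0..<int N}"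
      using assms(2) by auto
    ultimately show "(+) x ` ?M \<in>
        (\<lambda>(m, n). (+) (of_int m * a + of_int n * b) ` ?M) ` ({0..<int N} \<times> {0..<int N})"
      by (intro image_eqI[of _ _ "(m mod int N, n mod int N)"]) auto
  qed
  then have fin: "finite ((\<lambda>x. (+) x ` ?M) ` \<Lambda>0)"
    by (rule finite_subset) auto
  have "(\<lambda>x. (+) x ` ?M) ` ?M \<subseteq> (\<lambda>x. (+) x ` ?M) ` \<Lambda>0"
    using sub by blast
  then have "finite ((\<lambda>x. (+) x ` ?M) ` ?M)" using fin finite_subset by blast
  then show ?thesis
    using fin sub \<open>complex_lattice ?M\<close>
    unfolding commensurability_class_def commensurable_def finite_index_def
    by (auto simp: Int_absorb2 image_image)
qed

lemma lattice_common_periods: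
  assumes "complex_lattice \<Lambda>0"
    and "\<Lambda>1 \<in> commensurability_class \<Lambda>0" "\<Lambda>2 \<in> commensurability_class \<Lambda>0"
  obtains \<Lambda> where "\<Lambda> \<in> commensurability_class \<Lambda>0" "\<Lambda> \<subseteq> \<Lambda>1" "\<Lambda> \<subseteq> \<Lambda>2"
proof -
  have c: "complex_lattice \<Lambda>1" "complex_lattice \<Lambda>2"
    "finite_index (\<Lambda>1 \<inter> \<Lambda>0) \<Lambda>0" "finite_index (\<Lambda>2 \<inter> \<Lambda>0) \<Lambda>0"
    using assms unfolding commensurability_class_def commensurable_def by auto
  obtain N1 N2 :: nat where N: "N1 > 0" "\<And>x k. x \<in> \<Lambda>0 \<Longrightarrow> of_nat (N1 * k) * x \<in> \<Lambda>1"
      "N2 > 0" "\<And>x k. x \<in> \<Lambda>0 \<Longrightarrow> of_nat (N2 * k) * x \<in> \<Lambda>2"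
    using lattice_multiple_subset[OF c(1) assms(1) c(3)]
      lattice_multiple_subset[OF c(2) assms(1) c(4)] by metis
  show ?thesis
  proof (rule that)
    show "(*) (of_nat (N1 * N2)) ` \<Lambda>0 \<in> commensurability_class \<Lambda>0"
      by (rule lattice_multiple_in_class[OF assms(1)]) (use N in simp)
    show "(*) (of_nat (N1 * N2)) ` \<Lambda>0 \<subseteq> \<Lambda>1" using N(2) by blast
    show "(*) (of_nat (N1 * N2)) ` \<Lambda>0 \<subseteq> \<Lambda>2" using N(4) by (metis image_subsetI mult.commute)
  qed
qed

lemma lattice_in_own_class:
  assumes "complex_lattice \<Lambda>0"
  shows "\<Lambda>0 \<in> commensurability_class \<Lambda>0"
  using lattice_multiple_in_class[OF assms, of 1] by simp

lemma elliptic_carrier_binop: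
  assumes "complex_lattice \<Lambda>0"
    and f: "f \<in> carrier (elliptic_field \<Lambda>0)" and g: "g \<in> carrier (elliptic_field \<Lambda>0)"
    and mero: "(\<lambda>z. h (f z) (g z)) meromorphic_on UNIV"
  shows "remove_sings (\<lambda>z. h (f z) (g z)) \<in> carrier (elliptic_field \<Lambda>0)"
proof -
  obtain \<Lambda>1 \<Lambda>2 where L: "\<Lambda>1 \<in> commensurability_class \<Lambda>0" "f \<in> periodic_meromorphic \<Lambda>1"
      "\<Lambda>2 \<in> commensurability_class \<Lambda>0" "g \<in> periodic_meromorphic \<Lambda>2"
    using f g unfolding elliptic_field_def by auto
  then obtain \<Lambda> where \<Lambda>: "\<Lambda> \<in> commensurability_class \<Lambda>0" "\<Lambda> \<subseteq> \<Lambda>1" "\<Lambda> \<subseteq> \<Lambda>2"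
    using lattice_common_periods assms(1) by metis
  have "f (z + w) = f z" "g (z + w) = g z" if "w \<in> \<Lambda>" for w z
    using L(2,4) \<Lambda>(2,3) that unfolding periodic_meromorphic_def by auto
  then have "h (f (z + w)) (g (z + w)) = h (f z) (g z)" if "w \<in> \<Lambda>" for w z
    using that by simp
  then have "remove_sings (\<lambda>z. h (f z) (g z)) (z + w) = remove_sings (\<lambda>z. h (f z) (g z)) z"
    if "w \<in> \<Lambda>" for w z
    using that by (intro remove_sings_periodic)
  then have "remove_sings (\<lambda>z. h (f z) (g z)) \<in> periodic_meromorphic \<Lambda>"
    using remove_sings_nicely_meromorphic[OF mero] unfolding periodic_meromorphic_def by auto
  then show ?thesis using \<Lambda>(1) unfolding elliptic_field_def by auto
qed

lemma elliptic_carrierD: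
  assumes "f \<in> carrier (elliptic_field \<Lambda>0)"
  shows "f nicely_meromorphic_on UNIV" "f meromorphic_on UNIV"
  using assms unfolding elliptic_field_def periodic_meromorphic_def nicely_meromorphic_on_def
  by auto

lemma elliptic_carrier_const:
  assumes "complex_lattice \<Lambda>0"
  shows "(\<lambda>_. c) \<in> carrier (elliptic_field \<Lambda>0)"
  using lattice_in_own_class[OF assms]
  unfolding elliptic_field_def periodic_meromorphic_def by auto

lemma remove_sings_const: "remove_sings (\<lambda>_. c) = (\<lambda>_. c)"
  by (rule remove_sings_nicely) auto

lemma remove_sings_nested:
  assumes "u meromorphic_on UNIV"
  shows "remove_sings (\<lambda>z. h (remove_sings u z) z) = remove_sings (\<lambda>z. h (u z) z)"
  by (rule remove_sings_cong_cosparse)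
     (use eventually_remove_sings_eq[OF assms] in \<open>auto elim!: eventually_mono\<close>)

theorem elliptic_field_field:
  assumes L: "complex_lattice \<Lambda>0"
  shows "field (elliptic_field \<Lambda>0)"
proof -
  let ?K = "elliptic_field \<Lambda>0"
  note D = elliptic_carrierD
  note C = elliptic_carrier_binop[OF L]
  have ops: "f \<otimes>\<^bsub>?K\<^esub> g = remove_sings (\<lambda>z. f z * g z)" "f \<oplus>\<^bsub>?K\<^esub> g = remove_sings (\<lambda>z. f z + g z)"
    "\<one>\<^bsub>?K\<^esub> = (\<lambda>_. 1)" "\<zero>\<^bsub>?K\<^esub> = (\<lambda>_. 0)" for f g
    by (simp_all add: elliptic_field_def)
  note N1 = remove_sings_nested
  have N2: "remove_sings (\<lambda>z. h (remove_sings u z) (remove_sings v z)) = remove_sings (\<lambda>z. h (u z) (v z))"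
    if "u meromorphic_on UNIV" "v meromorphic_on UNIV" for h u v
    using N1[OF that(1), of "\<lambda>x z. h x (remove_sings v z)"] N1[OF that(2), of "\<lambda>x z. h (u z) x"]
    by simp
  have "abelian_group ?K"
  proof (rule abelian_groupI)
    fix f g h assume f: "f \<in> carrier ?K" and g: "g \<in> carrier ?K" and h: "h \<in> carrier ?K"
    show "f \<oplus>\<^bsub>?K\<^esub> g \<in> carrier ?K"
      unfolding ops using C[OF f g] D[OF f] D[OF g] by (auto intro: meromorphic_intros)
    show "f \<oplus>\<^bsub>?K\<^esub> g \<oplus>\<^bsub>?K\<^esub> h = f \<oplus>\<^bsub>?K\<^esub> (g \<oplus>\<^bsub>?K\<^esub> h)"
      unfolding ops
      using N1[of "\<lambda>z. f z + g z" "\<lambda>x z. x + h z"] N1[of "\<lambda>z. g z + h z" "\<lambda>x z. f z + x"]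
        D(2)[OF f] D(2)[OF g] D(2)[OF h]
      by (simp add: meromorphic_intros add.assoc)
    show "f \<oplus>\<^bsub>?K\<^esub> g = g \<oplus>\<^bsub>?K\<^esub> f"
      unfolding ops by (simp add: add.commute)
  next
    show "\<zero>\<^bsub>?K\<^esub> \<in> carrier ?K" unfolding ops by (rule elliptic_carrier_const[OF L])
  next
    fix f assume f: "f \<in> carrier ?K"
    show "\<zero>\<^bsub>?K\<^esub> \<oplus>\<^bsub>?K\<^esub> f = f" unfolding ops by (simp add: remove_sings_nicely[OF D(1)[OF f]])
    have "remove_sings (\<lambda>z. - f z) \<in> carrier ?K"
      using C[OF f f, of "\<lambda>x y. - x"] D(2)[OF f] by (simp add: meromorphic_intros)
    moreover have "remove_sings (\<lambda>z. - f z) \<oplus>\<^bsub>?K\<^esub> f = \<zero>\<^bsub>?K\<^esub>"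
      unfolding ops using N1[of "\<lambda>z. - f z" "\<lambda>x z. x + f z"] D(2)[OF f]
      by (simp add: meromorphic_intros remove_sings_const)
    ultimately show "\<exists>g\<in>carrier ?K. g \<oplus>\<^bsub>?K\<^esub> f = \<zero>\<^bsub>?K\<^esub>" by blast
  qed
  moreover have "comm_monoid ?K"
  proof (rule comm_monoidI)
    fix f g h assume f: "f \<in> carrier ?K" and g: "g \<in> carrier ?K" and h: "h \<in> carrier ?K"
    show "f \<otimes>\<^bsub>?K\<^esub> g \<otimes>\<^bsub>?K\<^esub> h = f \<otimes>\<^bsub>?K\<^esub> (g \<otimes>\<^bsub>?K\<^esub> h)"
      unfolding ops
      using N1[of "\<lambda>z. f z * g z" "\<lambda>x z. x * h z"] N1[of "\<lambda>z. g z * h z" "\<lambda>x z. f z * x"]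
        D(2)[OF f] D(2)[OF g] D(2)[OF h]
      by (simp add: meromorphic_intros mult.assoc)
  next
    fix f g assume f: "f \<in> carrier ?K" and g: "g \<in> carrier ?K"
    show "f \<otimes>\<^bsub>?K\<^esub> g \<in> carrier ?K"
      unfolding ops using C[OF f g] D[OF f] D[OF g] by (auto intro: meromorphic_intros)
    show "f \<otimes>\<^bsub>?K\<^esub> g = g \<otimes>\<^bsub>?K\<^esub> f"
      unfolding ops by (simp add: mult.commute)
  next
    show "\<one>\<^bsub>?K\<^esub> \<in> carrier ?K" unfolding ops by (rule elliptic_carrier_const[OF L])
  next
    fix f assume f: "f \<in> carrier ?K"
    show "\<one>\<^bsub>?K\<^esub> \<otimes>\<^bsub>?K\<^esub> f = f" unfolding ops by (simp add: remove_sings_nicely[OF D(1)[OF f]])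
  qed
  moreover have "(f \<oplus>\<^bsub>?K\<^esub> g) \<otimes>\<^bsub>?K\<^esub> h = f \<otimes>\<^bsub>?K\<^esub> h \<oplus>\<^bsub>?K\<^esub> g \<otimes>\<^bsub>?K\<^esub> h"
    if f: "f \<in> carrier ?K" and g: "g \<in> carrier ?K" and h: "h \<in> carrier ?K" for f g h
    unfolding ops
    using N1[of "\<lambda>z. f z + g z" "\<lambda>x z. x * h z"]
      N2[of "\<lambda>z. f z * h z" "\<lambda>z. g z * h z" "\<lambda>x y. x + y"]
      D(2)[OF f] D(2)[OF g] D(2)[OF h]
    by (simp add: meromorphic_intros distrib_right)
  ultimately have cr: "cring ?K" by (rule cringI)
  show ?thesis
  proof (rule cring.cring_fieldI2[OF cr])
    show "\<zero>\<^bsub>?K\<^esub> \<noteq> \<one>\<^bsub>?K\<^esub>" unfolding ops by (simp add: fun_eq_iff)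
    fix f assume f: "f \<in> carrier ?K" and "f \<noteq> \<zero>\<^bsub>?K\<^esub>"
    then have "\<not> (\<forall>x\<in>UNIV. f x = 0)" unfolding ops by auto
    then have ev: "eventually (\<lambda>z. f z \<noteq> 0) (cosparse UNIV)"
      using nicely_meromorphic_imp_constant_or_avoid[OF D(1)[OF f], of 0] by auto
    have "remove_sings (\<lambda>z. inverse (f z)) \<in> carrier ?K"
      using C[OF f f, of "\<lambda>x y. inverse x"] D(2)[OF f] by (simp add: meromorphic_intros)
    moreover have "f \<otimes>\<^bsub>?K\<^esub> remove_sings (\<lambda>z. inverse (f z)) = \<one>\<^bsub>?K\<^esub>"
    proof -
      have "f \<otimes>\<^bsub>?K\<^esub> remove_sings (\<lambda>z. inverse (f z)) = remove_sings (\<lambda>z. f z * inverse (f z))"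
        unfolding ops using N1[of "\<lambda>z. inverse (f z)" "\<lambda>x z. f z * x"] D(2)[OF f]
        by (simp add: meromorphic_intros)
      also have "\<dots> = remove_sings (\<lambda>_. 1)"
        by (rule remove_sings_cong_cosparse) (use ev in \<open>auto elim!: eventually_mono\<close>)
      finally show ?thesis unfolding ops by (simp add: remove_sings_const)
    qed
    ultimately show "\<exists>g\<in>carrier ?K. f \<otimes>\<^bsub>?K\<^esub> g = \<one>\<^bsub>?K\<^esub>" by blast
  qed
qed

lemma dilation_closed:
  assumes "complex_lattice \<Lambda>0" "q > 0" "f \<in> carrier (elliptic_field \<Lambda>0)"
  shows "dilation q f \<in> carrier (elliptic_field \<Lambda>0)"
proof -
  obtain \<Lambda> where \<Lambda>: "\<Lambda> \<in> commensurability_class \<Lambda>0" "f \<in> periodic_meromorphic \<Lambda>"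
    using assms(3) unfolding elliptic_field_def by auto
  then obtain c d where cd: "\<Lambda> = {of_int m * c + of_int n * d | m n :: int. True}"
    unfolding commensurability_class_def complex_lattice_def by auto
  have per: "dilation q f (z + w) = dilation q f z" if w: "w \<in> \<Lambda>" for z w
  proof -
    obtain m n where "w = of_int m * c + of_int n * d" using w cd by blast
    then have "of_nat q * w = of_int (int q * m) * c + of_int (int q * n) * d"
      by (simp add: algebra_simps)
    then have "of_nat q * w \<in> \<Lambda>" using cd by blast
    then show ?thesis
      using \<Lambda>(2) unfolding periodic_meromorphic_def dilation_def
      by (simp add: distrib_left)
  qed
  have nice: "f nicely_meromorphic_on UNIV" by (rule elliptic_carrierD) fact
  have mero: "dilation q f meromorphic_on UNIV"
    unfolding dilation_def
    by (rule meromorphic_on_compose[OF elliptic_carrierD(2)[OF assms(3)]])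
       (auto intro!: analytic_intros)
  have fm: "filtermap (\<lambda>x. of_nat q * x) (at z) = at (of_nat q * z)" for z :: complex
  proof (rule filtermap_fun_inverse[of "\<lambda>x. x / of_nat q"])
    have ne: "of_nat q \<noteq> (0 :: complex)" using assms(2) by simp
    have "((\<lambda>x. x / of_nat q) \<longlongrightarrow> (of_nat q * z) / of_nat q) (at (of_nat q * z))"
      by (intro tendsto_intros ne)
    then have "((\<lambda>x. x / of_nat q) \<longlongrightarrow> z) (at (of_nat q * z))" using ne by simp
    moreover have "eventually (\<lambda>x. x / of_nat q \<noteq> z) (at (of_nat q * z))"
      using ne by (auto simp: eventually_at_filter field_simps)
    ultimately show "filterlim (\<lambda>x. x / of_nat q) (at z) (at (of_nat q * z))"
      by (rule filterlim_atI)
    have "((\<lambda>x. of_nat q * x) \<longlongrightarrow> of_nat q * z) (at z)"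
      by (intro tendsto_intros)
    moreover have "eventually (\<lambda>x. of_nat q * x \<noteq> of_nat q * z) (at z)"
      using ne by (simp add: eventually_at_filter)
    ultimately show "filterlim (\<lambda>x. of_nat q * x) (at (of_nat q * z)) (at z)"
      by (rule filterlim_atI)
    show "eventually (\<lambda>x. of_nat q * (x / of_nat q) = x) (at (of_nat q * z))"
      using ne by simp
  qed
  have "remove_sings (dilation q f) = dilation q f"
  proof
    fix z
    have "remove_sings (f \<circ> (\<lambda>x. of_nat q * x)) z = remove_sings f (of_nat q * z)"
      by (rule remove_sings_compose[OF fm])
    then show "remove_sings (dilation q f) z = dilation q f z"
      using remove_sings_nicely[OF nice] by (simp add: dilation_def o_def)
  qed
  then have "dilation q f nicely_meromorphic_on UNIV"
    using remove_sings_nicely_meromorphic[OF mero] by simp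
  then have "dilation q f \<in> periodic_meromorphic \<Lambda>"
    using per unfolding periodic_meromorphic_def by auto
  then show ?thesis using \<Lambda>(1) unfolding elliptic_field_def by auto
qed

lemma mero_deriv_closed:
  assumes "f \<in> carrier (elliptic_field \<Lambda>0)"
  shows "mero_deriv f \<in> carrier (elliptic_field \<Lambda>0)"
proof -
  obtain \<Lambda> where \<Lambda>: "\<Lambda> \<in> commensurability_class \<Lambda>0" "f \<in> periodic_meromorphic \<Lambda>"
    using assms unfolding elliptic_field_def by auto
  have "deriv f (z + w) = deriv f z" if "w \<in> \<Lambda>" for z w
  proof -
    have "(\<lambda>x. f (x + w)) = f"
      using \<Lambda>(2) that unfolding periodic_meromorphic_def by auto
    then show ?thesis unfolding deriv_def by (simp add: DERIV_shift)
  qed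
  then have "mero_deriv f \<in> periodic_meromorphic \<Lambda>"
    unfolding mero_deriv_def periodic_meromorphic_def
    using remove_sings_periodic remove_sings_nicely_meromorphic meromorphic_on_deriv
      elliptic_carrierD(2)[OF assms] by blast
  then show ?thesis using \<Lambda>(1) unfolding elliptic_field_def by auto
qed

end

theory Submission
  imports Defs "HOL-Library.Function_Algebras" "HOL-Computational_Algebra.Fundamental_Theorem_Algebra"
begin

text \<open>
  It suffices to find a hyperplane of \<open>W\<close> stable under \<open>\<Phi>\<close> and \<open>\<nabla>\<close> and to induct on the dimension. Such
  a hyperplane is the kernel of a horizontal functional that \<open>\<Phi>\<close> multiplies by a constant, i.e. in
  coordinates, of a solution \<open>v\<close> over \<open>K\<close> of the equation \<open>v' = B v\<close> dual to \<open>\<nabla>\<close> with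
  \<open>A v = c \<phi>(v)\<close>.

  The compatibility of \<open>\<Phi>\<close> and \<open>\<nabla>\<close> says that the injective operator \<open>y \<mapsto> \<phi>\<inverse>(A y)\<close> carries
  meromorphic solutions on \<open>U\<close> to solutions on \<open>q U\<close>. Applied repeatedly to a local solution, it yields
  solutions on arbitrarily large discs, which translation by periods of \<open>B\<close> moves to the origin. Hence
  the finite-dimensional space of global meromorphic solutions is nonzero. On it the translations \<open>t\<close> by
  two basic periods commute, and the operator \<open>G\<close> above satisfies \<open>t\<^sup>q G = G t\<close>. Thus \<open>G\<inverse>\<close> raises the
  eigenvalues of \<open>t\<close> to the power \<open>q\<close>, so that they are roots of unity, and \<open>G\<close> has an eigenvector
  that is periodic under a sublattice, i.e. has entries in \<open>K\<close>.
\<close>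

section \<open>Operators on finite-dimensional complex vector spaces\<close>

text \<open>The obstacle is that a system with poles has in general no nonzero global meromorphic
  solution: continuing a local solution around a pole of \<open>B\<close> can make it multivalued,
  and at the pole itself it can have an essential singularity. No monodromy is computed. A disc
  around a regular point carries a solution, and \<open>push\<close> turns it into single-valued
  meromorphic solutions on discs q^k times as large, which may well contain poles of
  \<open>B\<close>. Solutions obtained for different k are unrelated and cannot be glued directly;
  the finite dimension of the space of initial values supplies a coherent choice. A functional is
  sought rather than a vector because its kernel is a hyperplane, so that the induction needs
  subspaces only and no quotients. Simultaneous eigenvectors of the translations are a priori
  periodic only up to constant multipliers. That the multipliers are roots of unity is what makes
  them truly periodic for a multiple of the lattice, and K is large enough to contain functions with
  such periods.\<close>

definition linear_endo_on :: "('k \<Rightarrow> 'b \<Rightarrow> 'b) \<Rightarrow> 'b set \<Rightarrow> ('b::plus \<Rightarrow> 'b) \<Rightarrow> bool" where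
  "linear_endo_on smul V T \<longleftrightarrow> T ` V \<subseteq> V \<and>
     (\<forall>x\<in>V. \<forall>y\<in>V. T (x + y) = T x + T y) \<and> (\<forall>c. \<forall>x\<in>V. T (smul c x) = smul c (T x))"

lemma linear_endo_onI:
  assumes "\<And>x. x \<in> V \<Longrightarrow> T x \<in> V"
    "\<And>x y. x \<in> V \<Longrightarrow> y \<in> V \<Longrightarrow> T (x + y) = T x + T y"
    "\<And>c x. x \<in> V \<Longrightarrow> T (smul c x) = smul c (T x)"
  shows "linear_endo_on smul V T"
  using assms unfolding linear_endo_on_def by blast

lemma linear_endo_onD:
  assumes "linear_endo_on smul V T"
  shows "x \<in> V \<Longrightarrow> T x \<in> V"
    "x \<in> V \<Longrightarrow> y \<in> V \<Longrightarrow> T (x + y) = T x + T y"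
    "x \<in> V \<Longrightarrow> T (smul c x) = smul c (T x)"
  using assms unfolding linear_endo_on_def by blast+

lemma linear_endo_on_subset:
  assumes "linear_endo_on smul V T" "S \<subseteq> V" "\<And>x. x \<in> S \<Longrightarrow> T x \<in> S"
  shows "linear_endo_on smul S T"
  by (rule linear_endo_onI) (use assms linear_endo_onD[OF assms(1)] in blast)+

lemma linear_endo_on_funpow:
  assumes "linear_endo_on smul V T"
  shows "linear_endo_on smul V (T ^^ n)"
proof (induction n)
  case 0
  show ?case by (auto intro!: linear_endo_onI)
next
  case (Suc n)
  show ?case
    by (rule linear_endo_onI)
       (use linear_endo_onD[OF assms] linear_endo_onD[OF Suc] in auto)
qed

text \<open>The vector p(T) v by Horner's scheme: each step applies T and adds a multiple of v, so
  that proofs can go by induction along \<open>pCons\<close>.\<close>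

definition poly_endo :: "('a::comm_ring_1 \<Rightarrow> 'b \<Rightarrow> 'b) \<Rightarrow> ('b::ab_group_add \<Rightarrow> 'b) \<Rightarrow> 'a poly \<Rightarrow> 'b \<Rightarrow> 'b" where
  "poly_endo smul T p v = fold_coeffs (\<lambda>a w. smul a v + T w) p 0"

locale complex_vector_space = vector_space scale
  for scale :: "complex \<Rightarrow> 'b::ab_group_add \<Rightarrow> 'b"
begin

text \<open>A bound on independent sets, because \<open>dim\<close> is 0 in infinite dimension and
  could not express finiteness. It passes to arbitrary subsets.\<close>

definition dim_at_most :: "'b set \<Rightarrow> nat \<Rightarrow> bool" where
  "dim_at_most V d \<longleftrightarrow> (\<forall>B. B \<subseteq> V \<longrightarrow> independent B \<longrightarrow> finite B \<and> card B \<le> d)"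

lemma dim_at_most_subset: "dim_at_most V d \<Longrightarrow> S \<subseteq> V \<Longrightarrow> dim_at_most S d"
  unfolding dim_at_most_def by blast

lemma dim_at_most_span: "finite B \<Longrightarrow> dim_at_most (span B) (card B)"
  unfolding dim_at_most_def using independent_span_bound by blast

text \<open>Otherwise the first d + 1 terms would be distinct and independent. This is applied to
  the iterates of an operator and to eigenvectors.\<close>

lemma dim_at_most_sequence:
  assumes "dim_at_most V d" and x: "\<And>k::nat. x k \<in> V"
  shows "\<exists>k\<le>d. x k \<in> span (x ` {..<k})"
proof (rule ccontr)
  assume *: "\<not> ?thesis"
  have "independent (x ` {..<k}) \<and> card (x ` {..<k}) = k" if "k \<le> Suc d" for k
    using that
  proof (induction k)
    case 0
    then show ?case by (simp add: independent_empty)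
  next
    case (Suc k)
    have "x k \<notin> span (x ` {..<k})" using * Suc.prems Suc_le_mono by blast
    moreover from this have "x k \<notin> x ` {..<k}" using span_base by metis
    ultimately show ?case
      using Suc by (simp add: lessThan_Suc independent_insert)
  qed
  then have "independent (x ` {..<Suc d})" "card (x ` {..<Suc d}) = Suc d" by blast+
  moreover have "x ` {..<Suc d} \<subseteq> V" using x by blast
  ultimately show False using assms(1) unfolding dim_at_most_def by (metis not_less_eq_eq order_refl)
qed

lemma dim_at_most_basis:
  assumes "dim_at_most V d" "S \<subseteq> V"
  obtains B where "B \<subseteq> S" "independent B" "S \<subseteq> span B" "finite B" "card B = dim S"
proof -
  obtain B where "B \<subseteq> S" "independent B" "S \<subseteq> span B" "card B = dim S"
    using basis_exists by blast
  then show ?thesis using that assms unfolding dim_at_most_def by blast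
qed

lemma subspace_eq_of_dim_eq:
  assumes V: "dim_at_most V d" "T \<subseteq> V" and "subspace S" "S \<subseteq> T" "dim S \<ge> dim T"
  shows "S = T"
proof (rule ccontr)
  assume "S \<noteq> T"
  then obtain x where x: "x \<in> T" "x \<notin> S" using assms by blast
  obtain B where B: "B \<subseteq> T" "independent B" "T \<subseteq> span B" "finite B" "card B = dim T"
    using dim_at_most_basis[OF V] by metis
  obtain C where C: "C \<subseteq> S" "independent C" "S \<subseteq> span C" "finite C" "card C = dim S"
    using dim_at_most_basis[OF V(1), of S] assms by (metis subset_trans)
  have "span C \<subseteq> S" using C(1) assms(3) by (rule span_minimal)
  then have nx: "x \<notin> span C" using x by blast
  then have "x \<notin> C" using span_base by blast
  have "independent (insert x C)" using nx C(2) by (rule independent_insertI)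
  moreover have "insert x C \<subseteq> span B" using x C B assms by blast
  ultimately have "card (insert x C) \<le> card B" using independent_span_bound[OF B(4)] by blast
  then show False using C B assms(5) \<open>x \<notin> C\<close> by simp
qed

text \<open>The sequence is constant from an index at which the dimension is minimal, because a
  subspace of full dimension is the whole space.\<close>

lemma decreasing_subspaces_Inter:
  fixes S :: "nat \<Rightarrow> 'b set"
  assumes V: "dim_at_most V d" and S: "\<And>n. subspace (S n)" "\<And>n. S n \<subseteq> V" "\<And>n. \<exists>x\<in>S n. x \<noteq> 0"
    and dec: "\<And>m n. m \<le> n \<Longrightarrow> S n \<subseteq> S m"
  shows "\<exists>x. x \<noteq> 0 \<and> (\<forall>n. x \<in> S n)"
proof -
  obtain n where n: "\<And>k. dim (S n) \<le> dim (S k)"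
    using exists_least_iff[of "\<lambda>j. \<exists>n. dim (S n) = j"] by (metis linorder_not_less)
  obtain x where x: "x \<in> S n" "x \<noteq> 0" using S(3) by blast
  have "x \<in> S k" for k
  proof (cases "n \<le> k")
    case True
    then have "S k = S n" using subspace_eq_of_dim_eq[OF V S(2) S(1)] dec n by blast
    then show ?thesis using x by simp
  next
    case False
    then show ?thesis using x dec[of k n] by auto
  qed
  then show ?thesis using x by blast
qed

section \<open>Polynomials in an operator\<close>

context
  fixes V T
  assumes V: "subspace V" and T: "linear_endo_on scale V T"
begin

lemma linear_endo_on_0: "T 0 = 0"
  using linear_endo_onD(2)[OF T, of 0 0] subspace_0[OF V] by simp

lemma linear_endo_on_diff: "x \<in> V \<Longrightarrow> y \<in> V \<Longrightarrow> T (x - y) = T x - T y"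
  using linear_endo_onD(2)[OF T, of x "- y"] linear_endo_onD(3)[OF T, of y "-1"] subspace_neg[OF V]
  by simp

lemma poly_endo_0 [simp]: "poly_endo scale T 0 v = 0"
  by (simp add: poly_endo_def)

lemma poly_endo_pCons: "poly_endo scale T (pCons a p) v = scale a v + T (poly_endo scale T p v)"
  by (cases "p = 0 \<and> a = 0") (auto simp: poly_endo_def linear_endo_on_0)

lemma poly_endo_closed: "v \<in> V \<Longrightarrow> poly_endo scale T p v \<in> V"
  by (induction p) (auto simp: poly_endo_pCons subspace_0[OF V] intro!: subspace_add[OF V]
      subspace_scale[OF V] linear_endo_onD(1)[OF T])

lemma poly_endo_add: "v \<in> V \<Longrightarrow>
    poly_endo scale T (p + r) v = poly_endo scale T p v + poly_endo scale T r v"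
  by (induction p r rule: poly_induct2)
     (auto simp: poly_endo_pCons linear_endo_onD(2)[OF T] poly_endo_closed scale_left_distrib)

lemma poly_endo_smult: "v \<in> V \<Longrightarrow> poly_endo scale T (Polynomial.smult c p) v = scale c (poly_endo scale T p v)"
  by (induction p)
     (auto simp: poly_endo_pCons linear_endo_onD(3)[OF T] poly_endo_closed scale_right_distrib)

lemma poly_endo_diff: "v \<in> V \<Longrightarrow>
    poly_endo scale T (p - r) v = poly_endo scale T p v - poly_endo scale T r v"
  using poly_endo_add[of v p "Polynomial.smult (-1) r"] poly_endo_smult[of v "-1" r] by simp

lemma poly_endo_linear_factor: "v \<in> V \<Longrightarrow>
    poly_endo scale T ([:- a, 1:] * p) v = T (poly_endo scale T p v) - scale a (poly_endo scale T p v)"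
  by (simp add: poly_endo_add poly_endo_smult poly_endo_pCons poly_endo_diff)

lemma poly_endo_eigenvector:
  assumes "v \<in> V" "T v = scale a v"
  shows "poly_endo scale T p v = scale (poly p a) v"
  by (induction p)
     (use assms linear_endo_onD(3)[OF T] in \<open>auto simp: poly_endo_pCons scale_left_distrib mult.commute\<close>)

lemma poly_endo_linear: "linear_endo_on scale V (poly_endo scale T p)"
proof (rule linear_endo_onI)
  show "poly_endo scale T p (x + y) = poly_endo scale T p x + poly_endo scale T p y"
    if "x \<in> V" "y \<in> V" for x y
    by (induction p)
       (use that in \<open>auto simp: poly_endo_pCons linear_endo_onD(2)[OF T] poly_endo_closed scale_right_distrib\<close>)
  show "poly_endo scale T p (scale c x) = scale c (poly_endo scale T p x)" if "x \<in> V" for c x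
    by (induction p)
       (use that in \<open>auto simp: poly_endo_pCons linear_endo_onD(3)[OF T] poly_endo_closed scale_right_distrib mult.commute\<close>)
qed (rule poly_endo_closed)

text \<open>In finite dimension some iterate \<open>(T ^^ k) v\<close> depends on the earlier ones,
  which is a monic polynomial relation for v.\<close>

lemma annihilating_poly_exists:
  assumes "dim_at_most V d" "v \<in> V"
  shows "\<exists>p. p \<noteq> 0 \<and> poly_endo scale T p v = 0"
proof -
  have mon: "poly_endo scale T (monom 1 k) v = (T ^^ k) v" for k
    by (induction k) (auto simp: monom_Suc poly_endo_pCons linear_endo_on_0 simp flip: pCons_one)
  have cl: "(T ^^ k) v \<in> V" for k
    using linear_endo_onD(1)[OF linear_endo_on_funpow[OF T]] assms(2) by blast
  obtain k where k: "(T ^^ k) v \<in> span ((\<lambda>k. (T ^^ k) v) ` {..<k})"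
    using dim_at_most_sequence[OF assms(1), of "\<lambda>k. (T ^^ k) v"] cl by blast
  \<comment> \<open>The vectors r(T) v with r of degree less than k. Vanishing coefficients express
    this also for k = 0, where r must be 0, while a strict bound on \<open>degree\<close> would
    not.\<close>
  let ?S = "{poly_endo scale T r v | r. \<forall>i\<ge>k. coeff r i = 0}"
  have "subspace ?S"
  proof (rule subspaceI)
    show "0 \<in> ?S" by (rule CollectI, rule exI[of _ 0]) simp
    show "x + y \<in> ?S" if xy: "x \<in> ?S" "y \<in> ?S" for x y
    proof -
      obtain r s where "x = poly_endo scale T r v" "y = poly_endo scale T s v"
        "\<forall>i\<ge>k. coeff r i = 0" "\<forall>i\<ge>k. coeff s i = 0"
        using xy by blast
      then show ?thesis using assms(2) by (intro CollectI exI[of _ "r + s"]) (simp add: poly_endo_add)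
    qed
    show "scale c x \<in> ?S" if x: "x \<in> ?S" for c x
    proof -
      obtain r where "x = poly_endo scale T r v" "\<forall>i\<ge>k. coeff r i = 0" using x by blast
      then show ?thesis using assms(2) by (intro CollectI exI[of _ "Polynomial.smult c r"]) (simp add: poly_endo_smult)
    qed
  qed
  moreover have "(T ^^ j) v \<in> ?S" if "j < k" for j
    using that by (intro CollectI exI[of _ "monom 1 j"]) (simp add: mon)
  ultimately have "span ((\<lambda>k. (T ^^ k) v) ` {..<k}) \<subseteq> ?S"
    by (intro span_minimal) auto
  then obtain r where r: "(T ^^ k) v = poly_endo scale T r v" "\<forall>i\<ge>k. coeff r i = 0" using k by blast
  show ?thesis
  proof (intro exI conjI)
    show "poly_endo scale T (monom 1 k - r) v = 0" using r assms(2) by (simp add: poly_endo_diff mon)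
    have "coeff (monom 1 k - r) k = 1" using r by simp
    then show "monom 1 k - r \<noteq> 0" by (metis coeff_0 zero_neq_one)
  qed
qed

text \<open>If p has least degree among the nonzero polynomials with p(T) v = 0, its constant term a
  is nonzero: otherwise injectivity would allow T to be cancelled. Solving p(T) v = 0 for
  \<open>scale a v\<close> exhibits v as an image.\<close>

lemma injective_imp_surjective_on:
  assumes "dim_at_most V d" and inj: "\<And>x. x \<in> V \<Longrightarrow> T x = 0 \<Longrightarrow> x = 0"
  shows "T ` V = V"
proof
  show "T ` V \<subseteq> V" using linear_endo_onD(1)[OF T] by blast
  show "V \<subseteq> T ` V"
  proof
    fix v assume v: "v \<in> V"
    let ?P = "\<lambda>p. p \<noteq> 0 \<and> poly_endo scale T p v = 0"
    obtain p0 where "?P p0" using annihilating_poly_exists[OF assms(1) v] by blast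
    define p where "p = arg_min degree ?P"
    have p: "?P p" and min: "\<And>r. ?P r \<Longrightarrow> degree p \<le> degree r"
      unfolding p_def using arg_min_natI[of ?P, OF \<open>?P p0\<close>] arg_min_nat_le[of ?P] by blast+
    obtain a r where pr: "p = pCons a r" by (cases p)
    have "a \<noteq> 0"
    proof
      assume "a = 0"
      then have "T (poly_endo scale T r v) = 0" "r \<noteq> 0" using p pr by (auto simp: poly_endo_pCons)
      then have "?P r" using inj poly_endo_closed[OF v] by blast
      then show False using min[of r] pr \<open>r \<noteq> 0\<close> by simp
    qed
    have "scale a v = - T (poly_endo scale T r v)"
      using p pr by (simp add: poly_endo_pCons eq_neg_iff_add_eq_0)
    then have "scale (- inverse a) (T (poly_endo scale T r v)) = v"
      using \<open>a \<noteq> 0\<close> by (metis scale_minus_left scale_minus_right scale_scale left_inverse scale_one minus_minus)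
    then have "v = T (scale (- inverse a) (poly_endo scale T r v))"
      using linear_endo_onD(3)[OF T] poly_endo_closed[OF v] by metis
    then show "v \<in> T ` V" using poly_endo_closed[OF v] subspace_scale[OF V] by blast
  qed
qed

text \<open>Eigenvectors for distinct eigenvalues are independent, so infinitely many eigenvalues
  would contradict the dimension bound.\<close>

lemma finite_eigenvalue_sequence:
  fixes v :: "nat \<Rightarrow> 'b"
  assumes "dim_at_most V d" and v: "\<And>k. v k \<in> V" "\<And>k. v k \<noteq> 0" "\<And>k. T (v k) = scale (a k) (v k)"
  shows "finite (range a)"
proof (rule ccontr)
  assume inf: "infinite (range a)"
  obtain f :: "nat \<Rightarrow> complex" where f: "inj f" "range f \<subseteq> range a"
    using infinite_countable_subset[OF inf] by blast
  define g where "g n = (SOME k. a k = f n)" for n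
  have g: "a (g n) = f n" for n
  proof -
    have "f n \<in> range a" using f(2) by blast
    then have "\<exists>k. a k = f n" by (metis rangeE)
    then show ?thesis unfolding g_def by (rule someI_ex)
  qed
  obtain k where k: "v (g k) \<in> span ((\<lambda>j. v (g j)) ` {..<k})"
    using dim_at_most_sequence[OF assms(1), of "\<lambda>j. v (g j)"] v(1) by blast
  \<comment> \<open>This polynomial annihilates the first k chosen eigenvectors, hence their span
    and \<open>v (g k)\<close>, which makes \<open>f k\<close> one of its roots.\<close>
  define p where "p = (\<Prod>j<k. [:- f j, 1:])"
  have pv: "poly_endo scale T p (v (g j)) = scale (poly p (f j)) (v (g j))" for j
    using poly_endo_eigenvector[OF v(1) v(3)] g by metis
  let ?S = "{x\<in>V. poly_endo scale T p x = 0}"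
  have "subspace ?S"
    by (rule subspaceI) (use linear_endo_onD[OF poly_endo_linear[of p]] subspace_0[OF V]
        subspace_add[OF V] subspace_scale[OF V] linear_endo_onD(3)[OF poly_endo_linear[of p], of 0 0] in auto)
  moreover have "v (g j) \<in> ?S" if "j < k" for j
    using that v(1) pv[of j] by (auto simp: p_def poly_prod intro!: prod_zero)
  ultimately have "v (g k) \<in> ?S" using k span_minimal[of "(\<lambda>j. v (g j)) ` {..<k}" ?S] by auto
  then have "poly p (f k) = 0" using pv[of k] v(2) by auto
  then obtain j where "j < k" "f k = f j" by (auto simp: p_def poly_prod)
  then show False using f(1) by (auto simp: inj_def)
qed

end

text \<open>Take p of least degree with p(T) v = 0. It is not constant because v is nonzero, and
  splitting off a factor x - a leaves a cofactor r for which r(T) v is nonzero by minimality and is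
  the eigenvector.\<close>

lemma eigenvector_exists:
  assumes V: "subspace V" and T: "linear_endo_on scale V T" and "dim_at_most V d" "v \<in> V" "v \<noteq> 0"
  shows "\<exists>a w. w \<in> V \<and> w \<noteq> 0 \<and> T w = scale a w"
proof -
  let ?P = "\<lambda>p. p \<noteq> 0 \<and> poly_endo scale T p v = 0"
  obtain p0 where "?P p0" using annihilating_poly_exists[OF V T assms(3,4)] by blast
  define p where "p = arg_min degree ?P"
  have p: "?P p" and min: "\<And>r. ?P r \<Longrightarrow> degree p \<le> degree r"
    unfolding p_def using arg_min_natI[of ?P, OF \<open>?P p0\<close>] arg_min_nat_le[of ?P] by blast+
  have "degree p \<noteq> 0"
  proof
    assume "degree p = 0"
    then obtain c where "p = [:c:]" by (metis degree_eq_zeroE)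
    then have "scale c v = 0" "c \<noteq> 0"
      using p by (auto simp: poly_endo_pCons[OF V T] linear_endo_on_0[OF V T] poly_endo_0[OF V T])
    then show False using assms by simp
  qed
  then obtain a where "poly p a = 0"
    using fundamental_theorem_of_algebra[of p] constant_degree[of p] by auto
  then obtain r where r: "p = [:- a, 1:] * r" by (metis dvdE poly_eq_0_iff_dvd)
  have "r \<noteq> 0" using r p by auto
  then have "degree p = Suc (degree r)" using r by (simp add: degree_mult_eq del: mult_pCons_left)
  then have "poly_endo scale T r v \<noteq> 0" using min[of r] \<open>r \<noteq> 0\<close> by auto
  moreover have "T (poly_endo scale T r v) = scale a (poly_endo scale T r v)"
    using p r poly_endo_linear_factor[OF V T assms(4)] by simp
  ultimately show ?thesis using poly_endo_closed[OF V T assms(4)] by blast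
qed

text \<open>A \<open>t\<close>-eigenvector with eigenvalue \<open>a\<close> is sent by the powers of \<open>F\<close> to eigenvectors with
  eigenvalues \<open>a ^ q ^ k\<close>; only finitely many of these can be distinct.\<close>

lemma eigenvalue_root_of_unity:
  assumes V: "subspace V" and t: "linear_endo_on scale V t" and d: "dim_at_most V d"
    and F: "\<And>x. x \<in> V \<Longrightarrow> F x \<in> V" "\<And>x. x \<in> V \<Longrightarrow> x \<noteq> 0 \<Longrightarrow> F x \<noteq> 0"
      "\<And>c x. x \<in> V \<Longrightarrow> F (scale c x) = scale c (F x)"
    and tF: "\<And>x. x \<in> V \<Longrightarrow> t (F x) = F ((t ^^ q) x)"
    and "q \<ge> 2" "a \<noteq> 0" "v \<in> V" "v \<noteq> 0" "t v = scale a v"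
  shows "\<exists>N>0. a ^ N = 1"
proof -
  have pow: "(t ^^ n) x = scale (b ^ n) x" if "x \<in> V" "t x = scale b x" for x b n
    by (induction n) (use that linear_endo_onD(3)[OF t] in \<open>auto simp: mult.commute\<close>)
  have Fv: "(F ^^ k) v \<in> V \<and> (F ^^ k) v \<noteq> 0 \<and> t ((F ^^ k) v) = scale (a ^ q ^ k) ((F ^^ k) v)" for k
  proof (induction k)
    case (Suc k)
    let ?x = "(F ^^ k) v"
    have "t (F ?x) = F (scale ((a ^ q ^ k) ^ q) ?x)"
      using Suc tF[of ?x] pow[of ?x "a ^ q ^ k" q] by simp
    also have "\<dots> = scale (a ^ q ^ Suc k) (F ?x)"
      using Suc F(3) by (simp only: power_Suc2 power_mult)
    finally show ?case using Suc F by simp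
  qed (use assms in auto)
  then have "finite (range (\<lambda>k. a ^ q ^ k))"
    by (intro finite_eigenvalue_sequence[OF V t d, of "\<lambda>k. (F ^^ k) v"]) auto
  then have "\<not> inj (\<lambda>k. a ^ q ^ k)" using finite_imageD infinite_UNIV_nat by blast
  then obtain k l :: nat where kl: "k < l" "a ^ q ^ k = a ^ q ^ l"
    unfolding inj_on_def by (metis linorder_neqE_nat)
  have "q ^ k < q ^ l" using kl assms by simp
  then have "a ^ (q ^ l - q ^ k) * a ^ q ^ k = a ^ q ^ l" by (simp flip: power_add)
  then have "a ^ (q ^ l - q ^ k) = 1" using kl \<open>a \<noteq> 0\<close> by simp
  then show ?thesis using \<open>q ^ k < q ^ l\<close> by (intro exI[of _ "q ^ l - q ^ k"]) simp
qed

text \<open>The inverse F of G on V satisfies t F = F t^q. The common fixed space of t^n and u^n is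
  therefore F-stable: if t^n fixes x, so does t^(q n), and then t^n fixes F x. The relation for G
  itself would only give that t^(q n) fixes G x. Hence an eigenvector is found for F and then read
  as one of G.\<close>

lemma periodic_eigenvector_exists:
  assumes V: "subspace V" and d: "dim_at_most V d" and v0: "v0 \<in> V" "v0 \<noteq> 0"
    and t: "linear_endo_on scale V t" "linear_endo_on scale V u" and G: "linear_endo_on scale V G"
    and inj: "\<And>x. x \<in> V \<Longrightarrow> t x = 0 \<Longrightarrow> x = 0" "\<And>x. x \<in> V \<Longrightarrow> u x = 0 \<Longrightarrow> x = 0"
      "\<And>x. x \<in> V \<Longrightarrow> G x = 0 \<Longrightarrow> x = 0"
    and comm: "\<And>x. x \<in> V \<Longrightarrow> t (u x) = u (t x)"
    and tG: "\<And>x. x \<in> V \<Longrightarrow> (t ^^ q) (G x) = G (t x)" "\<And>x. x \<in> V \<Longrightarrow> (u ^^ q) (G x) = G (u x)"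
    and q: "q \<ge> 2"
  shows "\<exists>v c N. v \<in> V \<and> v \<noteq> 0 \<and> N > 0 \<and> c \<noteq> 0 \<and>
           (t ^^ N) v = v \<and> (u ^^ N) v = v \<and> G v = scale c v"
proof -
  have GV: "G ` V = V" by (rule injective_imp_surjective_on[OF V G d inj(3)])
  define F where "F = inv_into V G"
  have F: "F x \<in> V" "G (F x) = x" if "x \<in> V" for x
    using that inv_into_into[of x G V] f_inv_into_f[of x G V] GV by (auto simp: F_def)
  have Geq: "x = y" if "x \<in> V" "y \<in> V" "G x = G y" for x y
  proof -
    have "G (x - y) = 0" using linear_endo_on_diff[OF V G that(1,2)] that(3) by simp
    then have "x - y = 0" using inj(3) subspace_diff[OF V that(1,2)] by blast
    then show ?thesis by simp
  qed
  have Fs: "F (scale c x) = scale c (F x)" if "x \<in> V" for c x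
    by (rule Geq) (use that in \<open>auto simp: F linear_endo_onD(3)[OF G] subspace_scale[OF V]\<close>)
  have Fa: "F (x + y) = F x + F y" if "x \<in> V" "y \<in> V" for x y
    by (rule Geq) (use that in \<open>auto simp: F linear_endo_onD(2)[OF G] subspace_add[OF V]\<close>)
  have Fnz: "F x \<noteq> 0" if "x \<in> V" "x \<noteq> 0" for x
    using F(2)[OF that(1)] that linear_endo_on_0[OF V G] by auto
  have rel: "s (F x) = F ((s ^^ q) x)"
    if s: "linear_endo_on scale V s" "\<And>x. x \<in> V \<Longrightarrow> (s ^^ q) (G x) = G (s x)" and x: "x \<in> V" for s x
  proof (rule Geq)
    show "G (s (F x)) = G (F ((s ^^ q) x))"
      using s(2)[of "F x"] F[OF x] F(2)[of "(s ^^ q) x"] linear_endo_onD(1)[OF linear_endo_on_funpow[OF s(1)] x]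
      by metis
  qed (use F linear_endo_onD(1)[OF s(1)] linear_endo_onD(1)[OF linear_endo_on_funpow[OF s(1)]] x in auto)
  obtain a v1 where v1: "v1 \<in> V" "v1 \<noteq> 0" "t v1 = scale a v1"
    using eigenvector_exists[OF V t(1) d v0] by blast
  \<comment> \<open>u commutes with t and so preserves this eigenspace, where it has an eigenvector
    in its turn.\<close>
  let ?S = "{x\<in>V. t x = scale a x}"
  have S: "subspace ?S"
    by (rule subspaceI) (use linear_endo_onD[OF t(1)] subspace_0[OF V] linear_endo_on_0[OF V t(1)]
        subspace_add[OF V] subspace_scale[OF V] in \<open>auto simp: scale_right_distrib mult.commute\<close>)
  have uS: "linear_endo_on scale ?S u"
    by (rule linear_endo_on_subset[OF t(2)]) (use comm linear_endo_onD[OF t(2)] in auto)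
  obtain b v2 where v2: "v2 \<in> ?S" "v2 \<noteq> 0" "u v2 = scale b v2"
    using eigenvector_exists[OF S uS dim_at_most_subset[OF d], of v1] v1 by blast
  have "t v2 \<noteq> 0" "u v2 \<noteq> 0" using inj v2 by blast+
  then have ab: "a \<noteq> 0" "b \<noteq> 0" using v2 by auto
  obtain M where M: "M > 0" "a ^ M = 1"
    using eigenvalue_root_of_unity[OF V t(1) d F(1) Fnz Fs rel[OF t(1) tG(1)] q ab(1), of v2] v2 by auto
  obtain N where N: "N > 0" "b ^ N = 1"
    using eigenvalue_root_of_unity[OF V t(2) d F(1) Fnz Fs rel[OF t(2) tG(2)] q ab(2), of v2] v2 by auto
  have pow: "(s ^^ n) x = scale (c ^ n) x"
    if "linear_endo_on scale V s" "x \<in> V" "s x = scale c x" for x c n s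
    by (induction n) (use that linear_endo_onD(3)[OF that(1)] in \<open>auto simp: mult.commute\<close>)
  \<comment> \<open>A common exponent for both eigenvalues, so that \<open>?U\<close> contains
    \<open>v2\<close> and is nonzero.\<close>
  let ?n = "M * N"
  let ?U = "{x\<in>V. (t ^^ ?n) x = x \<and> (u ^^ ?n) x = x}"
  have "a ^ ?n = 1" "b ^ ?n = 1" using M N by (simp add: power_mult, metis mult.commute power_mult power_one)
  then have v2U: "v2 \<in> ?U" using v2 pow[OF t(1), of v2 a ?n] pow[OF t(2), of v2 b ?n] by auto
  note tn = linear_endo_on_funpow[OF t(1), of ?n] linear_endo_on_funpow[OF t(2), of ?n]
  have U: "subspace ?U"
    by (rule subspaceI) (use linear_endo_onD[OF tn(1)] linear_endo_onD[OF tn(2)] subspace_0[OF V]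
        linear_endo_on_0[OF V tn(1)] linear_endo_on_0[OF V tn(2)]
        subspace_add[OF V] subspace_scale[OF V] in auto)
  have relk: "(s ^^ k) (F x) = F ((s ^^ (q * k)) x)"
    if s: "linear_endo_on scale V s" "\<And>x. x \<in> V \<Longrightarrow> (s ^^ q) (G x) = G (s x)" and x: "x \<in> V" for s x k
    using x
  proof (induction k arbitrary: x)
    case (Suc k)
    have "(s ^^ Suc k) (F x) = (s ^^ k) (F ((s ^^ q) x))"
      using rel[OF s Suc.prems] by (simp add: funpow_swap1)
    also have "\<dots> = F ((s ^^ (q * k)) ((s ^^ q) x))"
      using Suc linear_endo_onD(1)[OF linear_endo_on_funpow[OF s(1)]] by blast
    finally show ?case by (metis add.commute comp_apply funpow_add mult_Suc_right)
  qed simp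
  have fixq: "(s ^^ (q * k)) x = x" if "(s ^^ k) x = x" for s :: "'b \<Rightarrow> 'b" and k x
    using that by (induction q) (auto simp: funpow_add add.commute)
  have FU: "linear_endo_on scale ?U F"
  proof (rule linear_endo_onI)
    fix x assume x: "x \<in> ?U"
    then show "F x \<in> ?U"
      using relk[OF t(1) tG(1), of x ?n] relk[OF t(2) tG(2), of x ?n] fixq[where s = t and k = ?n and x = x] fixq[where s = u and k = ?n and x = x] F(1)[of x]
      by auto
  qed (use Fa Fs in auto)
  obtain c w where w: "w \<in> ?U" "w \<noteq> 0" "F w = scale c w"
    using eigenvector_exists[OF U FU dim_at_most_subset[OF d], of v2] v2U v2(2) by blast
  have c: "c \<noteq> 0" using Fnz[of w] w by auto
  have "scale c (G w) = w" using F(2)[of w] w linear_endo_onD(3)[OF G, of w c] by auto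
  then have "G w = scale (inverse c) w" using c by (metis scale_scale left_inverse scale_one)
  then show ?thesis
    using w c M N by (intro exI[of _ w] exI[of _ "inverse c"] exI[of _ ?n]) auto
qed

end

section \<open>Linear differential equations with meromorphic coefficients\<close>

text \<open>Comparing the lowest coefficients \<open>n\<close> of a solution and of its derivative forces \<open>n = 0\<close>.\<close>

lemma fls_linear_ode_subdegree:
  fixes F :: "'i \<Rightarrow> complex fls" and b :: "'i \<Rightarrow> 'i \<Rightarrow> complex fls"
  assumes "finite I"
    and b: "\<And>i j. i \<in> I \<Longrightarrow> j \<in> I \<Longrightarrow> fls_subdegree (b i j) \<ge> 0"
    and ode: "\<And>i. i \<in> I \<Longrightarrow> fls_deriv (F i) = (\<Sum>j\<in>I. b i j * F j)"
    and nz: "\<exists>i\<in>I. F i \<noteq> 0"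
  shows "(\<forall>i\<in>I. fls_subdegree (F i) \<ge> 0) \<and> (\<exists>i\<in>I. fls_nth (F i) 0 \<noteq> 0)"
proof -
  define S where "S = (\<lambda>i. fls_subdegree (F i)) ` {i\<in>I. F i \<noteq> 0}"
  have S: "finite S" "S \<noteq> {}" using assms(1) nz by (auto simp: S_def)
  define n where "n = Min S"
  have "n \<in> S" unfolding n_def using S by (rule Min_in)
  then obtain i where i: "i \<in> I" "F i \<noteq> 0" "fls_subdegree (F i) = n" by (auto simp: S_def)
  have ge: "F j = 0 \<or> n \<le> fls_subdegree (F j)" if "j \<in> I" for j
    unfolding n_def using S(1) that by (cases "F j = 0") (auto simp: S_def intro!: Min_le)
  have "fls_nth (b i j * F j) (n - 1) = 0" if j: "j \<in> I" for j
    using ge[OF j] b[OF i(1) j] fls_times_nth_eq0[of "n - 1" "b i j" "F j"] by fastforce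
  then have "fls_nth (fls_deriv (F i)) (n - 1) = 0"
    using ode[OF i(1)] by (simp add: fls_nth_sum)
  moreover have ni: "fls_nth (F i) n \<noteq> 0" using i nth_fls_subdegree_nonzero by blast
  ultimately have "n = 0" by simp
  then have "fls_subdegree (F j) \<ge> 0" if "j \<in> I" for j
    using ge[OF that] by auto
  then show ?thesis using ni i(1) \<open>n = 0\<close> by auto
qed

section \<open>Convergent power series solutions of linear systems\<close>

fun power_series_solution :: "'i set \<Rightarrow> ('i \<Rightarrow> 'i \<Rightarrow> nat \<Rightarrow> complex) \<Rightarrow> nat \<Rightarrow> 'i \<Rightarrow> complex" where
  "power_series_solution I b 0 i = 1"
| "power_series_solution I b (Suc k) i =
     (\<Sum>l\<le>k. \<Sum>j\<in>I. b i j l * power_series_solution I b (k - l) j) / of_nat (Suc k)"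

text \<open>The n + 1 values of l contribute at most M L^n each, and the division by n + 1 cancels
  their number; M \<le> L then yields L^(n + 1).\<close>

lemma power_series_solution_bound:
  assumes "finite I" and b: "\<And>i l. i \<in> I \<Longrightarrow> (\<Sum>j\<in>I. norm (b i j l)) \<le> M * L ^ l"
    and M: "M \<ge> 0" "M \<le> L" and i: "i \<in> I"
  shows "norm (power_series_solution I b k i) \<le> L ^ k"
  using i
proof (induction k arbitrary: i rule: less_induct)
  case (less k)
  have L: "L \<ge> 0" using M by simp
  show ?case
  proof (cases k)
    case (Suc n)
    let ?a = "power_series_solution I b"
    have "norm (\<Sum>l\<le>n. \<Sum>j\<in>I. b i j l * ?a (n - l) j) \<le> (\<Sum>l\<le>n. M * L ^ n)"
    proof (rule sum_norm_le)
      fix l assume l: "l \<in> {..n}"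
      have "norm (\<Sum>j\<in>I. b i j l * ?a (n - l) j) \<le> (\<Sum>j\<in>I. norm (b i j l) * L ^ (n - l))"
      proof (rule sum_norm_le)
        fix j assume "j \<in> I"
        then have "norm (?a (n - l) j) \<le> L ^ (n - l)" using less.IH[of "n - l" j] Suc by simp
        then show "norm (b i j l * ?a (n - l) j) \<le> norm (b i j l) * L ^ (n - l)"
          by (simp add: norm_mult mult_left_mono)
      qed
      also have "\<dots> \<le> (M * L ^ l) * L ^ (n - l)"
        unfolding sum_distrib_right[symmetric] using b[OF less.prems] L by (intro mult_right_mono) auto
      also have "\<dots> = M * L ^ n" using l by (simp add: mult.assoc flip: power_add)
      finally show "norm (\<Sum>j\<in>I. b i j l * ?a (n - l) j) \<le> M * L ^ n" .
    qed
    also have "\<dots> = of_nat (Suc n) * (M * L ^ n)" by simp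
    also have "\<dots> \<le> of_nat (Suc n) * (L * L ^ n)"
      using M L by (intro mult_left_mono mult_right_mono) auto
    finally have "norm (\<Sum>l\<le>n. \<Sum>j\<in>I. b i j l * ?a (n - l) j) / of_nat (Suc n) \<le> L * L ^ n"
      by (simp add: divide_le_eq mult.commute del: of_nat_Suc)
    then show ?thesis using Suc by (simp add: norm_divide del: of_nat_Suc)
  qed simp
qed

lemma fps_conv_radius_pos_of_bound:
  fixes f :: "complex fps"
  assumes "\<And>k. norm (fps_nth f k) \<le> L ^ k" "L > 0"
  shows "fps_conv_radius f > 0"
proof -
  have "summable (\<lambda>k. fps_nth f k * of_real (1 / (2 * L)) ^ k)"
  proof (rule summable_comparison_test)
    have "norm (fps_nth f k * of_real (1 / (2 * L)) ^ k) \<le> (1/2) ^ k" for k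
    proof -
      have "norm (fps_nth f k * of_real (1 / (2 * L)) ^ k) = norm (fps_nth f k) * (1 / (2 * L)) ^ k"
        using assms(2) by (simp add: norm_mult norm_power norm_divide)
      also have "\<dots> \<le> L ^ k * (1 / (2 * L)) ^ k"
        using assms by (intro mult_right_mono) auto
      also have "\<dots> = (1/2) ^ k" using assms(2) by (simp flip: power_mult_distrib)
      finally show ?thesis .
    qed
    then show "\<exists>N. \<forall>n\<ge>N. norm (fps_nth f n * of_real (1 / (2 * L)) ^ n) \<le> (1/2) ^ n" by blast
    show "summable (\<lambda>n. (1 / 2 :: real) ^ n)" by (rule summable_geometric) simp
  qed
  then have "conv_radius (fps_nth f) \<ge> norm (of_real (1 / (2 * L)) :: complex)"
    by (rule conv_radius_geI)
  moreover have "ereal (norm (of_real (1 / (2 * L)) :: complex)) > 0" using assms(2) by simp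
  ultimately show ?thesis unfolding fps_conv_radius_def by (meson less_le_trans)
qed

text \<open>The terms of the series at a radius r inside the disc of convergence tend to 0 and are
  bounded, which gives L = 1 / r.\<close>

lemma fps_nth_geometric_bound:
  fixes f :: "complex fps"
  assumes "fps_conv_radius f > 0"
  shows "\<exists>M L. M \<ge> 0 \<and> L > 0 \<and> (\<forall>k. norm (fps_nth f k) \<le> M * L ^ k)"
proof -
  obtain r where r: "0 < ereal r" "ereal r < fps_conv_radius f"
    using ereal_dense2[OF assms] by blast
  then have "r > 0" by simp
  have "summable (\<lambda>k. fps_nth f k * of_real r ^ k)"
    by (rule summable_in_conv_radius) (use r in \<open>simp add: fps_conv_radius_def\<close>)
  then have "Bseq (\<lambda>k. fps_nth f k * of_real r ^ k)"
    using summable_LIMSEQ_zero convergent_def convergent_imp_Bseq by blast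
  then obtain M where M: "M > 0" "\<And>k. norm (fps_nth f k * of_real r ^ k) \<le> M"
    unfolding Bseq_def by blast
  have "norm (fps_nth f k) \<le> M * (1 / r) ^ k" for k
    using M(2)[of k] \<open>r > 0\<close> by (simp add: norm_mult norm_power power_divide field_simps)
  then show ?thesis using M(1) \<open>r > 0\<close> by (intro exI[of _ M] exI[of _ "1 / r"]) auto
qed

text \<open>Comparing coefficients gives the recursion \<open>power_series_solution\<close>, and a
  geometric majorant of its values proves convergence. The initial value 1 in every component is a
  convenient nonzero choice.\<close>

lemma fps_linear_ode_solution:
  fixes b :: "'i \<Rightarrow> 'i \<Rightarrow> complex fps"
  assumes fin: "finite I" and b: "\<And>i j. i \<in> I \<Longrightarrow> j \<in> I \<Longrightarrow> fps_conv_radius (b i j) > 0"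
  shows "\<exists>f. (\<forall>i\<in>I. fps_conv_radius (f i) > 0 \<and> fps_nth (f i) 0 = 1 \<and>
               fps_deriv (f i) = (\<Sum>j\<in>I. b i j * f j))"
proof -
  have "\<forall>i\<in>I. \<forall>j\<in>I. \<exists>M L. M \<ge> 0 \<and> L > 0 \<and> (\<forall>k. norm (fps_nth (b i j) k) \<le> M * L ^ k)"
    using fps_nth_geometric_bound b by blast
  then obtain M L where bnd: "\<And>i j. i \<in> I \<Longrightarrow> j \<in> I \<Longrightarrow> M i j \<ge> (0::real) \<and> L i j > (0::real) \<and>
      (\<forall>k. norm (fps_nth (b i j) k) \<le> M i j * L i j ^ k)" by metis
  \<comment> \<open>\<open>M0\<close> dominates the row sums in
    \<open>power_series_solution_bound\<close>, and \<open>L0\<close> dominates \<open>M0\<close>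
    and every rate \<open>L i j\<close>. Sums stand in for maxima, also for empty \<open>I\<close>;
    the summand 1 keeps \<open>L0\<close> positive.\<close>
  define M0 where "M0 = (\<Sum>i\<in>I. \<Sum>j\<in>I. M i j)"
  define L0 where "L0 = 1 + M0 + (\<Sum>i\<in>I. \<Sum>j\<in>I. L i j)"
  have M0: "M0 \<ge> 0" unfolding M0_def using bnd by (intro sum_nonneg) auto
  have sL: "(\<Sum>i\<in>I. \<Sum>j\<in>I. L i j) \<ge> 0" using bnd by (intro sum_nonneg) (auto intro: less_imp_le)
  have LL: "L i j \<le> L0" if "i \<in> I" "j \<in> I" for i j
  proof -
    have "L i j \<le> (\<Sum>j\<in>I. L i j)"
      using that bnd fin by (intro member_le_sum) (auto intro: less_imp_le)
    also have "\<dots> \<le> (\<Sum>i\<in>I. \<Sum>j\<in>I. L i j)"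
      using that bnd fin by (intro member_le_sum[of i I "\<lambda>i. \<Sum>j\<in>I. L i j"] sum_nonneg) (auto intro: less_imp_le)
    finally show ?thesis using M0 by (simp add: L0_def)
  qed
  define a where "a = power_series_solution I (\<lambda>i j. fps_nth (b i j))"
  define f where "f i = Abs_fps (\<lambda>k. a k i)" for i
  have bd: "norm (a k i) \<le> L0 ^ k" if i: "i \<in> I" for k i
    unfolding a_def
  proof (rule power_series_solution_bound[OF fin _ M0 _ i])
    show "M0 \<le> L0" using sL by (simp add: L0_def)
    fix i l assume i: "i \<in> I"
    have "(\<Sum>j\<in>I. norm (fps_nth (b i j) l)) \<le> (\<Sum>j\<in>I. M i j * L0 ^ l)"
    proof (rule sum_mono)
      fix j assume j: "j \<in> I"
      have "norm (fps_nth (b i j) l) \<le> M i j * L i j ^ l" using bnd[OF i j] by blast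
      also have "\<dots> \<le> M i j * L0 ^ l"
        using bnd[OF i j] LL[OF i j] by (intro mult_left_mono power_mono) auto
      finally show "norm (fps_nth (b i j) l) \<le> M i j * L0 ^ l" .
    qed
    also have "\<dots> = (\<Sum>j\<in>I. M i j) * L0 ^ l" by (simp add: sum_distrib_right)
    also have "\<dots> \<le> M0 * L0 ^ l"
    proof (rule mult_right_mono)
      show "(\<Sum>j\<in>I. M i j) \<le> M0" unfolding M0_def
        using i bnd fin by (intro member_le_sum[of i I "\<lambda>i. \<Sum>j\<in>I. M i j"] sum_nonneg) auto
      show "0 \<le> L0 ^ l" using M0 sL by (simp add: L0_def)
    qed
    finally show "(\<Sum>j\<in>I. norm (fps_nth (b i j) l)) \<le> M0 * L0 ^ l" .
  qed
  show ?thesis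
  proof (intro exI[of _ f] ballI conjI)
    fix i assume i: "i \<in> I"
    show "fps_conv_radius (f i) > 0"
      by (rule fps_conv_radius_pos_of_bound[of _ L0]) (use bd[OF i] M0 sL in \<open>auto simp: f_def L0_def\<close>)
    show "fps_nth (f i) 0 = 1" by (simp add: f_def a_def)
    show "fps_deriv (f i) = (\<Sum>j\<in>I. b i j * f j)"
    proof (rule fps_ext)
      fix k
      have "fps_nth (fps_deriv (f i)) k = of_nat (Suc k) * a (Suc k) i" by (simp add: f_def)
      also have "\<dots> = (\<Sum>l\<le>k. \<Sum>j\<in>I. fps_nth (b i j) l * a (k - l) j)"
        unfolding a_def power_series_solution.simps by (simp del: of_nat_Suc)
      also have "\<dots> = (\<Sum>j\<in>I. \<Sum>l\<le>k. fps_nth (b i j) l * a (k - l) j)" by (rule sum.swap)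
      also have "\<dots> = fps_nth (\<Sum>j\<in>I. b i j * f j) k"
        by (simp add: fps_sum_nth fps_mult_nth f_def atLeast0AtMost)
      finally show "fps_nth (fps_deriv (f i)) k = fps_nth (\<Sum>j\<in>I. b i j * f j) k" .
    qed
  qed
qed

text \<open>Both sides of the equation have the same power series at \<open>z0\<close> and hence
  agree near it; the radius r is chosen inside the discs of convergence.\<close>

lemma local_ode_solution:
  fixes B :: "'i \<Rightarrow> 'i \<Rightarrow> complex \<Rightarrow> complex"
  assumes fin: "finite I" and B: "\<And>i j. i \<in> I \<Longrightarrow> j \<in> I \<Longrightarrow> B i j analytic_on {z0}"
  shows "\<exists>y r. r > 0 \<and> (\<forall>i\<in>I. y i z0 = 1 \<and> y i analytic_on ball z0 r \<and>
           (\<forall>z\<in>ball z0 r. (y i has_field_derivative (\<Sum>j\<in>I. B i j z * y j z)) (at z)))"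
proof -
  define b where "b i j = fps_expansion (B i j) z0" for i j
  have b: "(\<lambda>x. B i j (z0 + x)) has_fps_expansion b i j" if "i \<in> I" "j \<in> I" for i j
    unfolding b_def by (rule analytic_at_imp_has_fps_expansion) (rule B[OF that])
  then have "fps_conv_radius (b i j) > 0" if "i \<in> I" "j \<in> I" for i j
    using that unfolding has_fps_expansion_def by blast
  then obtain f where f: "\<And>i. i \<in> I \<Longrightarrow> fps_conv_radius (f i) > 0" "\<And>i. i \<in> I \<Longrightarrow> fps_nth (f i) 0 = 1"
      "\<And>i. i \<in> I \<Longrightarrow> fps_deriv (f i) = (\<Sum>j\<in>I. b i j * f j)"
    using fps_linear_ode_solution[OF fin, of b] by metis
  have fe: "eval_fps (f i) has_fps_expansion f i" if "i \<in> I" for i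
    using f(1)[OF that] by (rule eval_fps_has_fps_expansion)
  have "eventually (\<lambda>x. deriv (eval_fps (f i)) x = (\<Sum>j\<in>I. B i j (z0 + x) * eval_fps (f j) x)) (nhds 0)"
    if i: "i \<in> I" for i
  proof -
    have "deriv (eval_fps (f i)) has_fps_expansion (\<Sum>j\<in>I. b i j * f j)"
      using has_fps_expansion_deriv[OF fe[OF i]] f(3)[OF i] by simp
    moreover have "(\<lambda>x. \<Sum>j\<in>I. B i j (z0 + x) * eval_fps (f j) x) has_fps_expansion (\<Sum>j\<in>I. b i j * f j)"
      by (intro has_fps_expansion_sum has_fps_expansion_mult b fe i)
    ultimately have "eventually (\<lambda>x. eval_fps (\<Sum>j\<in>I. b i j * f j) x = deriv (eval_fps (f i)) x) (nhds 0)"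
        "eventually (\<lambda>x. eval_fps (\<Sum>j\<in>I. b i j * f j) x = (\<Sum>j\<in>I. B i j (z0 + x) * eval_fps (f j) x)) (nhds 0)"
      unfolding has_fps_expansion_def by blast+
    then show ?thesis by eventually_elim simp
  qed
  then have "eventually (\<lambda>x. \<forall>i\<in>I. deriv (eval_fps (f i)) x = (\<Sum>j\<in>I. B i j (z0 + x) * eval_fps (f j) x)) (nhds 0)"
    using fin by (simp add: eventually_ball_finite)
  moreover have "eventually (\<lambda>x. \<forall>i\<in>I. x \<in> eball 0 (fps_conv_radius (f i))) (nhds (0::complex))"
  proof (intro eventually_ball_finite fin ballI eventually_nhds_in_open)
    show "0 \<in> eball (0::complex) (fps_conv_radius (f i))" if "i \<in> I" for i
      using f(1)[OF that] by (simp add: zero_ereal_def)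
  qed simp
  ultimately have "eventually (\<lambda>x. \<forall>i\<in>I. x \<in> eball 0 (fps_conv_radius (f i)) \<and>
      deriv (eval_fps (f i)) x = (\<Sum>j\<in>I. B i j (z0 + x) * eval_fps (f j) x)) (nhds 0)"
    by eventually_elim auto
  then obtain r where r: "r > 0" "\<And>x i. norm x < r \<Longrightarrow> i \<in> I \<Longrightarrow> x \<in> eball 0 (fps_conv_radius (f i)) \<and>
      deriv (eval_fps (f i)) x = (\<Sum>j\<in>I. B i j (z0 + x) * eval_fps (f j) x)"
    unfolding eventually_nhds_metric by (auto simp: dist_norm)
  define y where "y i z = eval_fps (f i) (z - z0)" for i z
  have d: "(y i has_field_derivative (\<Sum>j\<in>I. B i j z * y j z)) (at z)" if "i \<in> I" "z \<in> ball z0 r" for i z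
  proof -
    have n: "norm (z - z0) < r" using that by (simp add: dist_norm norm_minus_commute)
    have "(eval_fps (f i) has_field_derivative deriv (eval_fps (f i)) (z - z0)) (at (z - z0))"
      using has_field_derivative_eval_fps[of "z - z0" "f i"] r(2)[OF n that(1)] DERIV_imp_deriv
      by (metis in_eball_iff dist_0_norm)
    then have "((\<lambda>z. eval_fps (f i) (z - z0)) has_field_derivative deriv (eval_fps (f i)) (z - z0)) (at z)"
      using DERIV_shift[of "eval_fps (f i)" _ z "- z0"] by simp
    then show ?thesis using r(2)[OF n that(1)] by (simp add: y_def[abs_def])
  qed
  have "y i analytic_on ball z0 r" if "i \<in> I" for i
    unfolding analytic_on_open[OF open_ball] holomorphic_on_open[OF open_ball] using d[OF that] by blast
  moreover have "y i z0 = 1" if "i \<in> I" for i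
    using f(2)[OF that] by (simp add: y_def eval_fps_at_0)
  ultimately show ?thesis using r(1) d by blast
qed

section \<open>Solution spaces and uniqueness\<close>

locale meromorphic_ode =
  fixes I :: "'i set" and B :: "'i \<Rightarrow> 'i \<Rightarrow> complex \<Rightarrow> complex"
  assumes finite_I: "finite I"
    and meromorphic_B: "\<And>i j. i \<in> I \<Longrightarrow> j \<in> I \<Longrightarrow> B i j meromorphic_on UNIV"
begin

text \<open>All points where an entry fails to be analytic, not only its poles, since
  \<open>meromorphic_on\<close> permits arbitrary values at isolated points.\<close>

definition sing :: "complex set" where
  "sing = (\<Union>i\<in>I. \<Union>j\<in>I. {z. \<not> B i j analytic_on {z}})"

text \<open>Solutions on \<open>U\<close>, extended by \<open>0\<close> to \<^term>\<open>sing\<close> and outside \<open>U\<close>, so that they form a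
  subspace for the pointwise operations.\<close>

definition sol :: "complex set \<Rightarrow> ('i \<Rightarrow> complex \<Rightarrow> complex) set" where
  "sol U = {y. (\<forall>i z. i \<notin> I \<or> z \<notin> U \<or> z \<in> sing \<longrightarrow> y i z = 0) \<and>
     (\<forall>i\<in>I. y i meromorphic_on U) \<and>
     (\<forall>i\<in>I. \<forall>z\<in>U - sing. (y i has_field_derivative (\<Sum>j\<in>I. B i j z * y j z)) (at z))}"

text \<open>Brings functions that satisfy the equation up to isolated points into the normal form
  that \<open>sol U\<close> demands: limits at regular points, 0 elsewhere.\<close>

definition normalise :: "complex set \<Rightarrow> ('i \<Rightarrow> complex \<Rightarrow> complex) \<Rightarrow> 'i \<Rightarrow> complex \<Rightarrow> complex" where
  "normalise U h = (\<lambda>i z. if i \<in> I \<and> z \<in> U - sing then remove_sings (h i) z else 0)"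

lemma analytic_B: "z \<notin> sing \<Longrightarrow> i \<in> I \<Longrightarrow> j \<in> I \<Longrightarrow> B i j analytic_on {z}"
  unfolding sing_def by blast

lemma sparse_sing: "sing sparse_in UNIV"
  unfolding sing_def
  by (intro sparse_in_UN_finite finite_I meromorphic_on_imp_sparse_singularities meromorphic_B)

lemma closed_sing: "closed sing"
  using sparse_sing by (rule sparse_in_UNIV_imp_closed)

lemma open_Diff_sing: "open U \<Longrightarrow> open (U - sing)"
  using closed_sing by blast

lemma eventually_not_sing: "eventually (\<lambda>w. w \<notin> sing) (at z)"
  using eventually_not_in_cosparse[OF sparse_sing] by (simp add: eventually_cosparse_open_eq)

lemma regular_point_exists:
  assumes "open U" "U \<noteq> {}" shows "\<exists>z. z \<in> U - sing"
proof -
  obtain z where "z \<in> U" using assms by blast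
  then have "eventually (\<lambda>w. w \<in> U \<and> w \<notin> sing) (at z)"
    using eventually_not_sing eventually_at_in_open'[OF assms(1)] by (simp add: eventually_conj)
  then show ?thesis using eventually_happens[of _ "at z"] by fastforce
qed

lemma solD:
  assumes "y \<in> sol U"
  shows "i \<notin> I \<or> z \<notin> U \<or> z \<in> sing \<Longrightarrow> y i z = 0"
    "i \<in> I \<Longrightarrow> y i meromorphic_on U"
    "i \<in> I \<Longrightarrow> z \<in> U - sing \<Longrightarrow> (y i has_field_derivative (\<Sum>j\<in>I. B i j z * y j z)) (at z)"
  using assms unfolding sol_def by blast+

lemma solI:
  assumes "\<And>i z. i \<notin> I \<or> z \<notin> U \<or> z \<in> sing \<Longrightarrow> y i z = 0"
    "\<And>i. i \<in> I \<Longrightarrow> y i meromorphic_on U"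
    "\<And>i z. i \<in> I \<Longrightarrow> z \<in> U - sing \<Longrightarrow> (y i has_field_derivative (\<Sum>j\<in>I. B i j z * y j z)) (at z)"
  shows "y \<in> sol U"
  using assms unfolding sol_def by blast

lemma sol_holomorphic:
  assumes "y \<in> sol U" "open U" "i \<in> I" shows "y i holomorphic_on U - sing"
  unfolding holomorphic_on_open[OF open_Diff_sing[OF assms(2)]] using solD(3)[OF assms(1,3)] by blast

lemma sol_analytic:
  assumes "y \<in> sol U" "open U" "i \<in> I" "z \<in> U - sing" shows "y i analytic_on {z}"
  using sol_holomorphic[OF assms(1-3)] open_Diff_sing[OF assms(2)] assms(4)
  by (meson analytic_at)

lemma sol_remove_sings:
  assumes "y \<in> sol U" "open U" "i \<in> I" "z \<in> U - sing" shows "remove_sings (y i) z = y i z"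
  by (rule remove_sings_at_analytic) (rule sol_analytic[OF assms])

lemma zero_in_sol: "0 \<in> sol U"
  by (rule solI) (auto simp: zero_fun_def)

lemma add_in_sol:
  assumes x: "x \<in> sol U" and y: "y \<in> sol U" shows "x + y \<in> sol U"
proof (rule solI)
  show "(x + y) i z = 0" if "i \<notin> I \<or> z \<notin> U \<or> z \<in> sing" for i z
    using solD(1)[OF x that] solD(1)[OF y that] by simp
  show "(x + y) i meromorphic_on U" if "i \<in> I" for i
    using solD(2)[OF x that] solD(2)[OF y that] by (simp add: plus_fun_def meromorphic_intros)
  show "((x + y) i has_field_derivative (\<Sum>j\<in>I. B i j z * (x + y) j z)) (at z)"
    if "i \<in> I" "z \<in> U - sing" for i z
    using DERIV_add[OF solD(3)[OF x that] solD(3)[OF y that]]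
    by (simp add: plus_fun_def distrib_left sum.distrib)
qed

lemma scale_in_sol:
  assumes y: "y \<in> sol U" shows "(\<lambda>i z. c * y i z) \<in> sol U"
proof (rule solI)
  show "c * y i z = 0" if "i \<notin> I \<or> z \<notin> U \<or> z \<in> sing" for i z
    using solD(1)[OF y that] by simp
  show "(\<lambda>z. c * y i z) meromorphic_on U" if "i \<in> I" for i
    using solD(2)[OF y that] by (simp add: meromorphic_intros)
  show "((\<lambda>z. c * y i z) has_field_derivative (\<Sum>j\<in>I. B i j z * (c * y j z))) (at z)"
    if "i \<in> I" "z \<in> U - sing" for i z
    using DERIV_cmult[OF solD(3)[OF y that], of c]
    by (simp add: sum_distrib_left mult.left_commute)
qed

lemma diff_in_sol:
  assumes x: "x \<in> sol U" and y: "y \<in> sol U" shows "x - y \<in> sol U"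
proof -
  have "x - y = x + (\<lambda>i z. (- 1) * y i z)" by (simp add: fun_eq_iff)
  then show ?thesis using add_in_sol[OF x scale_in_sol[OF y]] by metis
qed

text \<open>At a regular point the coefficients are power series, so
  \<open>fls_linear_ode_subdegree\<close> applies to the Laurent expansions. Its first conclusion
  excludes poles of solutions there, its second is uniqueness for the initial value 0.\<close>

lemma laurent_solution:
  assumes z: "z \<notin> sing" and h: "\<And>i. i \<in> I \<Longrightarrow> h i meromorphic_on {z}"
    and ode: "\<And>i. i \<in> I \<Longrightarrow> eventually (\<lambda>w. deriv (h i) w = (\<Sum>j\<in>I. B i j w * h j w)) (at z)"
  shows "\<exists>F. (\<forall>i\<in>I. (\<lambda>w. h i (z + w)) has_laurent_expansion F i \<and> fls_subdegree (F i) \<ge> 0) \<and>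
    ((\<exists>i\<in>I. F i \<noteq> 0) \<longrightarrow> (\<exists>i\<in>I. fls_nth (F i) 0 \<noteq> 0))"
proof -
  have "\<forall>i\<in>I. \<exists>F. (\<lambda>w. h i (z + w)) has_laurent_expansion F"
    using h by (auto simp: meromorphic_on_def)
  then obtain F where F: "\<And>i. i \<in> I \<Longrightarrow> (\<lambda>w. h i (z + w)) has_laurent_expansion F i" by metis
  define b where "b i j = fps_to_fls (fps_expansion (B i j) z)" for i j
  have b: "(\<lambda>w. B i j (z + w)) has_laurent_expansion b i j" if "i \<in> I" "j \<in> I" for i j
    unfolding b_def
    by (intro has_laurent_expansion_fps analytic_at_imp_has_fps_expansion analytic_B z that)
  have bs: "fls_subdegree (b i j) \<ge> 0" for i j by (simp add: b_def fls_subdegree_fls_to_fps_gt0)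
  have eq: "fls_deriv (F i) = (\<Sum>j\<in>I. b i j * F j)" if i: "i \<in> I" for i
  proof -
    have "deriv (\<lambda>w. h i (z + w)) has_laurent_expansion fls_deriv (F i)"
      by (rule has_laurent_expansion_deriv[OF F[OF i]])
    moreover have "deriv (\<lambda>w. h i (z + w)) = (\<lambda>w. deriv (h i) (z + w))"
      using DERIV_shift[of "h i"] by (auto simp: deriv_def fun_eq_iff add.commute)
    ultimately have "(\<lambda>w. deriv (h i) (z + w)) has_laurent_expansion fls_deriv (F i)" by simp
    then have "(\<lambda>w. \<Sum>j\<in>I. B i j (z + w) * h j (z + w)) has_laurent_expansion fls_deriv (F i)"
      using has_laurent_expansion_cong'[OF ode[OF i] refl refl] by simp
    moreover have "(\<lambda>w. \<Sum>j\<in>I. B i j (z + w) * h j (z + w)) has_laurent_expansion (\<Sum>j\<in>I. b i j * F j)"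
      by (intro has_laurent_expansion_sum has_laurent_expansion_mult b F i)
    ultimately show ?thesis by (rule has_laurent_expansion_unique)
  qed
  show ?thesis
  proof (cases "\<exists>i\<in>I. F i \<noteq> 0")
    case True
    then show ?thesis using fls_linear_ode_subdegree[OF finite_I bs eq True] F by (intro exI[of _ F]) simp
  next
    case False
    then show ?thesis using F by (intro exI[of _ F]) simp
  qed
qed

text \<open>Singularities of h at regular points are removable by \<open>laurent_solution\<close>.
  The equation holds near such a point and both sides are continuous after removal, so it holds at
  the point.\<close>

lemma normalise_in_sol:
  assumes U: "open U" and h: "\<And>i. i \<in> I \<Longrightarrow> h i meromorphic_on U"
    and ode: "\<And>i z. i \<in> I \<Longrightarrow> z \<in> U \<Longrightarrow>
      eventually (\<lambda>w. deriv (h i) w = (\<Sum>j\<in>I. B i j w * h j w)) (at z)"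
  shows "normalise U h \<in> sol U"
proof (rule solI)
  let ?y = "normalise U h" and ?r = "\<lambda>i. remove_sings (h i)"
  show "?y i z = 0" if "i \<notin> I \<or> z \<notin> U \<or> z \<in> sing" for i z
    using that by (auto simp: normalise_def)
  show "?y i meromorphic_on U" if i: "i \<in> I" for i
  proof -
    have "eventually (\<lambda>w. ?r i w = ?y i w) (at z)" if "z \<in> U" for z
      using eventually_not_sing[of z] eventually_at_in_open'[OF U that]
      by eventually_elim (use i in \<open>auto simp: normalise_def\<close>)
    then show ?thesis
      using remove_sings_meromorphic[OF h[OF i]] meromorphic_on_cong[of U "?r i" "?y i" U] by blast
  qed
  have an: "?r i analytic_on {z}" if i: "i \<in> I" and z: "z \<in> U - sing" for i z
  proof -
    have hz: "h i meromorphic_on {z}" if "i \<in> I" for i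
      using h[OF that] meromorphic_on_subset z by blast
    have ode_z: "eventually (\<lambda>w. deriv (h i) w = (\<Sum>j\<in>I. B i j w * h j w)) (at z)" if "i \<in> I" for i
      using ode[OF that] z by blast
    obtain F where "(\<lambda>w. h i (z + w)) has_laurent_expansion F" "fls_subdegree F \<ge> 0"
      using laurent_solution[of z h, OF _ hz ode_z] z i by blast
    then have "h i \<midarrow>z\<rightarrow> fls_nth F 0"
      by (rule has_laurent_expansion_imp_tendsto)
    then show ?thesis
      using remove_sings_analytic_at hz[OF i] meromorphic_on_isolated_singularity by blast
  qed
  show "(?y i has_field_derivative (\<Sum>j\<in>I. B i j z * ?y j z)) (at z)"
    if i: "i \<in> I" and z: "z \<in> U - sing" for i z
  proof -
    have ev: "eventually (\<lambda>w. ?r j w = h j w \<and> h j analytic_on {w}) (at z)" if "j \<in> I" for j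
    proof (rule eventually_conj)
      show "eventually (\<lambda>w. ?r j w = h j w) (at z)"
        using eventually_remove_sings_eq[OF h[OF that]] z U by (auto simp: eventually_cosparse_open_eq)
      show "eventually (\<lambda>w. h j analytic_on {w}) (at z)"
        using meromorphic_on_imp_analytic_cosparse[OF h[OF that]] z U by (auto simp: eventually_cosparse_open_eq)
    qed
    then have ev': "eventually (\<lambda>w. \<forall>j\<in>I. ?r j w = h j w \<and> h j analytic_on {w}) (at z)"
      using finite_I by (simp add: eventually_ball_finite)
    have "eventually (\<lambda>w. deriv (h i) w = (\<Sum>j\<in>I. B i j w * h j w)) (at z)" using ode i z by blast
    then have eq: "eventually (\<lambda>w. deriv (?r i) w = (\<Sum>j\<in>I. B i j w * ?r j w)) (at z)"
      using ev' by eventually_elim (simp add: i)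
    have "(\<lambda>w. deriv (?r i) w) analytic_on {z}" "(\<lambda>w. \<Sum>j\<in>I. B i j w * ?r j w) analytic_on {z}"
      using an[OF _ z] i z by (auto intro!: analytic_intros analytic_deriv analytic_B)
    then have lim: "deriv (?r i) \<midarrow>z\<rightarrow> deriv (?r i) z"
        "(\<lambda>w. \<Sum>j\<in>I. B i j w * ?r j w) \<midarrow>z\<rightarrow> (\<Sum>j\<in>I. B i j z * ?r j z)"
      using analytic_at_imp_isCont isContD by blast+
    have "deriv (?r i) \<midarrow>z\<rightarrow> (\<Sum>j\<in>I. B i j z * ?r j z)"
      by (rule tendsto_cong[THEN iffD2, OF eq lim(2)])
    then have "deriv (?r i) z = (\<Sum>j\<in>I. B i j z * ?r j z)"
      using lim(1) tendsto_unique[OF at_neq_bot] by blast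
    moreover have "(?r i has_field_derivative deriv (?r i) z) (at z)"
      using an[OF i z] analytic_on_imp_differentiable_at DERIV_deriv_iff_field_differentiable by blast
    ultimately have "(?r i has_field_derivative (\<Sum>j\<in>I. B i j z * ?y j z)) (at z)"
      using z by (simp add: normalise_def)
    then show ?thesis
      by (rule has_field_derivative_transform_within_open[OF _ open_Diff_sing[OF U] z])
         (use i in \<open>auto simp: normalise_def\<close>)
  qed
qed

text \<open>Zero initial values force zero Laurent expansions by \<open>laurent_solution\<close>,
  and the identity theorem spreads the zeros over \<open>U - sing\<close>.\<close>

lemma sol_eq_0:
  assumes U: "open U" "connected U" and y: "y \<in> sol U" and z0: "z0 \<in> U - sing" and y0: "\<And>i. i \<in> I \<Longrightarrow> y i z0 = 0"
  shows "y = 0"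
proof -
  have ev: "eventually (\<lambda>w. deriv (y i) w = (\<Sum>j\<in>I. B i j w * y j w)) (at z0)" if "i \<in> I" for i
    using eventually_at_in_open'[OF open_Diff_sing[OF U(1)] z0]
    by eventually_elim (rule DERIV_imp_deriv[OF solD(3)[OF y that]])
  have mero: "y i meromorphic_on {z0}" if "i \<in> I" for i
    using solD(2)[OF y that] meromorphic_on_subset z0 by blast
  have "z0 \<notin> sing" using z0 by blast
  from laurent_solution[of z0 y, OF this mero ev]
  obtain F where F: "\<forall>i\<in>I. (\<lambda>w. y i (z0 + w)) has_laurent_expansion F i \<and> fls_subdegree (F i) \<ge> 0"
      "(\<exists>i\<in>I. F i \<noteq> 0) \<longrightarrow> (\<exists>i\<in>I. fls_nth (F i) 0 \<noteq> 0)"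
    by blast
  have "fls_nth (F i) 0 = 0" if "i \<in> I" for i
  proof -
    have "y i \<midarrow>z0\<rightarrow> fls_nth (F i) 0"
      using has_laurent_expansion_imp_tendsto F(1) that by blast
    moreover have "y i \<midarrow>z0\<rightarrow> 0"
      using sol_analytic[OF y U(1) that z0] analytic_at_imp_isCont isContD y0[OF that] by fastforce
    ultimately show ?thesis using tendsto_unique[OF at_neq_bot] by blast
  qed
  then have "F i = 0" if "i \<in> I" for i using F(2) that by blast
  then have ev0: "eventually (\<lambda>z. y i z = 0) (at z0)" if "i \<in> I" for i
    using has_laurent_expansion_eventually_zero_iff F(1) that by metis
  \<comment> \<open>Removing a countable set does not disconnect a connected open set in the
    plane.\<close>
  have conn: "connected (U - sing)"
    using connected_open_diff_countable[of U sing] U sparse_imp_countable[OF open_UNIV sparse_sing] by simp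
  have "y i z = 0" if i: "i \<in> I" and z: "z \<in> U - sing" for i z
  proof -
    let ?Z = "{w \<in> U - sing. y i w = 0}"
    have "eventually (\<lambda>w. w \<in> ?Z) (at z0)"
      using ev0[OF i] eventually_at_in_open'[OF open_Diff_sing[OF U(1)] z0] by eventually_elim auto
    then have lim: "z0 islimpt ?Z"
      unfolding islimpt_conv_frequently_at by (intro eventually_frequently at_neq_bot)
    show ?thesis
      by (rule analytic_continuation[OF sol_holomorphic[OF y U(1) i] open_Diff_sing[OF U(1)] conn _ z0 lim _ z])
         blast+
  qed
  then have "y i z = 0" for i z
    using solD(1)[OF y, of i z] by (cases "i \<in> I \<and> z \<in> U - sing") blast+
  then show ?thesis by (simp add: fun_eq_iff)
qed

lemma restrict_in_sol:
  assumes y: "y \<in> sol U" and "U' \<subseteq> U" "open U'"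
  shows "(\<lambda>i z. if z \<in> U' then y i z else 0) \<in> sol U'" (is "?x \<in> _")
proof (rule solI)
  show "?x i z = 0" if "i \<notin> I \<or> z \<notin> U' \<or> z \<in> sing" for i z
    using solD(1)[OF y] that by auto
  show "?x i meromorphic_on U'" if i: "i \<in> I" for i
  proof -
    have "eventually (\<lambda>w. y i w = ?x i w) (at z)" if "z \<in> U'" for z
      using eventually_at_in_open'[OF assms(3) that] by eventually_elim auto
    then show ?thesis
      using meromorphic_on_subset[OF solD(2)[OF y i] assms(2)] meromorphic_on_cong[of U' "y i" "?x i" U'] by blast
  qed
  show "(?x i has_field_derivative (\<Sum>j\<in>I. B i j z * ?x j z)) (at z)" if i: "i \<in> I" and z: "z \<in> U' - sing" for i z
  proof -
    have "(y i has_field_derivative (\<Sum>j\<in>I. B i j z * ?x j z)) (at z)"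
      using solD(3)[OF y i, of z] z assms(2) by auto
    then show ?thesis
      by (rule has_field_derivative_transform_within_open[OF _ assms(3)]) (use z in auto)
  qed
qed

lemma translate_in_sol:
  assumes B: "\<And>i j z. i \<in> I \<Longrightarrow> j \<in> I \<Longrightarrow> B i j (z + c) = B i j z" and y: "y \<in> sol U"
  shows "(\<lambda>i z. y i (z + c)) \<in> sol {z. z + c \<in> U}"
proof (rule solI)
  \<comment> \<open>Periodicity of \<open>B\<close> makes \<open>sing\<close> invariant under the
    translation, so that the zeros prescribed on \<open>sing\<close> move along.\<close>
  have "z + c \<in> sing \<longleftrightarrow> z \<in> sing" for z
  proof -
    have sh: "(\<lambda>w. f (w + d)) analytic_on {z}" if "f analytic_on {z + d}" for f :: "complex \<Rightarrow> complex" and z d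
      using analytic_on_compose_gen[of "\<lambda>w. w + d" "{z}" f "{z + d}"] that
      by (simp add: o_def analytic_on_add)
    have "B i j analytic_on {z + c} \<longleftrightarrow> B i j analytic_on {z}" if "i \<in> I" "j \<in> I" for i j
    proof
      assume "B i j analytic_on {z + c}"
      from sh[OF this] show "B i j analytic_on {z}" using B that by simp
    next
      assume "B i j analytic_on {z}"
      then have "(\<lambda>w. B i j (w + (- c))) analytic_on {z + c}" by (intro sh) simp
      moreover have "B i j (w + (- c)) = B i j w" for w using B[OF that, of "w - c"] by simp
      ultimately show "B i j analytic_on {z + c}" by simp
    qed
    then show ?thesis unfolding sing_def by blast
  qed
  note s = this
  show "y i (z + c) = 0" if "i \<notin> I \<or> z \<notin> {z. z + c \<in> U} \<or> z \<in> sing" for i z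
    using that solD(1)[OF y, of i "z + c"] s by blast
  show "(\<lambda>z. y i (z + c)) meromorphic_on {z. z + c \<in> U}" if "i \<in> I" for i
    by (rule meromorphic_on_compose[OF solD(2)[OF y that]]) (auto intro!: analytic_intros)
  show "((\<lambda>z. y i (z + c)) has_field_derivative (\<Sum>j\<in>I. B i j z * y j (z + c))) (at z)"
    if "i \<in> I" "z \<in> {z. z + c \<in> U} - sing" for i z
    using solD(3)[OF y that(1), of "z + c"] that s B by (auto simp: DERIV_shift)
qed

lemma local_sol_exists:
  assumes "z0 \<notin> sing" "I \<noteq> {}"
  shows "\<exists>r>0. \<exists>y\<in>sol (ball z0 r). y \<noteq> 0"
proof -
  obtain y r where r: "r > 0" and y: "\<And>i. i \<in> I \<Longrightarrow> y i z0 = 1" "\<And>i. i \<in> I \<Longrightarrow> y i analytic_on ball z0 r"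
    "\<And>i z. i \<in> I \<Longrightarrow> z\<in>ball z0 r \<Longrightarrow> (y i has_field_derivative (\<Sum>j\<in>I. B i j z * y j z)) (at z)"
    using local_ode_solution[OF finite_I, of B z0] analytic_B[OF assms(1)] by blast
  let ?y = "normalise (ball z0 r) y"
  have "?y \<in> sol (ball z0 r)"
  proof (rule normalise_in_sol)
    show "y i meromorphic_on ball z0 r" if "i \<in> I" for i
      by (rule analytic_on_imp_meromorphic_on) (rule y(2)[OF that])
    show "eventually (\<lambda>w. deriv (y i) w = (\<Sum>j\<in>I. B i j w * y j w)) (at z)" if "i \<in> I" "z \<in> ball z0 r" for i z
      using eventually_at_in_open'[OF open_ball that(2)]
      by eventually_elim (rule DERIV_imp_deriv[OF y(3)[OF that(1)]])
  qed simp
  moreover obtain i where "i \<in> I" using assms by blast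
  then have "?y i z0 = 1"
    using y(1)[of i] y(2)[of i] r assms(1) analytic_on_subset[of "y i" "ball z0 r" "{z0}"] by (simp add: normalise_def)
  then have "?y \<noteq> 0" by auto
  ultimately show ?thesis using r by blast
qed

end

text \<open>Rounding down the real coordinates of c with respect to a and b leaves a remainder in
  the fundamental parallelogram.\<close>

lemma complex_lattice_cobounded:
  fixes a b :: complex
  assumes "a \<noteq> b" "independent {a, b}"
  shows "\<exists>d. \<forall>c. \<exists>m n :: int. norm (c - (of_int m * a + of_int n * b)) \<le> d"
proof (rule exI[of _ "norm a + norm b"], rule allI)
  fix c
  have "c \<in> span {a, b}"
    using card_ge_dim_independent[of "{a, b}" UNIV] assms by auto
  then obtain s t where "c - s *\<^sub>R a - t *\<^sub>R b = 0"
    by (auto simp: span_breakdown_eq)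
  then have c: "c = s *\<^sub>R a + t *\<^sub>R b" by (simp add: algebra_simps)
  have "c - (of_int \<lfloor>s\<rfloor> * a + of_int \<lfloor>t\<rfloor> * b) = (s - of_int \<lfloor>s\<rfloor>) *\<^sub>R a + (t - of_int \<lfloor>t\<rfloor>) *\<^sub>R b"
    unfolding c by (simp add: scaleR_conv_of_real algebra_simps)
  also have "norm \<dots> \<le> \<bar>s - of_int \<lfloor>s\<rfloor>\<bar> * norm a + \<bar>t - of_int \<lfloor>t\<rfloor>\<bar> * norm b"
    by (rule norm_triangle_le) simp
  also have "\<dots> \<le> 1 * norm a + 1 * norm b"
  proof -
    have "\<bar>x - of_int \<lfloor>x\<rfloor>\<bar> \<le> 1" for x :: real by linarith
    then show ?thesis by (intro add_mono mult_right_mono) auto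
  qed
  finally have "norm (c - (of_int \<lfloor>s\<rfloor> * a + of_int \<lfloor>t\<rfloor> * b)) \<le> norm a + norm b" by simp
  then show "\<exists>m n :: int. norm (c - (of_int m * a + of_int n * b)) \<le> norm a + norm b" by blast
qed

lemma eventually_at_scaled:
  fixes q z :: complex
  assumes "q \<noteq> 0" "eventually P (at (q * z))"
  shows "eventually (\<lambda>w. P (q * w)) (at z)"
proof -
  have "filterlim (\<lambda>w. q * w) (at (q * z)) (at z)"
    by (rule filterlim_atI) (use assms(1) in \<open>auto intro!: tendsto_eq_intros simp: eventually_at_filter\<close>)
  then show ?thesis using assms(2) by (rule eventually_compose_filterlim[rotated])
qed

lemma fun_pow_translate:
  "((\<lambda>y i z. y i (z + c)) ^^ n) y = (\<lambda>i z. y i (z + of_nat n * (c::complex)))"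
  by (induction n arbitrary: y) (simp_all add: algebra_simps)

interpretation function_vs: complex_vector_space "\<lambda>c (y :: 'i \<Rightarrow> complex \<Rightarrow> complex) i z. c * y i z"
  by unfold_locales (auto simp: fun_eq_iff algebra_simps)

interpretation vector_vs: complex_vector_space "\<lambda>c (v :: 'i \<Rightarrow> complex) i. c * v i"
  by unfold_locales (auto simp: fun_eq_iff algebra_simps)

lemma vector_dim_at_most:
  assumes "finite I"
  shows "\<exists>d. vector_vs.dim_at_most {v :: 'i \<Rightarrow> complex. \<forall>i. i \<notin> I \<longrightarrow> v i = 0} d"
proof -
  let ?e = "\<lambda>i j. if j = i then 1 else (0::complex)"
  have "v \<in> vector_vs.span (?e ` I)" if v: "\<forall>i. i \<notin> I \<longrightarrow> v i = 0" for v :: "'i \<Rightarrow> complex"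
  proof -
    have "v = (\<Sum>i\<in>I. (\<lambda>j. v i * ?e i j))"
    proof
      fix j
      have "(\<Sum>i\<in>I. (\<lambda>j. v i * ?e i j)) j = (\<Sum>i\<in>I. v i * ?e i j)"
        by (induction I rule: infinite_finite_induct) auto
      also have "\<dots> = v j" using v assms by (simp add: if_distrib cong: if_cong)
      finally show "v j = (\<Sum>i\<in>I. (\<lambda>j. v i * ?e i j)) j" by simp
    qed
    moreover have "(\<Sum>i\<in>I. (\<lambda>j. v i * ?e i j)) \<in> vector_vs.span (?e ` I)"
      by (intro vector_vs.span_sum vector_vs.span_scale vector_vs.span_base imageI)
    ultimately show ?thesis by simp
  qed
  then have "{v :: 'i \<Rightarrow> complex. \<forall>i. i \<notin> I \<longrightarrow> v i = 0} \<subseteq> vector_vs.span (?e ` I)" by blast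
  then show ?thesis
    using vector_vs.dim_at_most_subset[OF vector_vs.dim_at_most_span[of "?e ` I"]] assms by blast
qed

section \<open>Finite dimension and global solutions\<close>

context meromorphic_ode
begin

text \<open>Solutions are continuous at regular points and 0 elsewhere. Identities known only up to
  isolated points, such as those for \<open>push\<close>, thus become equations between
  solutions.\<close>

lemma sol_eqI:
  assumes x: "x \<in> sol U" and y: "y \<in> sol U" and U: "open U"
    and ev: "\<And>i z. i \<in> I \<Longrightarrow> z \<in> U - sing \<Longrightarrow> eventually (\<lambda>w. x i w = y i w) (at z)"
  shows "x = y"
proof (intro ext)
  fix i z
  show "x i z = y i z"
  proof (cases "i \<in> I \<and> z \<in> U - sing")
    case True
    then have lim: "x i \<midarrow>z\<rightarrow> x i z" "y i \<midarrow>z\<rightarrow> y i z"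
      using sol_analytic[OF x U] sol_analytic[OF y U] analytic_at_imp_isCont isContD by blast+
    have "x i \<midarrow>z\<rightarrow> y i z" by (rule tendsto_cong[THEN iffD2, OF ev lim(2)]) (use True in blast)+
    then show ?thesis using lim(1) tendsto_unique[OF at_neq_bot] by blast
  next
    case False
    then show ?thesis using solD(1)[OF x] solD(1)[OF y] by (metis DiffI)
  qed
qed

lemma subspace_sol: "function_vs.subspace (sol U)"
  by (rule function_vs.subspaceI) (auto intro: zero_in_sol add_in_sol scale_in_sol)

text \<open>Evaluation at a regular point is linear and, by \<open>sol_eq_0\<close>, injective, so
  it carries independent solutions to independent vectors of initial values.\<close>

lemma sol_dim_at_most:
  assumes U: "open U" "connected U" "U \<noteq> {}"
  shows "\<exists>d. function_vs.dim_at_most (sol U) d"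
proof -
  obtain z0 where z0: "z0 \<in> U - sing" using regular_point_exists[OF U(1,3)] by blast
  obtain d where d: "vector_vs.dim_at_most {v :: 'i \<Rightarrow> complex. \<forall>i. i \<notin> I \<longrightarrow> v i = 0} d"
    using vector_dim_at_most[OF finite_I] by blast
  let ?e = "\<lambda>(y :: 'i \<Rightarrow> complex \<Rightarrow> complex) i. y i z0"
  interpret ev: Vector_Spaces.linear "\<lambda>c (y :: 'i \<Rightarrow> complex \<Rightarrow> complex) i z. c * y i z" "\<lambda>c (v :: 'i \<Rightarrow> complex) i. c * v i" ?e
    by unfold_locales (auto simp: fun_eq_iff)
  have inj: "inj_on ?e (sol U)"
  proof (rule inj_onI)
    fix x y assume "x \<in> sol U" "y \<in> sol U" "?e x = ?e y"
    then have "x - y = 0"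
      by (intro sol_eq_0[OF U(1,2) diff_in_sol z0]) (auto simp: fun_eq_iff)
    then show "x = y" by simp
  qed
  have "finite S \<and> card S \<le> d" if S: "S \<subseteq> sol U" "function_vs.independent S" for S
  proof -
    have "function_vs.span S \<subseteq> sol U" by (rule function_vs.span_minimal[OF S(1) subspace_sol])
    then have i: "inj_on ?e (function_vs.span S)" "inj_on ?e S"
      using inj S(1) inj_on_subset by blast+
    have "vector_vs.independent (?e ` S)" by (rule ev.independent_injective_image[OF S(2) i(1)])
    moreover have "?e ` S \<subseteq> {v. \<forall>i. i \<notin> I \<longrightarrow> v i = 0}" using S(1) solD(1) by blast
    ultimately have "finite (?e ` S) \<and> card (?e ` S) \<le> d"
      using d unfolding vector_vs.dim_at_most_def by blast
    then show ?thesis using i(2) card_image finite_imageD by metis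
  qed
  then show ?thesis unfolding function_vs.dim_at_most_def by blast
qed

text \<open>The values at \<open>z0\<close> of solutions on larger and larger balls form a decreasing sequence of
  nonzero subspaces, so that some value extends to all of them.\<close>

lemma global_sol_exists:
  assumes big: "\<And>R. R > 0 \<Longrightarrow> \<exists>y\<in>sol (ball 0 R). y \<noteq> 0"
  shows "\<exists>y\<in>sol UNIV. y \<noteq> 0"
proof -
  obtain z0 where "z0 \<in> UNIV - sing" using regular_point_exists[of UNIV] by auto
  then have z0: "z0 \<notin> sing" by simp
  \<comment> \<open>The summand \<open>norm z0\<close> puts \<open>z0\<close> into every ball; the
    summand 1 puts each z into the ball whose index is \<open>norm z\<close> rounded up.\<close>
  define R where "R n = norm z0 + 1 + real n" for n
  have R: "R n > 0" "norm z0 < R n" for n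
    unfolding R_def using norm_ge_zero[of z0] of_nat_0_le_iff[of n, where ?'a = real] by linarith+
  have z0R: "z0 \<in> ball 0 (R n) - sing" for n using z0 R by simp
  let ?e = "\<lambda>(y :: 'i \<Rightarrow> complex \<Rightarrow> complex) i. y i z0"
  define S where "S n = ?e ` sol (ball 0 (R n))" for n
  obtain d where d: "vector_vs.dim_at_most {v :: 'i \<Rightarrow> complex. \<forall>i. i \<notin> I \<longrightarrow> v i = 0} d"
    using vector_dim_at_most[OF finite_I] by blast
  have "\<exists>u. u \<noteq> 0 \<and> (\<forall>n. u \<in> S n)"
  proof (rule vector_vs.decreasing_subspaces_Inter[OF d])
    fix n
    show "vector_vs.subspace (S n)"
    proof (rule vector_vs.subspaceI)
      show "0 \<in> S n" unfolding S_def by (rule image_eqI[OF _ zero_in_sol]) (simp add: fun_eq_iff)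
      show "u + v \<in> S n" if uv: "u \<in> S n" "v \<in> S n" for u v
      proof -
        obtain x y where "x \<in> sol (ball 0 (R n))" "y \<in> sol (ball 0 (R n))" "u = ?e x" "v = ?e y"
          using uv unfolding S_def by blast
        then show ?thesis unfolding S_def
            by (intro image_eqI[of _ _ "x + y"] add_in_sol) (auto simp: fun_eq_iff)
      qed
      show "(\<lambda>i. c * v i) \<in> S n" if v: "v \<in> S n" for c v
      proof -
        obtain y where "y \<in> sol (ball 0 (R n))" "v = ?e y" using v unfolding S_def by blast
        then show ?thesis unfolding S_def by (intro image_eqI[OF _ scale_in_sol]) (auto simp: fun_eq_iff)
      qed
    qed
    show "S n \<subseteq> {v. \<forall>i. i \<notin> I \<longrightarrow> v i = 0}" unfolding S_def using solD(1) by blast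
    obtain y where y: "y \<in> sol (ball 0 (R n))" "y \<noteq> 0" using big[OF R(1)] by blast
    have "?e y \<noteq> 0"
    proof
      assume "?e y = 0"
      then have "y i z0 = 0" for i by (metis zero_fun_apply)
      then show False using sol_eq_0[OF open_ball connected_ball y(1) z0R] y(2) by blast
    qed
    then show "\<exists>u\<in>S n. u \<noteq> 0" unfolding S_def using y(1) by blast
  next
    fix m n :: nat assume mn: "m \<le> n"
    then have sub: "ball 0 (R m) \<subseteq> ball 0 (R n)" by (auto simp: R_def)
    show "S n \<subseteq> S m"
    proof
      fix v assume "v \<in> S n"
      then obtain y where y: "y \<in> sol (ball 0 (R n))" "v = ?e y" unfolding S_def by blast
      show "v \<in> S m" unfolding S_def
        by (rule image_eqI[OF _ restrict_in_sol[OF y(1) sub open_ball]]) (use y(2) R in auto)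
    qed
  qed
  then obtain u where u: "u \<noteq> 0" "\<And>n. u \<in> S n" by blast
  then have "\<forall>n. \<exists>y. y \<in> sol (ball 0 (R n)) \<and> u = ?e y" unfolding S_def by blast
  then obtain Y where Y: "\<And>n. Y n \<in> sol (ball 0 (R n))" "\<And>n. u = ?e (Y n)" by metis
  have YY: "Y n i z = Y m i z" if mn: "m \<le> n" and z: "z \<in> ball 0 (R m)" for m n i z
  proof -
    have sub: "ball 0 (R m) \<subseteq> ball 0 (R n)" using mn by (auto simp: R_def)
    let ?r = "\<lambda>i z. if z \<in> ball 0 (R m) then Y n i z else 0"
    have "?r - Y m = 0"
    proof (rule sol_eq_0[OF open_ball connected_ball _ z0R])
      show "?r - Y m \<in> sol (ball 0 (R m))" by (intro diff_in_sol restrict_in_sol[OF Y(1) sub open_ball] Y(1))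
      show "(?r - Y m) i z0 = 0" for i
      proof -
        have "?e (Y n) = ?e (Y m)" using Y(2) by metis
        then have "Y n i z0 = Y m i z0" by (rule fun_cong)
        then show ?thesis using R(2)[of m] by simp
      qed
    qed
    then have "(?r - Y m) i z = 0" by (metis zero_fun_apply)
    then show ?thesis using z by simp
  qed
  \<comment> \<open>\<open>Y n\<close> and \<open>Y m\<close> share the value u at \<open>z0\<close>
    and so coincide on the smaller ball. Any sufficiently large index may therefore be used at
    z.\<close>
  define y where "y i z = Y (nat \<lceil>norm z\<rceil>) i z" for i z
  have inR: "z \<in> ball 0 (R (nat \<lceil>norm z\<rceil>))" for z :: complex
  proof -
    have "norm z \<le> real (nat \<lceil>norm z\<rceil>)" by linarith
    then have "norm z < R (nat \<lceil>norm z\<rceil>)" unfolding R_def using norm_ge_zero[of z0] by linarith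
    then show ?thesis by simp
  qed
  have yY: "y i z = Y n i z" if "z \<in> ball 0 (R n)" for i z n
    unfolding y_def using YY[OF _ that] YY[OF _ inR[of z]] by (metis nat_le_linear)
  have "y \<in> sol UNIV"
  proof (rule solI)
    show "y i z = 0" if "i \<notin> I \<or> z \<notin> UNIV \<or> z \<in> sing" for i z
      using solD(1)[OF Y(1)] that by (auto simp: y_def)
    show "y i meromorphic_on UNIV" if i: "i \<in> I" for i
      unfolding meromorphic_on_meromorphic_at[of _ UNIV]
    proof
      fix z :: complex
      let ?n = "nat \<lceil>norm z\<rceil>"
      have "eventually (\<lambda>w. Y ?n i w = y i w) (at z)"
        using eventually_at_in_open'[OF open_ball inR] by eventually_elim (simp add: yY)
      moreover have "Y ?n i meromorphic_on {z}"
        using solD(2)[OF Y(1) i] meromorphic_on_subset inR by blast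
      ultimately show "y i meromorphic_on {z}"
        using meromorphic_on_cong[of "{z}" "Y ?n i" "y i" "{z}"] by blast
    qed
    show "(y i has_field_derivative (\<Sum>j\<in>I. B i j z * y j z)) (at z)" if i: "i \<in> I" and z: "z \<in> UNIV - sing" for i and z :: complex
    proof -
      let ?n = "nat \<lceil>norm z\<rceil>"
      have "(Y ?n i has_field_derivative (\<Sum>j\<in>I. B i j z * y j z)) (at z)"
        using solD(3)[OF Y(1) i, of z ?n] z inR[of z] by (simp add: y_def)
      then show ?thesis
        by (rule has_field_derivative_transform_within_open[OF _ open_ball inR]) (simp add: yY)
    qed
  qed
  moreover have "y \<noteq> 0"
  proof
    assume "y = 0"
    then have "u i = 0" for i using Y(2)[of "nat \<lceil>norm z0\<rceil>"] by (auto simp: y_def fun_eq_iff)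
    then show False using u(1) by (simp add: fun_eq_iff)
  qed
  ultimately show ?thesis by blast
qed

end

section \<open>Equations compatible with a dilation\<close>

text \<open>The matrix form of an integrable \<open>\<phi>\<close>-module: the equation \<open>y' = B y\<close> together with an
  invertible \<open>A\<close> such that \<open>y\<close> is a solution if and only if \<open>z \<mapsto> A (z / q) y (z / q)\<close> is.\<close>

locale dilation_ode = meromorphic_ode I B
  for I :: "'i set" and B :: "'i \<Rightarrow> 'i \<Rightarrow> complex \<Rightarrow> complex" +
  fixes A E :: "'i \<Rightarrow> 'i \<Rightarrow> complex \<Rightarrow> complex" and q :: nat and \<omega>1 \<omega>2 :: complex
  assumes I_nonempty: "I \<noteq> {}" and q_ge_2: "q \<ge> 2"
    and meromorphic_A: "\<And>i j. i \<in> I \<Longrightarrow> j \<in> I \<Longrightarrow> A i j meromorphic_on UNIV"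
    and periods_independent: "\<omega>1 \<noteq> \<omega>2" "independent {\<omega>1, \<omega>2}"
    and periodic_B: "\<And>i j z. i \<in> I \<Longrightarrow> j \<in> I \<Longrightarrow> B i j (z + \<omega>1) = B i j z"
      "\<And>i j z. i \<in> I \<Longrightarrow> j \<in> I \<Longrightarrow> B i j (z + \<omega>2) = B i j z"
    and periodic_A: "\<And>i j z. i \<in> I \<Longrightarrow> j \<in> I \<Longrightarrow> A i j (z + \<omega>1) = A i j z"
      "\<And>i j z. i \<in> I \<Longrightarrow> j \<in> I \<Longrightarrow> A i j (z + \<omega>2) = A i j z"
    and compatible: "\<And>i j z0. i \<in> I \<Longrightarrow> j \<in> I \<Longrightarrow> eventually (\<lambda>z.
        deriv (A i j) z + (\<Sum>k\<in>I. A i k z * B k j z) =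
        of_nat q * (\<Sum>k\<in>I. B i k (of_nat q * z) * A k j z)) (at z0)"
    and left_inverse: "\<And>i j z0. i \<in> I \<Longrightarrow> j \<in> I \<Longrightarrow> eventually (\<lambda>z.
        (\<Sum>k\<in>I. E i k z * A k j z) = (if i = j then 1 else 0)) (at z0)"
begin

section \<open>Transport of solutions along the dilation\<close>

abbreviation qc :: complex where "qc \<equiv> of_nat q"

lemma qc_nz: "qc \<noteq> 0" using q_ge_2 by simp

text \<open>The operator G of the overview; the inverse of \<phi> divides the argument by q, and
  \<open>normalise\<close> repairs the values at poles of \<open>A\<close> and on
  \<open>sing\<close>.\<close>

definition push :: "complex set \<Rightarrow> ('i \<Rightarrow> complex \<Rightarrow> complex) \<Rightarrow> 'i \<Rightarrow> complex \<Rightarrow> complex" where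
  "push U y = normalise {z. z / qc \<in> U} (\<lambda>i z. \<Sum>j\<in>I. A i j (z / qc) * y j (z / qc))"

lemma open_scaled: "open U \<Longrightarrow> open {z. z / qc \<in> U}"
  using open_vimage[of U "\<lambda>z. z / qc"] qc_nz by (simp add: vimage_def continuous_intros)

lemma eventually_at_div: "eventually P (at (z / qc)) \<Longrightarrow> eventually (\<lambda>w. P (w / qc)) (at z)"
  using eventually_at_scaled[of "inverse qc" P z] qc_nz by (simp add: field_simps)

lemma meromorphic_push:
  assumes "y \<in> sol U" "i \<in> I"
  shows "(\<lambda>z. \<Sum>j\<in>I. A i j (z / qc) * y j (z / qc)) meromorphic_on {z. z / qc \<in> U}"
proof (intro meromorphic_on_sum meromorphic_on_mult)
  fix j assume j: "j \<in> I"
  show "(\<lambda>z. A i j (z / qc)) meromorphic_on {z. z / qc \<in> U}"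
    by (rule meromorphic_on_compose[OF meromorphic_A[OF assms(2) j]])
       (use qc_nz in \<open>auto intro!: analytic_intros\<close>)
  show "(\<lambda>z. y j (z / qc)) meromorphic_on {z. z / qc \<in> U}"
    by (rule meromorphic_on_compose[OF solD(2)[OF assms(1) j]])
       (use qc_nz in \<open>auto intro!: analytic_intros\<close>)
qed

text \<open>By the chain rule the derivative at q v is (1 / q) (A' + A B) y evaluated at v, and
  compatibility replaces A' + A B by q B(q v) A, whose factor q cancels.\<close>

lemma push_in_sol:
  assumes y: "y \<in> sol U" and U: "open U"
  shows "push U y \<in> sol {z. z / qc \<in> U}"
  unfolding push_def
proof (rule normalise_in_sol[OF open_scaled[OF U] meromorphic_push[OF y]])
  fix i z assume i: "i \<in> I" and z: "z \<in> {z. z / qc \<in> U}"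
  let ?h = "\<lambda>i z. \<Sum>j\<in>I. A i j (z / qc) * y j (z / qc)"
  have zU: "z / qc \<in> U" using z by simp
  have "eventually (\<lambda>w. \<forall>j\<in>I. A i j analytic_on {w}) (at (z / qc))"
    using finite_I meromorphic_on_imp_analytic_cosparse[OF meromorphic_A[OF i]]
    by (intro eventually_ball_finite) (auto simp: eventually_cosparse_open_eq)
  moreover have "eventually (\<lambda>w. \<forall>j\<in>I. deriv (A i j) w + (\<Sum>k\<in>I. A i k w * B k j w) =
        qc * (\<Sum>k\<in>I. B i k (qc * w) * A k j w)) (at (z / qc))"
    using finite_I compatible[OF i] by (intro eventually_ball_finite) auto
  ultimately have "eventually (\<lambda>w. w \<in> U \<and> w \<notin> sing \<and> (\<forall>j\<in>I. A i j analytic_on {w}) \<and>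
      (\<forall>j\<in>I. deriv (A i j) w + (\<Sum>k\<in>I. A i k w * B k j w) =
        qc * (\<Sum>k\<in>I. B i k (qc * w) * A k j w))) (at (z / qc))"
    using eventually_not_sing[of "z / qc"] eventually_at_in_open'[OF U zU] by eventually_elim blast
  then have "eventually (\<lambda>w. w / qc \<in> U \<and> w / qc \<notin> sing \<and> (\<forall>j\<in>I. A i j analytic_on {w / qc}) \<and>
      (\<forall>j\<in>I. deriv (A i j) (w / qc) + (\<Sum>k\<in>I. A i k (w / qc) * B k j (w / qc)) =
        qc * (\<Sum>k\<in>I. B i k (qc * (w / qc)) * A k j (w / qc)))) (at z)"
    by (rule eventually_at_div)
  then show "eventually (\<lambda>w. deriv (?h i) w = (\<Sum>j\<in>I. B i j w * ?h j w)) (at z)"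
  proof eventually_elim
    case (elim w)
    define v where "v = w / qc"
    have qv: "qc * v = w" using qc_nz by (simp add: v_def)
    have v: "v \<in> U - sing" using elim by (simp add: v_def)
    have rel: "deriv (A i j) v + (\<Sum>k\<in>I. A i k v * B k j v) = qc * (\<Sum>k\<in>I. B i k w * A k j v)" if "j \<in> I" for j
      using elim that qv unfolding v_def by auto
    have "((\<lambda>z. z / qc) has_field_derivative 1 / qc) (at w)"
      using q_ge_2 by (auto intro!: derivative_eq_intros)
    note comp = DERIV_chain2[OF _ this]
    have dA: "(A i j has_field_derivative deriv (A i j) v) (at v)" if "j \<in> I" for j
      using elim that analytic_on_imp_differentiable_at DERIV_deriv_iff_field_differentiable
      unfolding v_def by blast
    have "((\<lambda>z. A i j (z / qc) * y j (z / qc)) has_field_derivative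
        deriv (A i j) v * (1 / qc) * y j v + (\<Sum>k\<in>I. B j k v * y k v) * (1 / qc) * A i j v) (at w)"
      if "j \<in> I" for j
      using DERIV_mult[OF comp[OF dA[OF that, unfolded v_def]] comp[OF solD(3)[OF y that v, unfolded v_def]]]
      by (simp add: v_def)
    then have "(?h i has_field_derivative
        (\<Sum>j\<in>I. deriv (A i j) v * (1 / qc) * y j v + (\<Sum>k\<in>I. B j k v * y k v) * (1 / qc) * A i j v)) (at w)"
      by (rule DERIV_sum)
    then have "deriv (?h i) w = (\<Sum>j\<in>I. deriv (A i j) v * (1 / qc) * y j v + (\<Sum>k\<in>I. B j k v * y k v) * (1 / qc) * A i j v)"
      by (rule DERIV_imp_deriv)
    also have "\<dots> = (1 / qc) * (\<Sum>j\<in>I. deriv (A i j) v * y j v) + (1 / qc) * (\<Sum>j\<in>I. \<Sum>k\<in>I. A i j v * B j k v * y k v)"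
      by (simp add: sum.distrib sum_distrib_left sum_distrib_right mult_ac)
    also have "(\<Sum>j\<in>I. \<Sum>k\<in>I. A i j v * B j k v * y k v) = (\<Sum>k\<in>I. (\<Sum>j\<in>I. A i j v * B j k v) * y k v)"
      by (subst sum.swap) (simp add: sum_distrib_right)
    also have "(1 / qc) * (\<Sum>j\<in>I. deriv (A i j) v * y j v) + (1 / qc) * (\<Sum>k\<in>I. (\<Sum>j\<in>I. A i j v * B j k v) * y k v)
        = (1 / qc) * (\<Sum>j\<in>I. (deriv (A i j) v + (\<Sum>k\<in>I. A i k v * B k j v)) * y j v)"
      by (simp add: distrib_right distrib_left sum.distrib)
    also have "\<dots> = (1 / qc) * (\<Sum>j\<in>I. (qc * (\<Sum>k\<in>I. B i k w * A k j v)) * y j v)"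
      using rel by simp
    also have "\<dots> = (\<Sum>j\<in>I. (\<Sum>k\<in>I. B i k w * A k j v) * y j v)"
      unfolding sum_distrib_left[of "1 / qc"] using qc_nz by (intro sum.cong refl) simp
    also have "\<dots> = (\<Sum>k\<in>I. B i k w * ?h k w)"
      by (simp add: sum_distrib_left sum_distrib_right mult.assoc v_def) (rule sum.swap)
    finally show ?case .
  qed
qed

lemma eventually_push:
  assumes y: "y \<in> sol U" and U: "open U" and i: "i \<in> I" and z: "z / qc \<in> U"
  shows "eventually (\<lambda>w. push U y i w = (\<Sum>j\<in>I. A i j (w / qc) * y j (w / qc))) (at z)"
proof -
  have z': "z \<in> {z. z / qc \<in> U}" using z by simp
  have "eventually (\<lambda>w. remove_sings (\<lambda>z. \<Sum>j\<in>I. A i j (z / qc) * y j (z / qc)) w =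
      (\<Sum>j\<in>I. A i j (w / qc) * y j (w / qc))) (at z)"
    using eventually_remove_sings_eq[OF meromorphic_push[OF y i]] z' open_scaled[OF U]
    by (simp add: eventually_cosparse_open_eq)
  then show ?thesis
    using eventually_not_sing eventually_at_in_open'[OF open_scaled[OF U] z']
    by eventually_elim (simp add: push_def normalise_def i)
qed

text \<open>Off isolated points the hypothesis says that A y = 0, and the left inverse
  \<open>E\<close> recovers y.\<close>

lemma push_eq_0:
  assumes y: "y \<in> sol U" and U: "open U" and 0: "push U y = 0"
  shows "y = 0"
proof (rule sol_eqI[OF y zero_in_sol U])
  fix i z assume i: "i \<in> I" and z: "z \<in> U - sing"
  have zU: "(qc * z) / qc \<in> U" using z qc_nz by simp
  have "eventually (\<lambda>w. 0 = (\<Sum>j\<in>I. A k j (w / qc) * y j (w / qc))) (at (qc * z))" if "k \<in> I" for k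
    using eventually_push[OF y U that zU] by (simp add: 0)
  then have "eventually (\<lambda>w. 0 = (\<Sum>j\<in>I. A k j w * y j w)) (at z)" if "k \<in> I" for k
    using eventually_at_scaled[OF qc_nz, of _ z] that qc_nz by fastforce
  then have "eventually (\<lambda>w. \<forall>k\<in>I. 0 = (\<Sum>j\<in>I. A k j w * y j w)) (at z)"
    using finite_I by (simp add: eventually_ball_finite)
  moreover have "eventually (\<lambda>w. \<forall>j\<in>I. (\<Sum>k\<in>I. E i k w * A k j w) = (if i = j then 1 else 0)) (at z)"
    using finite_I left_inverse[OF i] by (intro eventually_ball_finite) auto
  ultimately show "eventually (\<lambda>w. y i w = 0 i w) (at z)"
  proof eventually_elim
    case (elim w)
    have "y i w = (\<Sum>j\<in>I. (if i = j then 1 else 0) * y j w)"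
      using finite_I i by (simp add: if_distrib[of "\<lambda>x. x * _"] cong: if_cong)
    also have "\<dots> = (\<Sum>j\<in>I. (\<Sum>k\<in>I. E i k w * A k j w) * y j w)" using elim by simp
    also have "\<dots> = (\<Sum>k\<in>I. E i k w * (\<Sum>j\<in>I. A k j w * y j w))"
      by (simp add: sum_distrib_left sum_distrib_right mult.assoc) (rule sum.swap)
    also have "\<dots> = 0" using elim(1) by (auto intro!: sum.neutral)
    finally show ?case by simp
  qed
qed

section \<open>Solutions on large discs\<close>

lemma pushed_sol_exists:
  assumes "y \<in> sol (ball c r)" "y \<noteq> 0"
  shows "\<exists>y\<in>sol (ball (qc ^ k * c) (real q ^ k * r)). y \<noteq> 0"
proof (induction k)
  case 0
  show ?case using assms by (simp only: power_0 mult_1) blast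
next
  case (Suc k)
  then obtain x where x: "x \<in> sol (ball (qc ^ k * c) (real q ^ k * r))" "x \<noteq> 0" by blast
  have "{z. z / qc \<in> ball b s} = ball (qc * b) (real q * s)" for b s
  proof -
    have "norm (b - z / qc) = norm (qc * b - z) / real q" for z
      using qc_nz by (simp add: norm_divide[symmetric] diff_divide_distrib norm_of_nat[symmetric, where 'a = complex] del: norm_of_nat)
    then have "z / qc \<in> ball b s \<longleftrightarrow> z \<in> ball (qc * b) (real q * s)" for z
      unfolding mem_ball dist_norm using q_ge_2 by (simp add: divide_less_eq mult.commute)
    then show ?thesis by blast
  qed
  then have "push (ball (qc ^ k * c) (real q ^ k * r)) x \<in> sol (ball (qc ^ Suc k * c) (real q ^ Suc k * r))"
    using push_in_sol[OF x(1) open_ball] by (simp add: mult.assoc)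
  then show ?case using push_eq_0[OF x(1) open_ball] x(2) by blast
qed

lemma periodic_B_lattice:
  assumes "i \<in> I" "j \<in> I"
  shows "B i j (z + (of_int m * \<omega>1 + of_int n * \<omega>2)) = B i j z"
proof -
  have per: "f (z + of_int m * \<omega>) = f z" if f: "\<And>z. f (z + \<omega>) = f z"
    for f :: "complex \<Rightarrow> complex" and m \<omega> z
  proof -
    have nat: "f (z + of_nat n * \<omega>) = f z" for n z
      by (induction n arbitrary: z) (use f in \<open>auto simp: algebra_simps simp flip: add.assoc\<close>)
    show ?thesis
    proof (cases "m \<ge> 0")
      case True
      then show ?thesis using nat[of z "nat m"] by simp
    next
      case False
      then show ?thesis using nat[of "z + of_int m * \<omega>" "nat (- m)"] by simp
    qed
  qed
  show ?thesis
    using per[of "B i j" \<omega>1 z m] per[of "B i j" \<omega>2 "z + of_int m * \<omega>1" n] periodic_B[OF assms]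
    by (simp add: add.assoc)
qed

text \<open>The disc obtained by k applications of \<open>push\<close> is centred at q^k z0,
  possibly far from 0, but a period brings the centre within a distance d of 0 that depends on the
  lattice alone. Only the radius has to grow.\<close>

lemma sol_on_ball_exists:
  assumes "R > 0"
  shows "\<exists>y\<in>sol (ball 0 R). y \<noteq> 0"
proof -
  obtain z0 where "z0 \<in> UNIV - sing" using regular_point_exists[of UNIV] by auto
  then obtain r y0 where r: "r > 0" and y0: "y0 \<in> sol (ball z0 r)" "y0 \<noteq> 0"
    using local_sol_exists[of z0] I_nonempty by blast
  obtain d where d: "\<And>c. \<exists>m n :: int. norm (c - (of_int m * \<omega>1 + of_int n * \<omega>2)) \<le> d"
    using complex_lattice_cobounded[OF periods_independent] by blast
  \<comment> \<open>This means q^k r > R + d, which leaves room for the translated centre at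
    distance up to d from 0.\<close>
  obtain k where k: "(R + d) / r < real q ^ k"
    using real_arch_pow[of "real q"] q_ge_2 by auto
  obtain x where x: "x \<in> sol (ball (qc ^ k * z0) (real q ^ k * r))" "x \<noteq> 0"
    using pushed_sol_exists[OF y0] by blast
  obtain m n :: int where mn: "norm (qc ^ k * z0 - (of_int m * \<omega>1 + of_int n * \<omega>2)) \<le> d"
    using d by blast
  define \<mu> where "\<mu> = of_int m * \<omega>1 + of_int n * \<omega>2"
  define U where "U = ball (qc ^ k * z0 - \<mu>) (real q ^ k * r)"
  have "{z. z + \<mu> \<in> ball (qc ^ k * z0) (real q ^ k * r)} = U"
    by (auto simp: U_def dist_norm algebra_simps)
  moreover have "B i j (z + \<mu>) = B i j z" if "i \<in> I" "j \<in> I" for i j z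
    unfolding \<mu>_def by (rule periodic_B_lattice[OF that])
  ultimately have t: "(\<lambda>i z. x i (z + \<mu>)) \<in> sol U" (is "?t \<in> _")
    using translate_in_sol[OF _ x(1), of \<mu>] by simp
  have sub: "ball 0 R \<subseteq> U"
  proof
    fix z :: complex assume "z \<in> ball 0 R"
    then have "norm z < R" by simp
    have "norm (qc ^ k * z0 - \<mu> - z) \<le> d + norm z"
      using norm_triangle_ineq4[of "qc ^ k * z0 - \<mu>" z] mn unfolding \<mu>_def by linarith
    also have "\<dots> < real q ^ k * r" using \<open>norm z < R\<close> k r by (simp add: field_simps)
    finally show "z \<in> U" by (simp add: U_def dist_norm)
  qed
  let ?r = "\<lambda>i z. if z \<in> ball 0 R then ?t i z else 0"
  have "?r \<in> sol (ball 0 R)" by (rule restrict_in_sol[OF t sub open_ball])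
  moreover have "?r \<noteq> 0"
  proof
    assume r0: "?r = 0"
    \<comment> \<open>A solution that vanishes at a regular point of the small ball vanishes on the
      connected set \<open>U\<close>, so the restriction of a nonzero solution is nonzero.\<close>
    obtain z1 where z1: "z1 \<in> ball 0 R - sing" using regular_point_exists[of "ball 0 R"] assms
      by (metis centre_in_ball empty_iff open_ball)
    have "?t i z1 = 0" for i
      using fun_cong[OF fun_cong[OF r0, of i], of z1] z1 by simp
    moreover have "z1 \<in> U - sing" using z1 sub by blast
    ultimately have "?t = 0"
      using sol_eq_0[OF _ _ t, of z1] by (simp add: U_def)
    then have "x i z = 0" for i z using fun_cong[OF fun_cong[OF \<open>?t = 0\<close>, of i], of "z - \<mu>"] by simp
    then show False using x(2) by (simp add: fun_eq_iff)
  qed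
  ultimately show ?thesis by blast
qed

text \<open>\<open>push\<close> divides the argument by q, so a shift by q c outside is a shift by c
  inside. With \<open>fun_pow_translate\<close> this is the relation t^q G = G t.\<close>

lemma push_translate:
  assumes y: "y \<in> sol UNIV" and B: "\<And>i j z. i \<in> I \<Longrightarrow> j \<in> I \<Longrightarrow> B i j (z + c) = B i j z"
    and A: "\<And>i j z. i \<in> I \<Longrightarrow> j \<in> I \<Longrightarrow> A i j (z + c) = A i j z"
  shows "(\<lambda>i z. push UNIV y i (z + qc * c)) = push UNIV (\<lambda>i z. y i (z + c))"
proof -
  have BN: "B i j (z + of_nat n * c) = B i j z" if "i \<in> I" "j \<in> I" for i j z n
    by (induction n arbitrary: z) (use B[OF that] in \<open>auto simp: algebra_simps simp flip: add.assoc\<close>)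
  have p: "push UNIV x \<in> sol UNIV" if "x \<in> sol UNIV" for x
    using push_in_sol[OF that open_UNIV] by simp
  have t: "(\<lambda>i z. y i (z + c)) \<in> sol UNIV"
    using translate_in_sol[OF B y] by simp
  have l: "(\<lambda>i z. push UNIV y i (z + qc * c)) \<in> sol UNIV"
    using translate_in_sol[OF BN[of _ _ _ q] p[OF y]] by simp
  show ?thesis
  proof (rule sol_eqI[OF l p[OF t] open_UNIV])
    fix i z assume i: "i \<in> I"
    have "filterlim (\<lambda>w. w + qc * c) (at (z + qc * c)) (at z)"
      by (rule filterlim_atI) (auto intro!: tendsto_eq_intros simp: eventually_at_filter)
    then have "eventually (\<lambda>w. push UNIV y i (w + qc * c) =
        (\<Sum>j\<in>I. A i j ((w + qc * c) / qc) * y j ((w + qc * c) / qc))) (at z)"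
      by (rule eventually_compose_filterlim[OF eventually_push[OF y open_UNIV i UNIV_I]])
    then show "eventually (\<lambda>w. push UNIV y i (w + qc * c) = push UNIV (\<lambda>i z. y i (z + c)) i w) (at z)"
      using eventually_push[OF t open_UNIV i UNIV_I, of z]
    proof eventually_elim
      case (elim w)
      have "(w + qc * c) / qc = w / qc + c" using qc_nz by (simp add: add_divide_distrib)
      then have "push UNIV y i (w + qc * c) = (\<Sum>j\<in>I. A i j (w / qc) * y j (w / qc + c))"
        unfolding elim(1) using A[OF i] by (intro sum.cong refl) simp
      then show ?case unfolding elim(2) .
    qed
  qed
qed

text \<open>\<open>remove_sings\<close> need not commute with sums of arbitrary functions, so
  linearity is claimed on solutions only, where \<open>sol_eqI\<close> reduces it to agreement off
  isolated points.\<close>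

lemma linear_endo_push: "linear_endo_on (\<lambda>c y i z. c * y i z) (sol UNIV) (push UNIV)"
proof (rule linear_endo_onI)
  show p: "push UNIV x \<in> sol UNIV" if "x \<in> sol UNIV" for x
    using push_in_sol[OF that open_UNIV] by simp
  show "push UNIV (x + y) = push UNIV x + push UNIV y" if x: "x \<in> sol UNIV" and y: "y \<in> sol UNIV" for x y
  proof (rule sol_eqI[OF p[OF add_in_sol[OF x y]] add_in_sol[OF p[OF x] p[OF y]] open_UNIV])
    fix i z assume i: "i \<in> I"
    show "eventually (\<lambda>w. push UNIV (x + y) i w = (push UNIV x + push UNIV y) i w) (at z)"
      using eventually_push[OF add_in_sol[OF x y] open_UNIV i UNIV_I, of z]
        eventually_push[OF x open_UNIV i UNIV_I, of z] eventually_push[OF y open_UNIV i UNIV_I, of z]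
      by eventually_elim (simp add: distrib_left sum.distrib)
  qed
  show "push UNIV (\<lambda>i z. c * y i z) = (\<lambda>i z. c * push UNIV y i z)" if y: "y \<in> sol UNIV" for c y
  proof (rule sol_eqI[OF p[OF scale_in_sol[OF y]] scale_in_sol[OF p[OF y]] open_UNIV])
    fix i z assume i: "i \<in> I"
    show "eventually (\<lambda>w. push UNIV (\<lambda>i z. c * y i z) i w = c * push UNIV y i w) (at z)"
      using eventually_push[OF scale_in_sol[OF y, of c] open_UNIV i UNIV_I, of z]
        eventually_push[OF y open_UNIV i UNIV_I, of z]
      by eventually_elim (simp add: sum_distrib_left mult_ac)
  qed
qed

section \<open>Periodic eigensolutions\<close>

lemma periodic_eigensolution_exists:
  "\<exists>y\<in>sol UNIV. y \<noteq> 0 \<and> (\<exists>c N. c \<noteq> 0 \<and> N > 0 \<and> push UNIV y = (\<lambda>i z. c * y i z) \<and>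
     (\<forall>i z. y i (z + of_nat N * \<omega>1) = y i z \<and> y i (z + of_nat N * \<omega>2) = y i z))"
proof -
  obtain y0 where y0: "y0 \<in> sol UNIV" "y0 \<noteq> 0"
    using global_sol_exists[OF sol_on_ball_exists] by blast
  obtain d where d: "function_vs.dim_at_most (sol UNIV) d"
    using sol_dim_at_most[OF open_UNIV connected_UNIV] by blast
  let ?t = "\<lambda>c (y :: 'i \<Rightarrow> complex \<Rightarrow> complex) i z. y i (z + c)"
  have lin: "linear_endo_on (\<lambda>c y i z. c * y i z) (sol UNIV) (?t c)"
    if B: "\<And>i j z. i \<in> I \<Longrightarrow> j \<in> I \<Longrightarrow> B i j (z + c) = B i j z" for c
  proof (rule linear_endo_onI)
    show "?t c x \<in> sol UNIV" if "x \<in> sol UNIV" for x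
      using translate_in_sol[OF B that] by simp
  qed (simp_all add: fun_eq_iff)
  have lin1: "linear_endo_on (\<lambda>c y i z. c * y i z) (sol UNIV) (?t \<omega>1)" by (rule lin) (rule periodic_B)
  have lin2: "linear_endo_on (\<lambda>c y i z. c * y i z) (sol UNIV) (?t \<omega>2)" by (rule lin) (rule periodic_B)
  have inj: "y = 0" if "?t c y = 0" for c y
  proof (intro ext)
    fix i z
    have "?t c y i (z - c) = 0" using that by (metis zero_fun_apply)
    then show "y i z = 0 i z" by simp
  qed
  have "\<exists>v c N. v \<in> sol UNIV \<and> v \<noteq> 0 \<and> N > 0 \<and> c \<noteq> 0 \<and>
      (?t \<omega>1 ^^ N) v = v \<and> (?t \<omega>2 ^^ N) v = v \<and> push UNIV v = (\<lambda>i z. c * v i z)"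
  proof (rule function_vs.periodic_eigenvector_exists[OF subspace_sol d y0 lin1 lin2 linear_endo_push])
    fix x assume x: "x \<in> sol UNIV"
    show "x = 0" if "push UNIV x = 0" using push_eq_0[OF x open_UNIV that] .
    show "x = 0" if "?t \<omega>1 x = 0" using inj[OF that] .
    show "x = 0" if "?t \<omega>2 x = 0" using inj[OF that] .
    show "?t \<omega>1 (?t \<omega>2 x) = ?t \<omega>2 (?t \<omega>1 x)" by (simp add: algebra_simps)
    show "(?t \<omega>1 ^^ q) (push UNIV x) = push UNIV (?t \<omega>1 x)"
      unfolding fun_pow_translate by (rule push_translate[OF x periodic_B(1) periodic_A(1)])
    show "(?t \<omega>2 ^^ q) (push UNIV x) = push UNIV (?t \<omega>2 x)"
      unfolding fun_pow_translate by (rule push_translate[OF x periodic_B(2) periodic_A(2)])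
  qed (rule q_ge_2)
  then obtain v c N where v: "v \<in> sol UNIV" "v \<noteq> 0" "N > 0" "c \<noteq> 0"
      "push UNIV v = (\<lambda>i z. c * v i z)"
      "(\<lambda>i z. v i (z + of_nat N * \<omega>1)) = v" "(\<lambda>i z. v i (z + of_nat N * \<omega>2)) = v"
    unfolding fun_pow_translate by blast
  have "v i (z + of_nat N * \<omega>1) = v i z \<and> v i (z + of_nat N * \<omega>2) = v i z" for i z
    using fun_cong[OF fun_cong[OF v(6), of i], of z] fun_cong[OF fun_cong[OF v(7), of i], of z] by simp
  then show ?thesis using v(1-5) by blast
qed

text \<open>The value 0 that \<open>sol\<close> prescribes on \<open>sing\<close> may violate
  \<open>nicely_meromorphic_on\<close>, so \<open>remove_sings\<close> is applied once more. The
  equations then hold off isolated points, which is all that matters in K.\<close>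

lemma elliptic_eigensolution_exists:
  "\<exists>v c N. c \<noteq> 0 \<and> N > 0 \<and> (\<exists>i\<in>I. v i \<noteq> (\<lambda>_. 0)) \<and>
     (\<forall>i\<in>I. v i nicely_meromorphic_on UNIV \<and>
        (\<forall>z. v i (z + of_nat N * \<omega>1) = v i z \<and> v i (z + of_nat N * \<omega>2) = v i z) \<and>
        (\<forall>z0. eventually (\<lambda>z. deriv (v i) z = (\<Sum>j\<in>I. B i j z * v j z)) (at z0)) \<and>
        (\<forall>z0. eventually (\<lambda>z. (\<Sum>j\<in>I. A i j z * v j z) = c * v i (qc * z)) (at z0)))"
proof -
  obtain y c N where y: "y \<in> sol UNIV" "y \<noteq> 0" and c: "c \<noteq> 0" and N: "N > 0"
    and p: "push UNIV y = (\<lambda>i z. c * y i z)"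
    and per: "\<And>i z. y i (z + of_nat N * \<omega>1) = y i z" "\<And>i z. y i (z + of_nat N * \<omega>2) = y i z"
    using periodic_eigensolution_exists by blast
  let ?v = "\<lambda>i. remove_sings (y i)"
  have nice: "?v i nicely_meromorphic_on UNIV" if "i \<in> I" for i
    by (rule remove_sings_nicely_meromorphic[OF solD(2)[OF y(1) that]])
  have vy: "?v i z = y i z" if "i \<in> I" "z \<notin> sing" for i z
    using sol_remove_sings[OF y(1) open_UNIV, of i z] that by simp
  have ev: "eventually (\<lambda>z. \<forall>i\<in>I. ?v i z = y i z) (at z0)" for z0
    using eventually_not_sing by eventually_elim (use vy in blast)
  have q: "eventually (\<lambda>z. (\<Sum>j\<in>I. A i j z * ?v j z) = c * ?v i (qc * z)) (at z0)" if i: "i \<in> I" for i z0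
  proof -
    have "eventually (\<lambda>w. c * ?v i w = (\<Sum>j\<in>I. A i j (w / qc) * y j (w / qc))) (at (qc * z0))"
      using eventually_push[OF y(1) open_UNIV i UNIV_I] ev[of "qc * z0"]
      by eventually_elim (use i in \<open>simp add: p\<close>)
    from eventually_at_scaled[OF qc_nz this]
    have "eventually (\<lambda>z. c * ?v i (qc * z) = (\<Sum>j\<in>I. A i j z * y j z)) (at z0)"
      using qc_nz by simp
    then show ?thesis using ev[of z0] by eventually_elim simp
  qed
  have d: "eventually (\<lambda>z. deriv (?v i) z = (\<Sum>j\<in>I. B i j z * ?v j z)) (at z0)" if i: "i \<in> I" for i z0
    using eventually_not_sing ev[of z0]
  proof eventually_elim
    case (elim z)
    have "y i analytic_on {z}" by (rule sol_analytic[OF y(1) open_UNIV i]) (use elim in simp)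
    then have "deriv (?v i) z = deriv (y i) z" by (rule deriv_remove_sings_at_analytic)
    also have "\<dots> = (\<Sum>j\<in>I. B i j z * y j z)"
      by (rule DERIV_imp_deriv[OF solD(3)[OF y(1) i]]) (use elim in simp)
    finally show ?case using elim by simp
  qed
  have "\<exists>i\<in>I. ?v i \<noteq> (\<lambda>_. 0)"
  proof (rule ccontr)
    assume "\<not> ?thesis"
    then have "y i z = 0" if "i \<in> I" "z \<notin> sing" for i z using vy[OF that] that by metis
    then have "y i z = 0" for i z using solD(1)[OF y(1)] by blast
    then show False using y(2) by (simp add: fun_eq_iff)
  qed
  moreover have "?v i (z + of_nat N * \<omega>1) = ?v i z \<and> ?v i (z + of_nat N * \<omega>2) = ?v i z" for i z
    using remove_sings_periodic per by metis
  ultimately show ?thesis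
    using c N nice d q by (intro exI[of _ ?v] exI[of _ c] exI[of _ N]) blast
qed

end

section \<open>Coordinates and hyperplanes\<close>

text \<open>The field as a space over itself, so that a functional becomes a linear map to which
  rank-nullity applies.\<close>

definition self_module :: "('a, 'm) ring_scheme \<Rightarrow> ('a, 'a) module" where
  "self_module K = \<lparr>carrier = carrier K, mult = mult K, one = one K, zero = zero K, add = add K, smult = mult K\<rparr>"

lemma vectorspace_self_module:
  assumes "field K"
  shows "vectorspace K (self_module K)"
proof -
  interpret field K by fact
  show ?thesis
    by (rule vs_criteria) (auto simp: self_module_def field_axioms a_ac m_ac l_distr r_distr intro: r_neg a_inv_closed)
qed

lemma dim_self_module:
  assumes "field K"
  shows "vectorspace.dim K (self_module K) = 1"
proof -
  interpret field K by fact
  interpret S: vectorspace K "self_module K" by (rule vectorspace_self_module) fact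
  have c: "carrier (self_module K) = carrier K" "\<zero>\<^bsub>self_module K\<^esub> = \<zero>\<^bsub>K\<^esub>"
    by (simp_all add: self_module_def)
  show ?thesis
  proof (rule S.dim1I[of "\<one>\<^bsub>K\<^esub>"])
    have "x \<in> S.span {\<one>\<^bsub>K\<^esub>}" if x: "x \<in> carrier K" for x
    proof -
      have sm: "x \<odot>\<^bsub>self_module K\<^esub> \<one>\<^bsub>K\<^esub> = x" using x by (simp add: self_module_def)
      have "S.lincomb (\<lambda>_. x) ({} \<union> {\<one>\<^bsub>K\<^esub>}) =
          x \<odot>\<^bsub>self_module K\<^esub> \<one>\<^bsub>K\<^esub> \<oplus>\<^bsub>self_module K\<^esub> S.lincomb (\<lambda>_. x) {}"
        by (rule S.lincomb_insert) (use x c in auto)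
      then have "S.lincomb (\<lambda>_. x) {\<one>\<^bsub>K\<^esub>} = x" using x c sm by simp
      then have "\<exists>a A. x = S.lincomb a A \<and> finite A \<and> A \<subseteq> {\<one>\<^bsub>K\<^esub>} \<and> a \<in> A \<rightarrow> carrier K"
        using x by (intro exI[of _ "\<lambda>_. x"] exI[of _ "{\<one>\<^bsub>K\<^esub>}"]) simp
      then show ?thesis unfolding S.span_def by simp
    qed
    moreover have "S.span {\<one>\<^bsub>K\<^esub>} \<subseteq> carrier (self_module K)"
      by (rule S.span_is_subset2) (simp add: c)
    ultimately show "S.span {\<one>\<^bsub>K\<^esub>} = carrier (self_module K)" using c by blast
  qed (simp_all add: c)
qed

context vectorspace
begin

text \<open>Independent sets of U are independent in V and hence of bounded size; a maximal one
  generates U.\<close>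

lemma fin_dim_subspace:
  assumes fd: fin_dim and U: "VectorSpace.subspace K U V"
  shows "vectorspace.fin_dim K (vs U)"
proof -
  interpret U: vectorspace K "vs U" by (rule subspace_is_vs[OF U])
  have sm: "submodule K U V" using U by (simp add: subspace_def)
  have UV: "U \<subseteq> carrier V" using sm by (simp add: submodule.subset)
  let ?P = "\<lambda>S. S \<subseteq> carrier (vs U) \<and> U.lin_indpt S"
  have "\<exists>A. finite A \<and> maximal A ?P"
  proof (rule maximal_exists[of ?P dim "{}"])
    show "finite A \<and> card A \<le> dim" if "?P A" for A
      using li_le_dim[OF fd, of A] span_li_not_depend(2)[OF _ sm, of A] that UV by auto
    show "?P {}" by (auto simp: U.lin_dep_def)
  qed
  then obtain A where A: "finite A" "maximal A ?P" by blast
  then have "U.gen_set A" using U.max_li_is_gen by blast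
  then show ?thesis unfolding U.fin_dim_def using A by (auto simp: maximal_def)
qed

lemma subspace_of_subspace:
  assumes U: "VectorSpace.subspace K U V" and T: "VectorSpace.subspace K T (vs U)"
  shows "VectorSpace.subspace K T V"
proof -
  have "submodule K U V" "submodule K T (vs U)" using U T by (simp_all add: subspace_def)
  then have "submodule K T V" unfolding submodule_def using module_axioms by auto
  then show ?thesis using vectorspace_axioms by (simp add: subspace_def)
qed

lemma subspace_carrier: "VectorSpace.subspace K (carrier V) V"
  using vectorspace_axioms module_axioms by (auto simp: subspace_def submodule_def)

text \<open>A functional that is nonzero at u has the whole field as its image, so rank-nullity
  gives a kernel of codimension 1.\<close>

lemma hyperplane_dim:
  assumes fd: fin_dim and l: "l \<in> carrier V \<rightarrow> carrier K"
    and add: "\<And>v w. v \<in> carrier V \<Longrightarrow> w \<in> carrier V \<Longrightarrow> l (v \<oplus>\<^bsub>V\<^esub> w) = l v \<oplus>\<^bsub>K\<^esub> l w"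
    and smult: "\<And>a v. a \<in> carrier K \<Longrightarrow> v \<in> carrier V \<Longrightarrow> l (a \<odot>\<^bsub>V\<^esub> v) = a \<otimes>\<^bsub>K\<^esub> l v"
    and u: "u \<in> carrier V" "l u \<noteq> \<zero>\<^bsub>K\<^esub>"
  shows "VectorSpace.subspace K {v \<in> carrier V. l v = \<zero>\<^bsub>K\<^esub>} V"
    "dim = Suc (vectorspace.dim K (vs {v \<in> carrier V. l v = \<zero>\<^bsub>K\<^esub>}))"
proof -
  let ?S = "self_module K"
  interpret S: vectorspace K ?S by (rule vectorspace_self_module) (rule field_axioms)
  have S: "carrier ?S = carrier K" "\<zero>\<^bsub>?S\<^esub> = \<zero>\<^bsub>K\<^esub>"
    "\<And>a b. a \<oplus>\<^bsub>?S\<^esub> b = a \<oplus>\<^bsub>K\<^esub> b" "\<And>a b. a \<odot>\<^bsub>?S\<^esub> b = a \<otimes>\<^bsub>K\<^esub> b"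
    by (simp_all add: self_module_def)
  interpret T: linear_map K V ?S l
    by unfold_locales (use l add smult in \<open>auto simp: module_hom_def S\<close>)
  have ker: "T.ker = {v \<in> carrier V. l v = \<zero>\<^bsub>K\<^esub>}" by (simp add: T.ker_def S)
  have "T.im = carrier ?S"
  proof
    show "T.im \<subseteq> carrier ?S" using l by (auto simp: T.im_def S)
    show "carrier ?S \<subseteq> T.im"
    proof
      fix a assume "a \<in> carrier ?S"
      then have a: "a \<in> carrier K" by (simp add: S)
      have lu: "l u \<in> carrier K" using l u by blast
      then have i: "inv\<^bsub>K\<^esub> (l u) \<in> carrier K" "inv\<^bsub>K\<^esub> (l u) \<otimes>\<^bsub>K\<^esub> l u = \<one>\<^bsub>K\<^esub>"
        using u(2) field_Units by auto
      have "l ((a \<otimes>\<^bsub>K\<^esub> inv\<^bsub>K\<^esub> (l u)) \<odot>\<^bsub>V\<^esub> u) = (a \<otimes>\<^bsub>K\<^esub> inv\<^bsub>K\<^esub> (l u)) \<otimes>\<^bsub>K\<^esub> l u"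
        using a i(1) u(1) by (intro smult) auto
      also have "\<dots> = a" using a i lu by (simp add: R.m_assoc)
      finally have "l ((a \<otimes>\<^bsub>K\<^esub> inv\<^bsub>K\<^esub> (l u)) \<odot>\<^bsub>V\<^esub> u) = a" .
      moreover have "(a \<otimes>\<^bsub>K\<^esub> inv\<^bsub>K\<^esub> (l u)) \<odot>\<^bsub>V\<^esub> u \<in> carrier V" using a i u(1) by simp
      ultimately show "a \<in> T.im" unfolding T.im_def by (metis imageI)
    qed
  qed
  then have "vectorspace.dim K (S.vs T.im) = 1"
    using dim_self_module[OF field_axioms] by simp
  then show "dim = Suc (vectorspace.dim K (vs {v \<in> carrier V. l v = \<zero>\<^bsub>K\<^esub>}))"
    using T.rank_nullity[OF fd] ker by simp
  show "VectorSpace.subspace K {v \<in> carrier V. l v = \<zero>\<^bsub>K\<^esub>} V"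
    using T.kerT_is_subspace ker by simp
qed

text \<open>The coefficient functions are extensional because arbitrary values outside \<beta> would
  destroy uniqueness.\<close>

definition coords :: "'c set \<Rightarrow> 'c \<Rightarrow> 'c \<Rightarrow> 'a" where
  "coords \<beta> w = (THE a. a \<in> \<beta> \<rightarrow>\<^sub>E carrier K \<and> lincomb a \<beta> = w)"

context
  fixes \<beta>
  assumes fin: "finite \<beta>" and bas: "basis \<beta>"
begin

lemma basis_carrier: "\<beta> \<subseteq> carrier V"
  using bas by (simp add: basis_def)

lemma coords_ex1: "w \<in> carrier V \<Longrightarrow> \<exists>!a. a \<in> \<beta> \<rightarrow>\<^sub>E carrier K \<and> lincomb a \<beta> = w"
  using basis_criterion[OF fin basis_carrier] bas by blast

lemma coords_PiE: "w \<in> carrier V \<Longrightarrow> coords \<beta> w \<in> \<beta> \<rightarrow>\<^sub>E carrier K"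
  and lincomb_coords: "w \<in> carrier V \<Longrightarrow> lincomb (coords \<beta> w) \<beta> = w"
  using theI'[OF coords_ex1, of w] unfolding coords_def by blast+

lemma coords_closed: "w \<in> carrier V \<Longrightarrow> x \<in> \<beta> \<Longrightarrow> coords \<beta> w x \<in> carrier K"
  using coords_PiE by (meson PiE_mem)

lemma coords_lincomb:
  assumes a: "a \<in> \<beta> \<rightarrow> carrier K" and x: "x \<in> \<beta>"
  shows "coords \<beta> (lincomb a \<beta>) x = a x"
proof -
  have w: "lincomb a \<beta> \<in> carrier V" using a basis_carrier by (intro lincomb_closed)
  have r: "restrict a \<beta> \<in> \<beta> \<rightarrow>\<^sub>E carrier K" using a by auto
  have "lincomb (restrict a \<beta>) \<beta> = lincomb a \<beta>"
    by (rule lincomb_cong) (use a basis_carrier in auto)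
  then have "coords \<beta> (lincomb a \<beta>) = restrict a \<beta>"
    using coords_ex1[OF w] coords_PiE[OF w] lincomb_coords[OF w] r by blast
  then show ?thesis using x by simp
qed

lemma coords_add:
  assumes v: "v \<in> carrier V" and w: "w \<in> carrier V" and x: "x \<in> \<beta>"
  shows "coords \<beta> (v \<oplus>\<^bsub>V\<^esub> w) x = coords \<beta> v x \<oplus>\<^bsub>K\<^esub> coords \<beta> w x"
proof -
  have c: "coords \<beta> v \<in> \<beta> \<rightarrow> carrier K" "coords \<beta> w \<in> \<beta> \<rightarrow> carrier K"
    using coords_closed v w by auto
  have "v \<oplus>\<^bsub>V\<^esub> w = lincomb (\<lambda>x. coords \<beta> v x \<oplus>\<^bsub>K\<^esub> coords \<beta> w x) \<beta>"
    using lincomb_sum[OF fin basis_carrier c] lincomb_coords v w by simp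
  then show ?thesis using coords_lincomb[OF _ x, of "\<lambda>x. coords \<beta> v x \<oplus>\<^bsub>K\<^esub> coords \<beta> w x"] c by auto
qed

lemma coords_smult:
  assumes a: "a \<in> carrier K" and w: "w \<in> carrier V" and x: "x \<in> \<beta>"
  shows "coords \<beta> (a \<odot>\<^bsub>V\<^esub> w) x = a \<otimes>\<^bsub>K\<^esub> coords \<beta> w x"
proof -
  have c: "coords \<beta> w \<in> \<beta> \<rightarrow> carrier K" using coords_closed w by auto
  have "a \<odot>\<^bsub>V\<^esub> w = lincomb (\<lambda>x. a \<otimes>\<^bsub>K\<^esub> coords \<beta> w x) \<beta>"
    using lincomb_smult[OF basis_carrier c a] lincomb_coords w by simp
  then show ?thesis using coords_lincomb[OF _ x, of "\<lambda>x. a \<otimes>\<^bsub>K\<^esub> coords \<beta> w x"] c a by auto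
qed

lemma coords_basis:
  assumes x: "x \<in> \<beta>" and y: "y \<in> \<beta>"
  shows "coords \<beta> x y = (if x = y then \<one>\<^bsub>K\<^esub> else \<zero>\<^bsub>K\<^esub>)"
proof -
  let ?a = "\<lambda>y. if x = y then \<one>\<^bsub>K\<^esub> else \<zero>\<^bsub>K\<^esub>"
  have xV: "x \<in> carrier V" using x basis_carrier by blast
  have "lincomb ?a \<beta> = (?a x \<odot>\<^bsub>V\<^esub> x) \<oplus>\<^bsub>V\<^esub> lincomb ?a (\<beta> - {x})"
    by (rule lincomb_del2[OF fin basis_carrier _ x]) auto
  also have "lincomb ?a (\<beta> - {x}) = lincomb (\<lambda>_. \<zero>\<^bsub>K\<^esub>) (\<beta> - {x})"
    by (rule lincomb_cong) (use basis_carrier in auto)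
  also have "\<dots> = \<zero>\<^bsub>V\<^esub>"
    unfolding lincomb_def using basis_carrier by (intro M.finsum_all0) auto
  finally have "lincomb ?a \<beta> = x" using xV by simp
  then show ?thesis using coords_lincomb[of ?a y] y by auto
qed

end

text \<open>Only additivity is assumed, since the lemma serves for the coordinates of \<Phi> and
  \<nabla>, which are semilinear and subject to a Leibniz rule instead of linear over K.\<close>

lemma additive_lincomb:
  assumes G: "abelian_group G" and A: "finite A" "A \<subseteq> carrier V" and a: "a \<in> A \<rightarrow> carrier K"
    and T: "T \<in> carrier V \<rightarrow> carrier G"
      "\<And>v w. v \<in> carrier V \<Longrightarrow> w \<in> carrier V \<Longrightarrow> T (v \<oplus>\<^bsub>V\<^esub> w) = T v \<oplus>\<^bsub>G\<^esub> T w"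
  shows "T (lincomb a A) = (\<Oplus>\<^bsub>G\<^esub> x\<in>A. T (a x \<odot>\<^bsub>V\<^esub> x))"
proof -
  interpret G: abelian_group G by fact
  have "T \<zero>\<^bsub>V\<^esub> \<oplus>\<^bsub>G\<^esub> T \<zero>\<^bsub>V\<^esub> = T \<zero>\<^bsub>V\<^esub>" using T(2)[of "\<zero>\<^bsub>V\<^esub>" "\<zero>\<^bsub>V\<^esub>"] by simp
  moreover have "T \<zero>\<^bsub>V\<^esub> \<in> carrier G" using T(1) by (metis M.zero_closed funcset_mem)
  ultimately have T0: "T \<zero>\<^bsub>V\<^esub> = \<zero>\<^bsub>G\<^esub>" by (metis G.add.r_cancel_one)
  show ?thesis
    unfolding lincomb_def using A a
  proof (induction A rule: finite_induct)
    case empty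
    then show ?case by (simp add: T0)
  next
    case (insert x A)
    have c: "a y \<odot>\<^bsub>V\<^esub> y \<in> carrier V" if "y \<in> insert x A" for y using insert that by auto
    have "(\<Oplus>\<^bsub>V\<^esub> y\<in>insert x A. a y \<odot>\<^bsub>V\<^esub> y) = a x \<odot>\<^bsub>V\<^esub> x \<oplus>\<^bsub>V\<^esub> (\<Oplus>\<^bsub>V\<^esub> y\<in>A. a y \<odot>\<^bsub>V\<^esub> y)"
      using insert.hyps c by (intro M.finsum_insert) auto
    moreover have "(\<Oplus>\<^bsub>V\<^esub> y\<in>A. a y \<odot>\<^bsub>V\<^esub> y) \<in> carrier V" using c by (intro M.finsum_closed) auto
    moreover have "(\<Oplus>\<^bsub>G\<^esub> y\<in>insert x A. T (a y \<odot>\<^bsub>V\<^esub> y)) =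
        T (a x \<odot>\<^bsub>V\<^esub> x) \<oplus>\<^bsub>G\<^esub> (\<Oplus>\<^bsub>G\<^esub> y\<in>A. T (a y \<odot>\<^bsub>V\<^esub> y))"
      using insert.hyps c T(1) by (intro G.finsum_insert) auto
    ultimately show ?case using insert c T(2) by auto
  qed
qed

end

section \<open>Integrable modules over the elliptic field\<close>

lemma eventually_cosparse_UNIV: "eventually P (cosparse UNIV) \<longleftrightarrow> (\<forall>z. eventually P (at z))"
  for P :: "complex \<Rightarrow> bool"
  by (simp add: eventually_cosparse_open_eq)

lemma eventually_cosparse_scaled:
  fixes q :: complex
  assumes "q \<noteq> 0" "eventually P (cosparse UNIV)"
  shows "eventually (\<lambda>z. P (q * z)) (cosparse UNIV)"
  using assms eventually_at_scaled unfolding eventually_cosparse_UNIV by blast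

lemma elliptic_remove_sings_eqI:
  assumes "h \<in> carrier (elliptic_field \<Lambda>0)" "eventually (\<lambda>z. f z = h z) (cosparse UNIV)"
  shows "remove_sings f = h"
  using remove_sings_cong_cosparse[OF assms(2)] remove_sings_nicely[OF elliptic_carrierD(1)[OF assms(1)]]
  by simp

text \<open>The field operations are the pointwise ones off a sparse set. Identities in K can
  therefore be proved pointwise there and lifted by this lemma.\<close>

lemma elliptic_eqI:
  assumes "f \<in> carrier (elliptic_field \<Lambda>0)" "g \<in> carrier (elliptic_field \<Lambda>0)"
    "eventually (\<lambda>z. f z = g z) (cosparse UNIV)"
  shows "f = g"
  using elliptic_remove_sings_eqI[OF assms(2,3)] remove_sings_nicely[OF elliptic_carrierD(1)[OF assms(1)]]
  by simp

lemma eventually_elliptic_mult: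
  assumes "f \<in> carrier (elliptic_field \<Lambda>0)" "g \<in> carrier (elliptic_field \<Lambda>0)"
  shows "eventually (\<lambda>z. (f \<otimes>\<^bsub>elliptic_field \<Lambda>0\<^esub> g) z = f z * g z) (cosparse UNIV)"
  using eventually_remove_sings_eq[of "\<lambda>z. f z * g z" UNIV] elliptic_carrierD(2)[OF assms(1)]
    elliptic_carrierD(2)[OF assms(2)]
  by (simp add: elliptic_field_def meromorphic_intros)

lemma eventually_elliptic_add:
  assumes "f \<in> carrier (elliptic_field \<Lambda>0)" "g \<in> carrier (elliptic_field \<Lambda>0)"
  shows "eventually (\<lambda>z. (f \<oplus>\<^bsub>elliptic_field \<Lambda>0\<^esub> g) z = f z + g z) (cosparse UNIV)"
  using eventually_remove_sings_eq[of "\<lambda>z. f z + g z" UNIV] elliptic_carrierD(2)[OF assms(1)]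
    elliptic_carrierD(2)[OF assms(2)]
  by (simp add: elliptic_field_def meromorphic_intros)

lemma eventually_elliptic_finsum:
  assumes L: "complex_lattice \<Lambda>0" and fin: "finite I"
    and f: "\<And>i. i \<in> I \<Longrightarrow> f i \<in> carrier (elliptic_field \<Lambda>0)"
  shows "eventually (\<lambda>z. (\<Oplus>\<^bsub>elliptic_field \<Lambda>0\<^esub> i\<in>I. f i) z = (\<Sum>i\<in>I. f i z)) (cosparse UNIV)"
proof -
  interpret field "elliptic_field \<Lambda>0" by (rule elliptic_field_field[OF L])
  show ?thesis using fin f
  proof (induction I rule: finite_induct)
    case empty
    have "\<zero>\<^bsub>elliptic_field \<Lambda>0\<^esub> = (\<lambda>_. 0)" by (simp add: elliptic_field_def)
    then show ?case by simp
  next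
    case (insert i I)
    have c: "f i \<in> carrier (elliptic_field \<Lambda>0)" "(\<Oplus>\<^bsub>elliptic_field \<Lambda>0\<^esub> i\<in>I. f i) \<in> carrier (elliptic_field \<Lambda>0)"
      using insert.prems by (auto intro!: finsum_closed)
    have "(\<Oplus>\<^bsub>elliptic_field \<Lambda>0\<^esub> i\<in>insert i I. f i) =
        f i \<oplus>\<^bsub>elliptic_field \<Lambda>0\<^esub> (\<Oplus>\<^bsub>elliptic_field \<Lambda>0\<^esub> i\<in>I. f i)"
      using insert by (intro finsum_insert) auto
    moreover have "eventually (\<lambda>z. (\<Oplus>\<^bsub>elliptic_field \<Lambda>0\<^esub> i\<in>I. f i) z = (\<Sum>i\<in>I. f i z)) (cosparse UNIV)"
      using insert by blast
    then have "eventually (\<lambda>z. (f i \<oplus>\<^bsub>elliptic_field \<Lambda>0\<^esub> (\<Oplus>\<^bsub>elliptic_field \<Lambda>0\<^esub> i\<in>I. f i)) z =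
        (\<Sum>i\<in>insert i I. f i z)) (cosparse UNIV)"
      using eventually_elliptic_add[OF c] by eventually_elim (use insert.hyps in simp)
    ultimately show ?case by simp
  qed
qed

lemma eventually_mero_deriv:
  assumes "f \<in> carrier (elliptic_field \<Lambda>0)"
  shows "eventually (\<lambda>z. mero_deriv f z = deriv f z) (cosparse UNIV)"
  unfolding mero_deriv_def
  by (rule eventually_remove_sings_eq) (intro meromorphic_on_deriv elliptic_carrierD(2)[OF assms])

text \<open>The period lattice of each function contains some multiple N \<Lambda>0 by
  commensurability, and the factors of finitely many functions multiply. The quantifier over k lets
  the induction replace a factor M by M N.\<close>

lemma elliptic_common_period:
  assumes L: "complex_lattice \<Lambda>0" and "finite S" "S \<subseteq> carrier (elliptic_field \<Lambda>0)"
  shows "\<exists>M>0. \<forall>f\<in>S. \<forall>k. \<forall>x\<in>\<Lambda>0. \<forall>z. f (z + of_nat (M * k) * x) = f z"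
  using assms(2,3)
proof (induction S rule: finite_induct)
  case empty
  then show ?case by blast
next
  case (insert f S)
  then obtain M where M: "M > 0" "\<And>g k x z. g \<in> S \<Longrightarrow> x \<in> \<Lambda>0 \<Longrightarrow> g (z + of_nat (M * k) * x) = g z"
    by auto
  obtain \<Lambda> where \<Lambda>: "\<Lambda> \<in> commensurability_class \<Lambda>0" "f \<in> periodic_meromorphic \<Lambda>"
    using insert.prems unfolding elliptic_field_def by auto
  then have "complex_lattice \<Lambda>" "finite_index (\<Lambda> \<inter> \<Lambda>0) \<Lambda>0"
    unfolding commensurability_class_def commensurable_def by auto
  then obtain N where N: "N > 0" "\<And>x k. x \<in> \<Lambda>0 \<Longrightarrow> of_nat (N * k) * x \<in> \<Lambda>"
    using lattice_multiple_subset[OF _ L] by metis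
  have fN: "f (z + of_nat (N * k) * x) = f z" if "x \<in> \<Lambda>0" for k x z
    using \<Lambda>(2) N(2)[OF that] unfolding periodic_meromorphic_def by blast
  show ?case
  proof (intro exI[of _ "M * N"] conjI ballI allI)
    show "M * N > 0" using M N by simp
    fix g k x z assume g: "g \<in> insert f S" and x: "x \<in> \<Lambda>0"
    show "g (z + of_nat (M * N * k) * x) = g z"
    proof (cases "g = f")
      case True
      then show ?thesis using fN[OF x, of z "M * k"] by (simp add: mult_ac)
    next
      case False
      then show ?thesis using M(2)[of g x z "N * k"] g x by (simp add: mult.assoc)
    qed
  qed
qed

lemma elliptic_carrierI:
  assumes L: "complex_lattice \<Lambda>0" and \<Lambda>0: "\<Lambda>0 = {of_int m * a + of_int n * b | m n :: int. True}"
    and f: "f nicely_meromorphic_on UNIV" and M: "M > 0"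
    and per: "\<And>z. f (z + of_nat M * a) = f z" "\<And>z. f (z + of_nat M * b) = f z"
  shows "f \<in> carrier (elliptic_field \<Lambda>0)"
proof -
  have perm: "f (z + of_int m * w) = f z" if w: "\<And>z. f (z + w) = f z" for z m w
  proof -
    have nat: "f (z + of_nat n * w) = f z" for n z
      by (induction n arbitrary: z) (use w in \<open>auto simp: algebra_simps simp flip: add.assoc\<close>)
    show ?thesis
    proof (cases "m \<ge> 0")
      case True
      then show ?thesis using nat[of z "nat m"] by simp
    next
      case False
      then show ?thesis using nat[of "z + of_int m * w" "nat (- m)"] by simp
    qed
  qed
  have "f (z + w) = f z" if "w \<in> (*) (of_nat M) ` \<Lambda>0" for z w
  proof -
    obtain m n :: int where "w = of_nat M * (of_int m * a + of_int n * b)"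
      using \<open>w \<in> _\<close> unfolding \<Lambda>0 by blast
    then have w: "z + w = (z + of_int m * (of_nat M * a)) + of_int n * (of_nat M * b)"
      by (simp add: algebra_simps)
    show ?thesis unfolding w perm[OF per(2)] perm[OF per(1)] ..
  qed
  then have "f \<in> periodic_meromorphic ((*) (of_nat M) ` \<Lambda>0)"
    using f unfolding periodic_meromorphic_def by blast
  then show ?thesis
    using lattice_multiple_in_class[OF L M] unfolding elliptic_field_def by auto
qed

section \<open>Coordinates of \<Phi> and \<nabla>, and the dual system\<close>

locale integrable_module =
  fixes \<Lambda>0 :: "complex set" and q :: nat
    and W :: "(complex \<Rightarrow> complex, 'w) module" and \<Phi> D :: "'w \<Rightarrow> 'w"
  assumes lattice: "complex_lattice \<Lambda>0" and q_ge_2: "q \<ge> 2"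
    and phi: "phi_module \<Lambda>0 q W \<Phi>"
    and conn: "connection \<Lambda>0 W D" and compat: "compatible q W \<Phi> D"
begin

abbreviation K where "K \<equiv> elliptic_field \<Lambda>0"

sublocale vectorspace K W
  using phi by (simp add: phi_module_def)

lemma fin_dim: "fin_dim"
  using phi by (simp add: phi_module_def)

lemma Phi_closed: "w \<in> carrier W \<Longrightarrow> \<Phi> w \<in> carrier W"
  using phi unfolding phi_module_def bij_betw_def by blast

lemma Phi_surj: "w \<in> carrier W \<Longrightarrow> \<exists>v\<in>carrier W. \<Phi> v = w"
proof -
  assume "w \<in> carrier W"
  then have "w \<in> \<Phi> ` carrier W" using phi unfolding phi_module_def bij_betw_def by simp
  then show ?thesis by blast
qed

lemma Phi_add: "v \<in> carrier W \<Longrightarrow> w \<in> carrier W \<Longrightarrow> \<Phi> (v \<oplus>\<^bsub>W\<^esub> w) = \<Phi> v \<oplus>\<^bsub>W\<^esub> \<Phi> w"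
  and Phi_smult: "a \<in> carrier K \<Longrightarrow> w \<in> carrier W \<Longrightarrow> \<Phi> (a \<odot>\<^bsub>W\<^esub> w) = dilation q a \<odot>\<^bsub>W\<^esub> \<Phi> w"
  using phi unfolding phi_module_def by blast+

lemma D_closed: "w \<in> carrier W \<Longrightarrow> D w \<in> carrier W"
  and D_add: "v \<in> carrier W \<Longrightarrow> w \<in> carrier W \<Longrightarrow> D (v \<oplus>\<^bsub>W\<^esub> w) = D v \<oplus>\<^bsub>W\<^esub> D w"
  and D_smult: "a \<in> carrier K \<Longrightarrow> w \<in> carrier W \<Longrightarrow>
    D (a \<odot>\<^bsub>W\<^esub> w) = mero_deriv a \<odot>\<^bsub>W\<^esub> w \<oplus>\<^bsub>W\<^esub> a \<odot>\<^bsub>W\<^esub> D w"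
  using conn unfolding connection_def by blast+

lemma D_Phi: "w \<in> carrier W \<Longrightarrow> D (\<Phi> w) = (\<lambda>_. of_nat q) \<odot>\<^bsub>W\<^esub> \<Phi> (D w)"
  using compat unfolding compatible_def by blast

lemma dilation_K: "a \<in> carrier K \<Longrightarrow> dilation q a \<in> carrier K"
  using dilation_closed[OF lattice] q_ge_2 by simp

lemma qc_nz: "(of_nat q :: complex) \<noteq> 0" using q_ge_2 by simp

context
  fixes \<beta>
  assumes fin: "finite \<beta>" and bas: "basis \<beta>"
begin

lemma in_carrier: "x \<in> \<beta> \<Longrightarrow> x \<in> carrier W"
  using basis_carrier[OF fin bas] by blast

lemma coords_PiK: "w \<in> carrier W \<Longrightarrow> coords \<beta> w \<in> \<beta> \<rightarrow> carrier K"
  using coords_closed[OF fin bas] by blast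

lemma coords_Phi:
  assumes w: "w \<in> carrier W" and x: "x \<in> \<beta>"
  shows "eventually (\<lambda>z. coords \<beta> (\<Phi> w) x z = (\<Sum>k\<in>\<beta>. coords \<beta> w k (of_nat q * z) * coords \<beta> (\<Phi> k) x z)) (cosparse UNIV)"
proof -
  let ?c = "coords \<beta>"
  note cl = coords_closed[OF fin bas]
  have "?c (\<Phi> (lincomb (?c w) \<beta>)) x = (\<Oplus>\<^bsub>K\<^esub> k\<in>\<beta>. ?c (\<Phi> (?c w k \<odot>\<^bsub>W\<^esub> k)) x)"
    by (rule additive_lincomb[OF R.abelian_group_axioms fin basis_carrier[OF fin bas] coords_PiK[OF w]])
       (use x in \<open>auto simp: Phi_closed cl Phi_add coords_add[OF fin bas]\<close>)
  then have eq: "?c (\<Phi> w) x = (\<Oplus>\<^bsub>K\<^esub> k\<in>\<beta>. ?c (\<Phi> (?c w k \<odot>\<^bsub>W\<^esub> k)) x)"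
    using lincomb_coords[OF fin bas w] by simp
  have in_K: "?c (\<Phi> (?c w k \<odot>\<^bsub>W\<^esub> k)) x \<in> carrier K" if "k \<in> \<beta>" for k
    by (rule cl[OF Phi_closed[OF smult_closed[OF cl[OF w that] in_carrier[OF that]]] x])
  have "eventually (\<lambda>z. ?c (\<Phi> (?c w k \<odot>\<^bsub>W\<^esub> k)) x z = ?c w k (of_nat q * z) * ?c (\<Phi> k) x z) (cosparse UNIV)"
    if k: "k \<in> \<beta>" for k
  proof -
    have kW: "k \<in> carrier W" by (rule in_carrier[OF k])
    have "?c (\<Phi> (?c w k \<odot>\<^bsub>W\<^esub> k)) x = dilation q (?c w k) \<otimes>\<^bsub>K\<^esub> ?c (\<Phi> k) x"
      using coords_smult[OF fin bas dilation_K[OF cl[OF w k]] Phi_closed[OF kW] x] Phi_smult[OF cl[OF w k] kW] by simp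
    then show ?thesis
      using eventually_elliptic_mult[OF dilation_K[OF cl[OF w k]] cl[OF Phi_closed[OF kW] x]]
      by (simp add: dilation_def)
  qed
  then have "eventually (\<lambda>z. \<forall>k\<in>\<beta>. ?c (\<Phi> (?c w k \<odot>\<^bsub>W\<^esub> k)) x z = ?c w k (of_nat q * z) * ?c (\<Phi> k) x z) (cosparse UNIV)"
    using fin by (simp add: eventually_ball_finite)
  moreover have "eventually (\<lambda>z. (\<Oplus>\<^bsub>K\<^esub> k\<in>\<beta>. ?c (\<Phi> (?c w k \<odot>\<^bsub>W\<^esub> k)) x) z =
      (\<Sum>k\<in>\<beta>. ?c (\<Phi> (?c w k \<odot>\<^bsub>W\<^esub> k)) x z)) (cosparse UNIV)"
    by (rule eventually_elliptic_finsum[OF lattice fin in_K])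
  ultimately show ?thesis unfolding eq
    by eventually_elim simp
qed

lemma coords_D:
  assumes w: "w \<in> carrier W" and x: "x \<in> \<beta>"
  shows "eventually (\<lambda>z. coords \<beta> (D w) x z =
    deriv (coords \<beta> w x) z + (\<Sum>k\<in>\<beta>. coords \<beta> w k z * coords \<beta> (D k) x z)) (cosparse UNIV)"
proof -
  let ?c = "coords \<beta>"
  note cl = coords_closed[OF fin bas]
  have "?c (D (lincomb (?c w) \<beta>)) x = (\<Oplus>\<^bsub>K\<^esub> k\<in>\<beta>. ?c (D (?c w k \<odot>\<^bsub>W\<^esub> k)) x)"
    by (rule additive_lincomb[OF R.abelian_group_axioms fin basis_carrier[OF fin bas] coords_PiK[OF w]])
       (use x in \<open>auto simp: D_closed cl D_add coords_add[OF fin bas]\<close>)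
  then have eq: "?c (D w) x = (\<Oplus>\<^bsub>K\<^esub> k\<in>\<beta>. ?c (D (?c w k \<odot>\<^bsub>W\<^esub> k)) x)"
    using lincomb_coords[OF fin bas w] by simp
  have in_K: "?c (D (?c w k \<odot>\<^bsub>W\<^esub> k)) x \<in> carrier K" if "k \<in> \<beta>" for k
    by (rule cl[OF D_closed[OF smult_closed[OF cl[OF w that] in_carrier[OF that]]] x])
  have "eventually (\<lambda>z. ?c (D (?c w k \<odot>\<^bsub>W\<^esub> k)) x z =
      (if k = x then deriv (?c w k) z else 0) + ?c w k z * ?c (D k) x z) (cosparse UNIV)"
    if k: "k \<in> \<beta>" for k
  proof -
    have kW: "k \<in> carrier W" by (rule in_carrier[OF k])
    have wk: "?c w k \<in> carrier K" by (rule cl[OF w k])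
    have d: "mero_deriv (?c w k) \<in> carrier K" by (rule mero_deriv_closed[OF wk])
    have p: "?c k x \<in> carrier K" "?c (D k) x \<in> carrier K" using cl kW D_closed x by blast+
    have cD: "?c (D (?c w k \<odot>\<^bsub>W\<^esub> k)) x = (mero_deriv (?c w k) \<otimes>\<^bsub>K\<^esub> ?c k x) \<oplus>\<^bsub>K\<^esub> (?c w k \<otimes>\<^bsub>K\<^esub> ?c (D k) x)"
      using D_smult[OF wk kW] coords_add[OF fin bas _ _ x] coords_smult[OF fin bas d kW x]
        coords_smult[OF fin bas wk D_closed[OF kW] x] d kW wk D_closed by simp
    have kx: "?c k x z = (if k = x then 1 else 0)" for z
      using coords_basis[OF fin bas k x] by (simp add: elliptic_field_def)
    show ?thesis
      unfolding cD
      using eventually_elliptic_add[OF R.m_closed[OF d p(1)] R.m_closed[OF wk p(2)]]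
        eventually_elliptic_mult[OF d p(1)] eventually_elliptic_mult[OF wk p(2)] eventually_mero_deriv[OF wk]
      by eventually_elim (simp add: kx)
  qed
  then have "eventually (\<lambda>z. \<forall>k\<in>\<beta>. ?c (D (?c w k \<odot>\<^bsub>W\<^esub> k)) x z =
      (if k = x then deriv (?c w k) z else 0) + ?c w k z * ?c (D k) x z) (cosparse UNIV)"
    using fin by (simp add: eventually_ball_finite)
  moreover have "eventually (\<lambda>z. (\<Oplus>\<^bsub>K\<^esub> k\<in>\<beta>. ?c (D (?c w k \<odot>\<^bsub>W\<^esub> k)) x) z =
      (\<Sum>k\<in>\<beta>. ?c (D (?c w k \<odot>\<^bsub>W\<^esub> k)) x z)) (cosparse UNIV)"
    by (rule eventually_elliptic_finsum[OF lattice fin in_K])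
  ultimately show ?thesis unfolding eq
    by eventually_elim (use fin x in \<open>simp add: sum.distrib\<close>)
qed

text \<open>The functional is written with the pointwise sum, which can be differentiated termwise,
  instead of the sum of the field; \<open>elliptic_remove_sings_eqI\<close> identifies the
  two.\<close>

lemma coords_functional:
  fixes v :: "'w \<Rightarrow> complex \<Rightarrow> complex"
  assumes v_K: "\<forall>x\<in>\<beta>. v x \<in> carrier K"
    and l_def: "l = (\<lambda>w. remove_sings (\<lambda>z. \<Sum>x\<in>\<beta>. coords \<beta> w x z * v x z))"
  shows "w \<in> carrier W \<Longrightarrow> l w \<in> carrier K"
    and "w \<in> carrier W \<Longrightarrow> eventually (\<lambda>z. l w z = (\<Sum>x\<in>\<beta>. coords \<beta> w x z * v x z)) (cosparse UNIV)"
    and "w \<in> carrier W \<Longrightarrow> u \<in> carrier W \<Longrightarrow> l (w \<oplus>\<^bsub>W\<^esub> u) = l w \<oplus>\<^bsub>K\<^esub> l u"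
    and "a \<in> carrier K \<Longrightarrow> w \<in> carrier W \<Longrightarrow> l (a \<odot>\<^bsub>W\<^esub> w) = a \<otimes>\<^bsub>K\<^esub> l w"
    and "x \<in> \<beta> \<Longrightarrow> l x = v x"
proof -
  let ?c = "coords \<beta>"
  note cl = coords_closed[OF fin bas] and v = v_K[rule_format]
  show ev: "eventually (\<lambda>z. l w z = (\<Sum>x\<in>\<beta>. ?c w x z * v x z)) (cosparse UNIV)" if "w \<in> carrier W" for w
    unfolding l_def
    by (intro eventually_remove_sings_eq meromorphic_intros elliptic_carrierD(2)[OF cl[OF that]] elliptic_carrierD(2)[OF v])
  show in_K: "l w \<in> carrier K" if w: "w \<in> carrier W" for w
  proof -
    let ?h = "\<Oplus>\<^bsub>K\<^esub> x\<in>\<beta>. ?c w x \<otimes>\<^bsub>K\<^esub> v x"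
    have h: "?h \<in> carrier K" using cl[OF w] v by (intro R.finsum_closed) auto
    have "eventually (\<lambda>z. \<forall>x\<in>\<beta>. (?c w x \<otimes>\<^bsub>K\<^esub> v x) z = ?c w x z * v x z) (cosparse UNIV)"
      using fin eventually_elliptic_mult[OF cl[OF w] v] by (intro eventually_ball_finite) auto
    moreover have "eventually (\<lambda>z. ?h z = (\<Sum>x\<in>\<beta>. (?c w x \<otimes>\<^bsub>K\<^esub> v x) z)) (cosparse UNIV)"
      using cl[OF w] v by (intro eventually_elliptic_finsum[OF lattice fin]) auto
    ultimately have "eventually (\<lambda>z. (\<Sum>x\<in>\<beta>. ?c w x z * v x z) = ?h z) (cosparse UNIV)"
      by eventually_elim simp
    then show ?thesis unfolding l_def using elliptic_remove_sings_eqI[OF h] h by simp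
  qed
  show "l (w \<oplus>\<^bsub>W\<^esub> u) = l w \<oplus>\<^bsub>K\<^esub> l u" if w: "w \<in> carrier W" and u: "u \<in> carrier W" for w u
  proof (rule elliptic_eqI)
    have wu: "w \<oplus>\<^bsub>W\<^esub> u \<in> carrier W" using w u by simp
    show "l (w \<oplus>\<^bsub>W\<^esub> u) \<in> carrier K" "l w \<oplus>\<^bsub>K\<^esub> l u \<in> carrier K" using in_K w u wu by auto
    have "eventually (\<lambda>z. \<forall>x\<in>\<beta>. (?c (w \<oplus>\<^bsub>W\<^esub> u)) x z = ?c w x z + ?c u x z) (cosparse UNIV)"
      using fin eventually_elliptic_add[OF cl[OF w] cl[OF u]] coords_add[OF fin bas w u]
      by (intro eventually_ball_finite) auto
    then show "eventually (\<lambda>z. l (w \<oplus>\<^bsub>W\<^esub> u) z = (l w \<oplus>\<^bsub>K\<^esub> l u) z) (cosparse UNIV)"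
      using ev[OF wu] ev[OF w] ev[OF u] eventually_elliptic_add[OF in_K[OF w] in_K[OF u]]
      by eventually_elim (simp add: distrib_right sum.distrib)
  qed
  show "l (a \<odot>\<^bsub>W\<^esub> w) = a \<otimes>\<^bsub>K\<^esub> l w" if a: "a \<in> carrier K" and w: "w \<in> carrier W" for a w
  proof (rule elliptic_eqI)
    have aw: "a \<odot>\<^bsub>W\<^esub> w \<in> carrier W" using w a by simp
    show "l (a \<odot>\<^bsub>W\<^esub> w) \<in> carrier K" "a \<otimes>\<^bsub>K\<^esub> l w \<in> carrier K" using in_K w a aw by auto
    have "eventually (\<lambda>z. \<forall>x\<in>\<beta>. (?c (a \<odot>\<^bsub>W\<^esub> w)) x z = a z * ?c w x z) (cosparse UNIV)"
      using fin eventually_elliptic_mult[OF a cl[OF w]] coords_smult[OF fin bas a w]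
      by (intro eventually_ball_finite) auto
    then show "eventually (\<lambda>z. l (a \<odot>\<^bsub>W\<^esub> w) z = (a \<otimes>\<^bsub>K\<^esub> l w) z) (cosparse UNIV)"
      using ev[OF aw] ev[OF w] eventually_elliptic_mult[OF a in_K[OF w]]
      by eventually_elim (simp add: sum_distrib_left mult.assoc)
  qed
  show "l x = v x" if x: "x \<in> \<beta>" for x
  proof -
    have "?c x y z = (if x = y then 1 else 0)" if "y \<in> \<beta>" for y z
      using coords_basis[OF fin bas x that] by (simp add: elliptic_field_def)
    then have "(\<Sum>y\<in>\<beta>. ?c x y z * v y z) = (\<Sum>y\<in>\<beta>. if x = y then v y z else 0)" for z
      by (intro sum.cong refl) simp
    then have "(\<Sum>y\<in>\<beta>. ?c x y z * v y z) = v x z" for z using fin x by simp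
    then show ?thesis unfolding l_def using remove_sings_nicely[OF elliptic_carrierD(1)[OF v[OF x]]] by simp
  qed
qed

text \<open>The entry \<open>v x\<close> is the value of the sought functional l on the basis vector
  x. The two equations say (l x)' = l (\<nabla> x) and l (\<Phi> x) = c \<phi>(l x), so row x of the
  matrix B holds the coordinates of \<nabla> x, and row x of A those of \<Phi> x.\<close>

lemma eigenfunctional_exists:
  assumes ne: "\<beta> \<noteq> {}"
  shows "\<exists>v c. c \<noteq> 0 \<and> (\<forall>x\<in>\<beta>. v x \<in> carrier K) \<and> (\<exists>x\<in>\<beta>. v x \<noteq> (\<lambda>_. 0)) \<and>
    (\<forall>x\<in>\<beta>. eventually (\<lambda>z. deriv (v x) z = (\<Sum>k\<in>\<beta>. coords \<beta> (D x) k z * v k z)) (cosparse UNIV) \<and>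
      eventually (\<lambda>z. (\<Sum>k\<in>\<beta>. coords \<beta> (\<Phi> x) k z * v k z) = c * v x (of_nat q * z)) (cosparse UNIV))"
proof -
  let ?c = "coords \<beta>"
  note cl = coords_closed[OF fin bas]
  obtain a b where ab: "a \<noteq> b" "independent {a, b}" "\<Lambda>0 = {of_int m * a + of_int n * b | m n :: int. True}"
    using lattice unfolding complex_lattice_def by blast
  have abL: "a \<in> \<Lambda>0" "b \<in> \<Lambda>0"
    unfolding ab(3) by (rule CollectI, rule exI[of _ 1], rule exI[of _ 0], simp)
                   (rule CollectI, rule exI[of _ 0], rule exI[of _ 1], simp)
  \<comment> \<open>All entries of A and B. Being finitely many, they have M \<Lambda>0 as common
    periods for some M, and its generators become the periods of the system.\<close>
  let ?S = "(\<lambda>(x, y). ?c (\<Phi> x) y) ` (\<beta> \<times> \<beta>) \<union> (\<lambda>(x, y). ?c (D x) y) ` (\<beta> \<times> \<beta>)"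
  have "finite ?S" using fin by blast
  moreover have "?S \<subseteq> carrier K" using cl Phi_closed D_closed in_carrier by auto
  ultimately obtain M where M: "M > 0" "\<forall>f\<in>?S. \<forall>k. \<forall>x\<in>\<Lambda>0. \<forall>z. f (z + of_nat (M * k) * x) = f z"
    using elliptic_common_period[OF lattice] by meson
  have per: "f (z + of_nat M * a) = f z" "f (z + of_nat M * b) = f z" if "f \<in> ?S" for f z
    using M(2)[rule_format, OF that abL(1), of z 1] M(2)[rule_format, OF that abL(2), of z 1] by simp_all
  have SPhi: "?c (\<Phi> x) y \<in> ?S" and SD: "?c (D x) y \<in> ?S" if "x \<in> \<beta>" "y \<in> \<beta>" for x y
    using that by (auto intro!: rev_image_eqI[of "(x, y)"])
  have "linear ((*) (of_nat M) :: complex \<Rightarrow> complex)"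
    by (auto intro!: linearI simp: algebra_simps)
  moreover have "inj ((*) (of_nat M) :: complex \<Rightarrow> complex)"
    using M(1) by (auto simp: inj_on_def)
  ultimately have "independent ((*) (of_nat M) ` {a, b})"
    using ab(2) by (meson inj_on_subset linear_independent_injective_image subset_UNIV)
  then have indep: "independent {of_nat M * a, of_nat M * b}" by simp
  \<comment> \<open>Expanding \<Phi> (u x) = x in coordinates shows that \<phi> of the coordinates
    of \<open>u x\<close> form row x of a left inverse of A.\<close>
  have "\<forall>x\<in>\<beta>. \<exists>v\<in>carrier W. \<Phi> v = x" using Phi_surj in_carrier by blast
  then obtain u where u: "\<And>x. x \<in> \<beta> \<Longrightarrow> u x \<in> carrier W" "\<And>x. x \<in> \<beta> \<Longrightarrow> \<Phi> (u x) = x" by metis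
  interpret ode: dilation_ode \<beta> "\<lambda>x. ?c (D x)" "\<lambda>x. ?c (\<Phi> x)" "\<lambda>x k. dilation q (?c (u x) k)" q
    "of_nat M * a" "of_nat M * b"
  proof
    fix x y z assume x: "x \<in> \<beta>" and y: "y \<in> \<beta>"
    have xW: "x \<in> carrier W" using x in_carrier by blast
    show "?c (D x) y meromorphic_on UNIV" "?c (\<Phi> x) y meromorphic_on UNIV"
      using cl D_closed[OF xW] Phi_closed[OF xW] y elliptic_carrierD(2) by blast+
    show "?c (D x) y (z + of_nat M * a) = ?c (D x) y z" "?c (D x) y (z + of_nat M * b) = ?c (D x) y z"
      "?c (\<Phi> x) y (z + of_nat M * a) = ?c (\<Phi> x) y z" "?c (\<Phi> x) y (z + of_nat M * b) = ?c (\<Phi> x) y z"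
      using per SD[OF x y] SPhi[OF x y] by blast+
    show "eventually (\<lambda>z. deriv (?c (\<Phi> x) y) z + (\<Sum>k\<in>\<beta>. ?c (\<Phi> x) k z * ?c (D k) y z) =
        of_nat q * (\<Sum>k\<in>\<beta>. ?c (D x) k (of_nat q * z) * ?c (\<Phi> k) y z)) (at z)"
    proof -
      have qK: "(\<lambda>_. of_nat q) \<in> carrier K" by (rule elliptic_carrier_const[OF lattice])
      have PD: "\<Phi> (D x) \<in> carrier W" using xW D_closed Phi_closed by blast
      \<comment> \<open>The y-coordinate of \<nabla> (\<Phi> x) = q \<Phi> (\<nabla> x). Expanding
        both sides by \<open>coords_D\<close> and \<open>coords_Phi\<close> gives the matrix
        condition.\<close>
      have eq: "?c (D (\<Phi> x)) y = (\<lambda>_. of_nat q) \<otimes>\<^bsub>K\<^esub> ?c (\<Phi> (D x)) y"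
        using coords_smult[OF fin bas qK PD y] D_Phi[OF xW] by simp
      have "eventually (\<lambda>z. deriv (?c (\<Phi> x) y) z + (\<Sum>k\<in>\<beta>. ?c (\<Phi> x) k z * ?c (D k) y z) =
          of_nat q * (\<Sum>k\<in>\<beta>. ?c (D x) k (of_nat q * z) * ?c (\<Phi> k) y z)) (cosparse UNIV)"
        using coords_D[OF Phi_closed[OF xW] y] coords_Phi[OF D_closed[OF xW] y]
          eventually_elliptic_mult[OF qK cl[OF PD y]]
        unfolding eq by eventually_elim simp
      then show ?thesis unfolding eventually_cosparse_UNIV by blast
    qed
    have "eventually (\<lambda>z. (\<Sum>k\<in>\<beta>. dilation q (?c (u x) k) z * ?c (\<Phi> k) y z) =
        (if x = y then 1 else 0)) (cosparse UNIV)"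
      using coords_Phi[OF u(1)[OF x] y]
    proof eventually_elim
      case (elim z)
      then show ?case using coords_basis[OF fin bas x y] u(2)[OF x]
        by (auto simp: dilation_def elliptic_field_def)
    qed
    then show "eventually (\<lambda>z. (\<Sum>k\<in>\<beta>. dilation q (?c (u x) k) z * ?c (\<Phi> k) y z) =
        (if x = y then 1 else 0)) (at z)"
      unfolding eventually_cosparse_UNIV by blast
  qed (use fin ne q_ge_2 ab(1) M(1) indep in auto)
  obtain v c N where c: "c \<noteq> 0" and N: "N > 0" and nz: "\<exists>x\<in>\<beta>. v x \<noteq> (\<lambda>_. 0)"
    and v: "\<forall>x\<in>\<beta>. v x nicely_meromorphic_on UNIV \<and>
        (\<forall>z. v x (z + of_nat N * (of_nat M * a)) = v x z \<and> v x (z + of_nat N * (of_nat M * b)) = v x z) \<and>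
        (\<forall>z0. eventually (\<lambda>z. deriv (v x) z = (\<Sum>k\<in>\<beta>. ?c (D x) k z * v k z)) (at z0)) \<and>
        (\<forall>z0. eventually (\<lambda>z. (\<Sum>k\<in>\<beta>. ?c (\<Phi> x) k z * v k z) = c * v x (of_nat q * z)) (at z0))"
    using ode.elliptic_eigensolution_exists by blast
  have "v x \<in> carrier K" if "x \<in> \<beta>" for x
    by (rule elliptic_carrierI[OF lattice ab(3), of _ "N * M"]) (use v that N M(1) in \<open>auto simp: mult.assoc\<close>)
  then show ?thesis
    unfolding eventually_cosparse_UNIV using c nz v by blast
qed

end

text \<open>H is the kernel of the functional l with values v on the basis. Horizontality gives l
  (\<nabla> w) = (l w)', and l (\<Phi> w) = c \<phi>(l w) with c nonzero shows that
  \<open>\<Phi> w\<close> lies in H exactly when w does. Both directions are used: the equality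
  \<Phi> H = H makes H a \<phi>-module again.\<close>

lemma stable_hyperplane_exists:
  assumes "dim > 0"
  shows "\<exists>H. VectorSpace.subspace K H W \<and> dim = Suc (vectorspace.dim K (vs H)) \<and> \<Phi> ` H = H \<and> D ` H \<subseteq> H"
proof -
  obtain \<beta> where \<beta>: "finite \<beta>" "basis \<beta>" using finite_basis_exists[OF fin_dim] by blast
  then have "\<beta> \<noteq> {}" using dim_basis assms by fastforce
  let ?c = "coords \<beta>"
  note cl = coords_closed[OF \<beta>]
  obtain v c where c: "c \<noteq> 0" and vK: "\<forall>x\<in>\<beta>. v x \<in> carrier K" and nz: "\<exists>x\<in>\<beta>. v x \<noteq> (\<lambda>_. 0)"
    and ode: "\<forall>x\<in>\<beta>. eventually (\<lambda>z. deriv (v x) z = (\<Sum>k\<in>\<beta>. ?c (D x) k z * v k z)) (cosparse UNIV) \<and>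
      eventually (\<lambda>z. (\<Sum>k\<in>\<beta>. ?c (\<Phi> x) k z * v k z) = c * v x (of_nat q * z)) (cosparse UNIV)"
    using eigenfunctional_exists[OF \<beta> \<open>\<beta> \<noteq> {}\<close>] by (elim exE conjE)
  note v = vK[rule_format] and vD = ode[rule_format, THEN conjunct1] and vPhi = ode[rule_format, THEN conjunct2]
  define l where "l = (\<lambda>w. remove_sings (\<lambda>z. \<Sum>x\<in>\<beta>. ?c w x z * v x z))"
  note l = coords_functional[OF \<beta> vK l_def]
  have K0: "\<zero>\<^bsub>K\<^esub> = (\<lambda>_. 0)" by (simp add: elliptic_field_def)
  have K0c: "(\<lambda>_. 0) \<in> carrier K" by (rule elliptic_carrier_const[OF lattice])
  have lD: "l (D w) = \<zero>\<^bsub>K\<^esub>" if w: "w \<in> carrier W" and lw: "l w = \<zero>\<^bsub>K\<^esub>" for w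
    unfolding K0
  proof (rule elliptic_eqI[OF l(1)[OF D_closed[OF w]] K0c])
    have "eventually (\<lambda>z. \<forall>x\<in>\<beta>. ?c (D w) x z = deriv (?c w x) z + (\<Sum>k\<in>\<beta>. ?c w k z * ?c (D k) x z)) (cosparse UNIV)"
      using \<beta>(1) coords_D[OF \<beta> w] by (intro eventually_ball_finite) auto
    moreover have "eventually (\<lambda>z. \<forall>x\<in>\<beta>. ?c w x analytic_on {z}) (cosparse UNIV)"
      using \<beta>(1) meromorphic_on_imp_analytic_cosparse[OF elliptic_carrierD(2)[OF cl[OF w]]]
      by (intro eventually_ball_finite) auto
    moreover have "eventually (\<lambda>z. \<forall>x\<in>\<beta>. v x analytic_on {z}) (cosparse UNIV)"
      using \<beta>(1) meromorphic_on_imp_analytic_cosparse[OF elliptic_carrierD(2)[OF v]]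
      by (intro eventually_ball_finite) auto
    moreover have "eventually (\<lambda>z. \<forall>x\<in>\<beta>. deriv (v x) z = (\<Sum>k\<in>\<beta>. ?c (D x) k z * v k z)) (cosparse UNIV)"
      using \<beta>(1) vD by (intro eventually_ball_finite) auto
    ultimately show "eventually (\<lambda>z. l (D w) z = 0) (cosparse UNIV)"
      using l(2)[OF D_closed[OF w]]
    proof eventually_elim
      case (elim z)
      \<comment> \<open>The sum before \<open>remove_sings\<close>. All its terms are analytic at z,
        so its derivative there is that of \<open>l w\<close> and can be taken termwise.\<close>
      let ?L = "\<lambda>z. \<Sum>x\<in>\<beta>. ?c w x z * v x z"
      have "?L analytic_on {z}" using elim(2,3) by (intro analytic_intros) auto
      then have "deriv ?L z = deriv (l w) z" unfolding l_def by simp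
      also have "\<dots> = 0" unfolding lw K0 by simp
      finally have dL: "deriv ?L z = 0" .
      have "l (D w) z = (\<Sum>x\<in>\<beta>. deriv (?c w x) z * v x z) + (\<Sum>x\<in>\<beta>. \<Sum>k\<in>\<beta>. ?c w k z * ?c (D k) x z * v x z)"
        using elim(1,5) by (simp add: distrib_right sum.distrib sum_distrib_right)
      also have "(\<Sum>x\<in>\<beta>. \<Sum>k\<in>\<beta>. ?c w k z * ?c (D k) x z * v x z) = (\<Sum>k\<in>\<beta>. ?c w k z * deriv (v k) z)"
        using elim(4) by (subst sum.swap) (simp add: sum_distrib_left mult.assoc)
      also have "(\<Sum>x\<in>\<beta>. deriv (?c w x) z * v x z) + (\<Sum>k\<in>\<beta>. ?c w k z * deriv (v k) z) =
          (\<Sum>x\<in>\<beta>. ?c w x z * deriv (v x) z + deriv (?c w x) z * v x z)"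
        by (simp add: sum.distrib add.commute)
      also have "\<dots> = deriv ?L z"
      proof (rule DERIV_imp_deriv[symmetric], rule DERIV_sum)
        fix x assume x: "x \<in> \<beta>"
        have "(?c w x has_field_derivative deriv (?c w x) z) (at z)" "(v x has_field_derivative deriv (v x) z) (at z)"
          using elim(2,3) x analytic_on_imp_differentiable_at DERIV_deriv_iff_field_differentiable by blast+
        from DERIV_mult[OF this]
        show "((\<lambda>z. ?c w x z * v x z) has_field_derivative
            ?c w x z * deriv (v x) z + deriv (?c w x) z * v x z) (at z)"
          by (simp add: algebra_simps)
      qed
      finally show ?case using dL by simp
    qed
  qed
  have lPhi: "eventually (\<lambda>z. l (\<Phi> w) z = c * l w (of_nat q * z)) (cosparse UNIV)" if w: "w \<in> carrier W" for w
  proof -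
    have "eventually (\<lambda>z. \<forall>x\<in>\<beta>. ?c (\<Phi> w) x z = (\<Sum>k\<in>\<beta>. ?c w k (of_nat q * z) * ?c (\<Phi> k) x z)) (cosparse UNIV)"
      using \<beta>(1) coords_Phi[OF \<beta> w] by (intro eventually_ball_finite) auto
    moreover have "eventually (\<lambda>z. \<forall>x\<in>\<beta>. (\<Sum>k\<in>\<beta>. ?c (\<Phi> x) k z * v k z) = c * v x (of_nat q * z)) (cosparse UNIV)"
      using \<beta>(1) vPhi by (intro eventually_ball_finite) auto
    ultimately show ?thesis
      using l(2)[OF Phi_closed[OF w]] eventually_cosparse_scaled[OF qc_nz l(2)[OF w]]
    proof eventually_elim
      case (elim z)
      have "l (\<Phi> w) z = (\<Sum>x\<in>\<beta>. \<Sum>k\<in>\<beta>. ?c w k (of_nat q * z) * ?c (\<Phi> k) x z * v x z)"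
        using elim(1,3) by (simp add: sum_distrib_right)
      also have "\<dots> = (\<Sum>k\<in>\<beta>. ?c w k (of_nat q * z) * (\<Sum>x\<in>\<beta>. ?c (\<Phi> k) x z * v x z))"
        by (subst sum.swap) (simp add: sum_distrib_left mult.assoc)
      also have "\<dots> = c * (\<Sum>k\<in>\<beta>. ?c w k (of_nat q * z) * v k (of_nat q * z))"
        using elim(2) by (simp add: sum_distrib_left mult.left_commute)
      finally show ?case using elim(4) by simp
    qed
  qed
  have lPhi0: "l (\<Phi> w) = \<zero>\<^bsub>K\<^esub> \<longleftrightarrow> l w = \<zero>\<^bsub>K\<^esub>" if w: "w \<in> carrier W" for w
  proof
    assume "l w = \<zero>\<^bsub>K\<^esub>"
    then have "eventually (\<lambda>z. l (\<Phi> w) z = 0) (cosparse UNIV)"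
      using lPhi[OF w] unfolding K0 by simp
    then show "l (\<Phi> w) = \<zero>\<^bsub>K\<^esub>"
      unfolding K0 by (rule elliptic_eqI[OF l(1)[OF Phi_closed[OF w]] K0c])
  next
    assume "l (\<Phi> w) = \<zero>\<^bsub>K\<^esub>"
    then have "eventually (\<lambda>z. l w (of_nat q * z) = 0) (cosparse UNIV)"
      using lPhi[OF w] c unfolding K0 by simp
    from eventually_cosparse_scaled[OF _ this, of "inverse (of_nat q)"]
    have "eventually (\<lambda>z. l w z = 0) (cosparse UNIV)" using qc_nz by (simp add: field_simps)
    then show "l w = \<zero>\<^bsub>K\<^esub>"
      unfolding K0 by (rule elliptic_eqI[OF l(1)[OF w] K0c])
  qed
  obtain x where x: "x \<in> \<beta>" "v x \<noteq> (\<lambda>_. 0)" using nz by blast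
  have xW: "x \<in> carrier W" using basis_carrier[OF \<beta>] x by blast
  have lx: "l x \<noteq> \<zero>\<^bsub>K\<^esub>" using l(5)[OF x(1)] x(2) K0 by simp
  let ?H = "{w \<in> carrier W. l w = \<zero>\<^bsub>K\<^esub>}"
  have lK: "l \<in> carrier W \<rightarrow> carrier K" using l(1) by blast
  have "\<Phi> ` ?H = ?H"
  proof
    show "\<Phi> ` ?H \<subseteq> ?H" using Phi_closed lPhi0 by blast
    show "?H \<subseteq> \<Phi> ` ?H"
    proof
      fix w assume w: "w \<in> ?H"
      then obtain u where "u \<in> carrier W" "\<Phi> u = w" using Phi_surj by blast
      then show "w \<in> \<Phi> ` ?H" using lPhi0[of u] w by blast
    qed
  qed
  moreover have "D ` ?H \<subseteq> ?H" using D_closed lD by blast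
  ultimately show ?thesis
    using hyperplane_dim[OF fin_dim lK l(3) l(4) xW lx] by blast
qed

lemma restrict_to_stable_subspace:
  assumes H: "VectorSpace.subspace K H W" and "\<Phi> ` H = H" "D ` H \<subseteq> H"
  shows "integrable_module \<Lambda>0 q (W\<lparr>carrier := H\<rparr>) \<Phi> D"
proof
  have "LinearCombinations.submodule K H W" using H by (simp add: VectorSpace.subspace_def)
  then have HW: "H \<subseteq> carrier W" by (rule LinearCombinations.submodule.subset)
  then have sub: "w \<in> carrier W" if "w \<in> H" for w using that by blast
  have "inj_on \<Phi> H" using phi HW unfolding phi_module_def bij_betw_def by (meson inj_on_subset)
  then show "phi_module \<Lambda>0 q (W\<lparr>carrier := H\<rparr>) \<Phi>"
    using subspace_is_vs[OF H] fin_dim_subspace[OF fin_dim H] assms(2) Phi_add Phi_smult sub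
    by (simp add: phi_module_def bij_betw_def)
  show "connection \<Lambda>0 (W\<lparr>carrier := H\<rparr>) D"
    using assms(3) D_add D_smult sub by (auto simp: connection_def)
  show "compatible q (W\<lparr>carrier := H\<rparr>) \<Phi> D"
    using D_Phi sub by (simp add: compatible_def)
qed (rule lattice q_ge_2)+

end

section \<open>The filtration\<close>

lemma stable_filtration_exists:
  assumes "integrable_module \<Lambda>0 q W \<Phi> D" "vectorspace.dim (elliptic_field \<Lambda>0) W = n"
  shows "\<exists>F. full_filtration \<Lambda>0 W n F \<and> (\<forall>i\<le>n. \<Phi> ` F i \<subseteq> F i \<and> D ` F i \<subseteq> F i)"
  using assms
proof (induction n arbitrary: W)
  case 0
  interpret integrable_module \<Lambda>0 q W \<Phi> D by (rule 0)
  obtain \<beta> where \<beta>: "finite \<beta>" "basis \<beta>" using finite_basis_exists[OF fin_dim] by blast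
  then have "\<beta> = {}" using dim_basis 0 by fastforce
  then have W0: "carrier W = {\<zero>\<^bsub>W\<^esub>}" using \<beta>(2) span_empty by (simp add: basis_def)
  have "full_filtration \<Lambda>0 W 0 (\<lambda>_. carrier W)"
    unfolding full_filtration_def
  proof (intro conjI allI impI)
    show "vectorspace.dim K (W\<lparr>carrier := carrier W\<rparr>) = i" if "i \<le> 0" for i using 0(2) that by simp
  qed (use W0 subspace_carrier in auto)
  then show ?case using Phi_closed D_closed by (intro exI[of _ "\<lambda>_. carrier W"]) auto
next
  case (Suc n)
  interpret integrable_module \<Lambda>0 q W \<Phi> D by (rule Suc)
  obtain H where H: "VectorSpace.subspace K H W" "dim = Suc (vectorspace.dim K (vs H))" "\<Phi> ` H = H" "D ` H \<subseteq> H"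
    using stable_hyperplane_exists Suc.prems(2) by auto
  have "LinearCombinations.submodule K H W" using H(1) by (simp add: VectorSpace.subspace_def)
  then have HW: "H \<subseteq> carrier W" by (rule LinearCombinations.submodule.subset)
  have "vectorspace.dim K (vs H) = n" using H(2) Suc.prems(2) by simp
  then obtain F where F: "full_filtration \<Lambda>0 (vs H) n F" "\<forall>i\<le>n. \<Phi> ` F i \<subseteq> F i \<and> D ` F i \<subseteq> F i"
    using Suc.IH[OF restrict_to_stable_subspace[OF H(1,3,4)]] by blast
  let ?F = "\<lambda>i. if i \<le> n then F i else carrier W"
  have "H \<noteq> carrier W" using H(2) by auto
  then have FH: "F n \<subset> carrier W" using F(1) HW by (auto simp: full_filtration_def)
  have "full_filtration \<Lambda>0 W (Suc n) ?F"
    unfolding full_filtration_def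
  proof (intro conjI allI impI)
    show "?F 0 = {\<zero>\<^bsub>W\<^esub>}" using F(1) by (simp add: full_filtration_def)
    show "?F (Suc n) = carrier W" by simp
    show "?F i \<subset> ?F (Suc i)" if "i < Suc n" for i
      using F(1) FH that by (cases "i = n") (auto simp: full_filtration_def)
    fix i assume i: "i \<le> Suc n"
    show "VectorSpace.subspace K (?F i) W"
      using F(1) i subspace_of_subspace[OF H(1)] subspace_carrier by (auto simp: full_filtration_def)
    show "vectorspace.dim K (W\<lparr>carrier := ?F i\<rparr>) = i"
      using F(1) i Suc.prems(2) by (auto simp: full_filtration_def le_Suc_eq)
  qed
  moreover have "\<forall>i\<le>Suc n. \<Phi> ` ?F i \<subseteq> ?F i \<and> D ` ?F i \<subseteq> ?F i"
    using F(2) Phi_closed D_closed by auto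
  ultimately show ?case by blast
qed

theorem theorem7p2:
  fixes \<Lambda>0 :: "complex set" and q :: nat
    and W :: "(complex \<Rightarrow> complex, 'w) module" and \<Phi> :: "'w \<Rightarrow> 'w"
  assumes "complex_lattice \<Lambda>0"
    and "q \<ge> 2"
    and "phi_module \<Lambda>0 q W \<Phi>"
    and "integrable_phi_module \<Lambda>0 q W \<Phi>"
  shows "solvable_phi_module \<Lambda>0 W \<Phi> \<and>
    (\<forall>D. connection \<Lambda>0 W D \<and> compatible q W \<Phi> D \<longrightarrow>
       (\<exists>n F. full_filtration \<Lambda>0 W n F \<and>
          (\<forall>i\<le>n. \<Phi> ` F i \<subseteq> F i \<and> D ` F i \<subseteq> F i)))"
proof -
  have "\<exists>n F. full_filtration \<Lambda>0 W n F \<and> (\<forall>i\<le>n. \<Phi> ` F i \<subseteq> F i \<and> D ` F i \<subseteq> F i)"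
    if "connection \<Lambda>0 W D" "compatible q W \<Phi> D" for D
    using stable_filtration_exists[OF integrable_module.intro[OF assms(1-3) that] refl] by blast
  \<comment> \<open>Solvability is the second assertion for a connection that integrability
    provides, with stability under \<nabla> forgotten.\<close>
  then show ?thesis
    using assms(4) unfolding solvable_phi_module_def integrable_phi_module_def by meson
qed

end
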